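(* Let $a,b>0$ be real parameters, and let $L$, $S$, $M$ be the (unbounded) linear operators in $\mathcal{L}^2=L^2(-\pi,\pi)$ defined in the context. If $2a+b<2$, then $L$ is a closed operator with closed range, and $L=SM$ (equality of unbounded operators, including equality of domains, where $\mathfrak{D}(SM)=\{y\in\mathfrak{D}(M): My\in\mathfrak{D}(S)\}$).
   Context: $\mathcal{L}^2$ denotes the Lebesgue space $L^2(-\pi,\pi)$ of complex-valued scalar functions; $\mathfrak{D}(T)$ and $\mathfrak{R}(T)$ denote the domain and range of a linear operator $T$. The parameters $a,b$ are real and positive. The operator $L$ in $\mathcal{L}^2$ is $$(Ly)(x)=\frac{d}{dx}\left((1-a\cos x)\,y(x)+b\sin x\cdot\frac{dy(x)}{dx}\right),$$ with domain $\mathfrak{D}(L)$ consisting of all absolutely continuous functions $y$ on $[-\pi,\pi]$ with $y(-\pi)=y(\pi)$ such that $Ly\in\mathcal{L}^2$ (the outer derivative being understood in the distributional sense on $(-\pi,\pi)$, i.e. $(1-a\cos x)y+b\sin x\,y'$ is absolutely continuous with derivative in $\mathcal{L}^2$). The operator $S$ in $\mathcal{L}^2$ is $(Sy)(x)=y'(x)$, with domain consisting of all absolutely continuous functions $y$ on $[-\pi,\pi]$ with $y'\in\mathcal{L}^2$ and $y(-\pi)=y(\pi)$. The operator $M$ in $\mathcal{L}^2$ is $$(My)(x)=(1-a\cos x)\,y(x)+b\sin x\cdot\frac{dy(x)}{dx},$$ with domain consisting of all $y\in\mathcal{L}^2$ that are (locally) absolutely continuous on $(-\pi,0)\cup(0,\pi)$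 and such that $My\in\mathcal{L}^2$ (functions in $\mathfrak{D}(M)$ may be unbounded near $0$; for example $x^{-1/3}\in\mathfrak{D}(M)$). *)

theory Defs
  imports "HOL-Analysis.Analysis"
begin

section \<open>The Hilbert space of square integrable functions on the interval from -pi to pi\<close>

abbreviation leb_pi :: "real measure" where
  "leb_pi \<equiv> lebesgue_on {-pi<..<pi}"

definition square_integrable :: "(real \<Rightarrow> complex) \<Rightarrow> bool" where
  "square_integrable f \<longleftrightarrow>
     f \<in> borel_measurable leb_pi \<and> integrable leb_pi (\<lambda>x. (cmod (f x))\<^sup>2)"

definition L2_rel :: "(real \<Rightarrow> complex) \<Rightarrow> (real \<Rightarrow> complex) \<Rightarrow> bool" where
  "L2_rel f g \<longleftrightarrow>
     square_integrable f \<and> square_integrable g \<and> (AE x in leb_pi. f x = g x)"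

lemma square_integrable_zero: "square_integrable (\<lambda>x. 0)"
  by (simp add: square_integrable_def)

lemma L2_rel_refl: "L2_rel f f \<longleftrightarrow> square_integrable f"
  by (simp add: L2_rel_def)

lemma part_equivp_L2_rel: "part_equivp L2_rel"
proof (rule part_equivpI)
  show "\<exists>f. L2_rel f f"
    using L2_rel_refl square_integrable_zero by blast
  show "symp L2_rel"
  proof (rule sympI)
    fix f g assume fg: "L2_rel f g"
    then have "AE x in leb_pi. f x = g x"
      by (simp add: L2_rel_def)
    then have "AE x in leb_pi. g x = f x"
      by eventually_elim simp
    with fg show "L2_rel g f"
      by (simp add: L2_rel_def)
  qed
  show "transp L2_rel"
  proof (rule transpI)
    fix f g h assume fg: "L2_rel f g" and gh: "L2_rel g h"
    have "AE x in leb_pi. f x = h x"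
      using fg[unfolded L2_rel_def, THEN conjunct2, THEN conjunct2]
        gh[unfolded L2_rel_def, THEN conjunct2, THEN conjunct2]
      by eventually_elim simp
    with fg gh show "L2_rel f h"
      by (simp add: L2_rel_def)
  qed
qed

quotient_type L2 = "real \<Rightarrow> complex" / partial: L2_rel
  morphisms rep_L2 abs_L2
  by (rule part_equivp_L2_rel)

lemma square_integrable_cmult:
  assumes "square_integrable f"
  shows "square_integrable (\<lambda>x. c * f x)"
proof -
  have "f \<in> borel_measurable leb_pi" "integrable leb_pi (\<lambda>x. (cmod (f x))\<^sup>2)"
    using assms by (simp_all add: square_integrable_def)
  then show ?thesis
    unfolding square_integrable_def norm_mult power_mult_distrib
    by (intro conjI borel_measurable_times borel_measurable_const integrable_mult_right)
qed

lemma square_integrable_scaleR: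
  assumes "square_integrable f"
  shows "square_integrable (\<lambda>x. r *\<^sub>R f x)"
  using square_integrable_cmult[OF assms, of "of_real r"] by (simp add: scaleR_conv_of_real)

lemma square_integrable_add:
  assumes "square_integrable f" "square_integrable g"
  shows "square_integrable (\<lambda>x. f x + g x)"
proof -
  have meas: "f \<in> borel_measurable leb_pi" "g \<in> borel_measurable leb_pi"
    and int: "integrable leb_pi (\<lambda>x. (cmod (f x))\<^sup>2)" "integrable leb_pi (\<lambda>x. (cmod (g x))\<^sup>2)"
    using assms by (auto simp: square_integrable_def)
  have "integrable leb_pi (\<lambda>x. (cmod (f x + g x))\<^sup>2)"
  proof (rule Bochner_Integration.integrable_bound)
    show "integrable leb_pi (\<lambda>x. 2 * (cmod (f x))\<^sup>2 + 2 * (cmod (g x))\<^sup>2)"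
      using int by auto
    show "(\<lambda>x. (cmod (f x + g x))\<^sup>2) \<in> borel_measurable leb_pi"
      by (intro borel_measurable_power measurable_compose[OF borel_measurable_add[OF meas] borel_measurable_norm])
    have "(cmod (u + v))\<^sup>2 \<le> 2 * (cmod u)\<^sup>2 + 2 * (cmod v)\<^sup>2" for u v
    proof -
      have "(cmod (u + v))\<^sup>2 \<le> (cmod u + cmod v)\<^sup>2"
        by (intro power_mono norm_triangle_ineq norm_ge_zero)
      also have "\<dots> \<le> 2 * (cmod u)\<^sup>2 + 2 * (cmod v)\<^sup>2"
        using sum_squares_bound[of "cmod u" "cmod v"] by (simp add: power2_sum)
      finally show ?thesis .
    qed
    then show "AE x in leb_pi. norm ((cmod (f x + g x))\<^sup>2)
        \<le> norm (2 * (cmod (f x))\<^sup>2 + 2 * (cmod (g x))\<^sup>2)"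
      by simp
  qed
  with meas show ?thesis
    by (simp add: square_integrable_def)
qed

lemma square_integrable_inner:
  assumes "square_integrable f" "square_integrable g"
  shows "integrable leb_pi (\<lambda>x. inner (f x) (g x))"
proof -
  have meas: "f \<in> borel_measurable leb_pi" "g \<in> borel_measurable leb_pi"
    and int: "integrable leb_pi (\<lambda>x. (cmod (f x))\<^sup>2)" "integrable leb_pi (\<lambda>x. (cmod (g x))\<^sup>2)"
    using assms by (auto simp: square_integrable_def)
  show ?thesis
  proof (rule Bochner_Integration.integrable_bound)
    show "integrable leb_pi (\<lambda>x. (cmod (f x))\<^sup>2 + (cmod (g x))\<^sup>2)"
      using int by auto
    show "(\<lambda>x. inner (f x) (g x)) \<in> borel_measurable leb_pi"
      using meas by (rule borel_measurable_inner)
    have "norm (inner u v) \<le> norm ((cmod u)\<^sup>2 + (cmod v)\<^sup>2)" for u v :: complex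
    proof -
      have "norm (inner u v) \<le> cmod u * cmod v"
        using Cauchy_Schwarz_ineq2[of u v] by simp
      also have "\<dots> \<le> (cmod u)\<^sup>2 + (cmod v)\<^sup>2"
        using sum_squares_bound[of "cmod u" "cmod v"]
          mult_nonneg_nonneg[OF norm_ge_zero[of u] norm_ge_zero[of v]] by linarith
      finally show ?thesis by simp
    qed
    then show "AE x in leb_pi. norm (inner (f x) (g x)) \<le> norm ((cmod (f x))\<^sup>2 + (cmod (g x))\<^sup>2)"
      by simp
  qed
qed

lemma L2_rel_integral_inner:
  assumes "L2_rel f f'" "L2_rel g g'"
  shows "(LINT x|leb_pi. inner (f x) (g x)) = (LINT x|leb_pi. inner (f' x) (g' x))"
proof (rule integral_cong_AE)
  show "(\<lambda>x. inner (f x) (g x)) \<in> borel_measurable leb_pi"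
    "(\<lambda>x. inner (f' x) (g' x)) \<in> borel_measurable leb_pi"
    using assms unfolding L2_rel_def
    by (blast intro: square_integrable_inner borel_measurable_integrable)+
  show "AE x in leb_pi. inner (f x) (g x) = inner (f' x) (g' x)"
    using assms[unfolded L2_rel_def, THEN conjunct2, THEN conjunct2]
    by eventually_elim simp
qed

instantiation L2 :: real_vector
begin

lift_definition zero_L2 :: L2 is "\<lambda>x. 0"
  by (simp add: L2_rel_refl square_integrable_zero)

lift_definition plus_L2 :: "L2 \<Rightarrow> L2 \<Rightarrow> L2" is "\<lambda>f g x. f x + g x"
  by (auto simp: L2_rel_def intro: square_integrable_add)

lift_definition uminus_L2 :: "L2 \<Rightarrow> L2" is "\<lambda>f x. - f x"
  using square_integrable_cmult[where c = "-1"] by (auto simp: L2_rel_def)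

lift_definition minus_L2 :: "L2 \<Rightarrow> L2 \<Rightarrow> L2" is "\<lambda>f g x. f x - g x"
  using square_integrable_add[OF _ square_integrable_cmult[where c = "-1"]]
  by (auto simp: L2_rel_def)

lift_definition scaleR_L2 :: "real \<Rightarrow> L2 \<Rightarrow> L2" is "\<lambda>r f x. r *\<^sub>R f x"
  by (auto simp: L2_rel_def intro: square_integrable_scaleR)

instance
proof
  fix u v w :: L2 and r s :: real
  show "u + v + w = u + (v + w)"
    by transfer (auto simp: L2_rel_def add.assoc intro!: square_integrable_add)
  show "u + v = v + u"
    by transfer (auto simp: L2_rel_def add.commute intro!: square_integrable_add)
  show "0 + u = u"
    by transfer (auto simp: L2_rel_def)
  show "- u + u = 0"
    by transfer (auto simp: L2_rel_def square_integrable_zero)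
  show "u - v = u + - v"
    by transfer (use square_integrable_add[OF _ square_integrable_cmult[where c = "-1"]] in
        \<open>auto simp: L2_rel_def\<close>)
  show "r *\<^sub>R (u + v) = r *\<^sub>R u + r *\<^sub>R v"
    by transfer (auto simp: L2_rel_def scaleR_right_distrib
        intro!: square_integrable_add square_integrable_scaleR)
  show "(r + s) *\<^sub>R u = r *\<^sub>R u + s *\<^sub>R u"
    by transfer (auto simp: L2_rel_def scaleR_left_distrib
        intro!: square_integrable_add square_integrable_scaleR)
  show "r *\<^sub>R s *\<^sub>R u = (r * s) *\<^sub>R u"
    by transfer (auto simp: L2_rel_def intro!: square_integrable_scaleR)
  show "1 *\<^sub>R u = u"
    by transfer (auto simp: L2_rel_def)
qed

end

text \<open>
  The real inner product below is the real part of the usual Hermitian one, so that it induces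
  the usual norm; multiplication by complex scalars is provided separately.
\<close>

instantiation L2 :: real_inner
begin

lift_definition inner_L2 :: "L2 \<Rightarrow> L2 \<Rightarrow> real" is "\<lambda>f g. LINT x|leb_pi. inner (f x) (g x)"
  by (rule L2_rel_integral_inner)

lift_definition norm_L2 :: "L2 \<Rightarrow> real" is "\<lambda>f. sqrt (LINT x|leb_pi. (cmod (f x))\<^sup>2)"
  using L2_rel_integral_inner by (simp add: dot_square_norm[symmetric])

definition dist_L2 :: "L2 \<Rightarrow> L2 \<Rightarrow> real" where
  "dist_L2 u v = norm (u - v)"

definition sgn_L2 :: "L2 \<Rightarrow> L2" where
  "sgn_L2 u = u /\<^sub>R norm u"

definition uniformity_L2 :: "(L2 \<times> L2) filter" where
  "uniformity_L2 = (INF e\<in>{0<..}. principal {(x, y). dist x y < e})"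

definition open_L2 :: "L2 set \<Rightarrow> bool" where
  "open_L2 U = (\<forall>x\<in>U. \<forall>\<^sub>F (x', y) in uniformity. x' = x \<longrightarrow> y \<in> U)"

instance
proof
  fix u v w :: L2 and r :: real
  show "sgn u = u /\<^sub>R norm u"
    by (rule sgn_L2_def)
  show "dist u v = norm (u - v)"
    by (rule dist_L2_def)
  show "(uniformity :: (L2 \<times> L2) filter) = (INF e\<in>{0<..}. principal {(x, y). dist x y < e})"
    by (rule uniformity_L2_def)
  show "open U = (\<forall>x\<in>U. \<forall>\<^sub>F (x', y) in uniformity. x' = x \<longrightarrow> y \<in> U)" for U :: "L2 set"
    by (rule open_L2_def)
  show "inner u v = inner v u"
    by transfer (simp add: inner_commute)
  show "inner (u + v) w = inner u w + inner v w"
    by transfer (simp add: inner_add_left L2_rel_refl square_integrable_inner)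
  show "inner (r *\<^sub>R u) v = r * inner u v"
    by transfer (simp add: L2_rel_refl)
  show "0 \<le> inner u u"
    by transfer simp
  show "inner u u = 0 \<longleftrightarrow> u = 0"
  proof transfer
    fix f :: "real \<Rightarrow> complex"
    assume "L2_rel f f"
    then have f: "square_integrable f"
      by (simp add: L2_rel_refl)
    have "(LINT x|leb_pi. inner (f x) (f x)) = 0 \<longleftrightarrow> (AE x in leb_pi. inner (f x) (f x) = 0)"
      by (rule integral_nonneg_eq_0_iff_AE[OF square_integrable_inner[OF f f]]) simp
    also have "\<dots> \<longleftrightarrow> L2_rel f (\<lambda>x. 0)"
      by (simp add: L2_rel_def f square_integrable_zero)
    finally show "(LINT x|leb_pi. inner (f x) (f x)) = 0 \<longleftrightarrow> L2_rel f (\<lambda>x. 0)" .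
  qed
  show "norm u = sqrt (inner u u)"
    by transfer (simp add: dot_square_norm)
qed

end

lift_definition scaleC_L2 :: "complex \<Rightarrow> L2 \<Rightarrow> L2" is "\<lambda>c f x. c * f x"
  by (auto simp: L2_rel_def intro: square_integrable_cmult)

definition represents :: "(real \<Rightarrow> complex) \<Rightarrow> L2 \<Rightarrow> bool" where
  "represents f u \<longleftrightarrow> square_integrable f \<and> abs_L2 f = u"


section \<open>Unbounded operators as graphs\<close>

text \<open>
  An operator is its graph, a set of pairs (argument, value): its domain is \<^const>\<open>Domain\<close>, its
  range is \<^const>\<open>Range\<close>, equality includes equality of domains, and the operator product
  \<open>S M\<close> is the relational composition \<open>M O S\<close> (in this order).
\<close>

definition linear_operator :: "(L2 \<times> L2) set \<Rightarrow> bool" where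
  "linear_operator T \<longleftrightarrow>
     single_valued T \<and> (0, 0) \<in> T \<and>
     (\<forall>u v u' v'. (u, v) \<in> T \<and> (u', v') \<in> T \<longrightarrow> (u + u', v + v') \<in> T) \<and>
     (\<forall>c u v. (u, v) \<in> T \<longrightarrow> (scaleC_L2 c u, scaleC_L2 c v) \<in> T)"

definition closed_operator :: "(L2 \<times> L2) set \<Rightarrow> bool" where
  "closed_operator T \<longleftrightarrow> linear_operator T \<and> closed T"


section \<open>Absolutely continuous functions\<close>

text \<open>
  A finite set \<open>D\<close> of pairs \<open>(u, v)\<close> encodes a finite family of non-overlapping compact
  subintervals \<open>{u..v}\<close> of \<open>S\<close>.
\<close>

definition abs_cont_on :: "real set \<Rightarrow> (real \<Rightarrow> complex) \<Rightarrow> bool" where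
  "abs_cont_on S f \<longleftrightarrow>
     (\<forall>\<epsilon>>0. \<exists>\<delta>>0. \<forall>D.
        finite D \<and> (\<forall>(u, v)\<in>D. u \<le> v \<and> {u..v} \<subseteq> S) \<and>
        disjoint_family_on (\<lambda>(u, v). {u<..<v}) D \<and> (\<Sum>(u, v)\<in>D. v - u) < \<delta>
        \<longrightarrow> (\<Sum>(u, v)\<in>D. cmod (f v - f u)) < \<epsilon>)"

definition locally_abs_cont_on :: "real set \<Rightarrow> (real \<Rightarrow> complex) \<Rightarrow> bool" where
  "locally_abs_cont_on S f \<longleftrightarrow> (\<forall>c d. c \<le> d \<and> {c..d} \<subseteq> S \<longrightarrow> abs_cont_on {c..d} f)"


section \<open>The operators\<close>

text \<open>
  The classical derivative. An absolutely continuous function is differentiable almost everywhere,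
  so the unspecified values of \<^const>\<open>vector_derivative\<close> at points of non-differentiability do not
  affect the classes in \<^typ>\<open>L2\<close> below.
\<close>

abbreviation vderiv :: "(real \<Rightarrow> complex) \<Rightarrow> real \<Rightarrow> complex" where
  "vderiv y x \<equiv> vector_derivative y (at x)"

definition m_expr :: "real \<Rightarrow> real \<Rightarrow> (real \<Rightarrow> complex) \<Rightarrow> real \<Rightarrow> complex" where
  "m_expr a b y x = of_real (1 - a * cos x) * y x + of_real (b * sin x) * vderiv y x"

text \<open>
  In \<open>L_op\<close>, the expression \<open>m_expr a b y\<close>, which is defined almost everywhere only, is
  required to have an absolutely continuous representative \<open>w\<close>.
\<close>

definition L_op :: "real \<Rightarrow> real \<Rightarrow> (L2 \<times> L2) set" where
  "L_op a b = {(u, v). \<exists>y w.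
     abs_cont_on {-pi..pi} y \<and> y (-pi) = y pi \<and>
     abs_cont_on {-pi..pi} w \<and> (AE x in leb_pi. m_expr a b y x = w x) \<and>
     represents y u \<and> represents (vderiv w) v}"

definition S_op :: "(L2 \<times> L2) set" where
  "S_op = {(u, v). \<exists>y.
     abs_cont_on {-pi..pi} y \<and> y (-pi) = y pi \<and>
     represents y u \<and> represents (vderiv y) v}"

definition M_op :: "real \<Rightarrow> real \<Rightarrow> (L2 \<times> L2) set" where
  "M_op a b = {(u, v). \<exists>y.
     locally_abs_cont_on ({-pi<..<0} \<union> {0<..<pi}) y \<and>
     represents y u \<and> represents (m_expr a b y) v}"


text \<open>
  \<open>S_op\<close> and \<open>M_op\<close> are single-valued: an almost-everywhere class has at most one continuous
  representative on an open set.
\<close>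

lemma abs_cont_on_imp_continuous_on:
  assumes "abs_cont_on {c..d} f"
  shows "continuous_on {c..d} f"
proof -
  have "\<exists>\<delta>>0. \<forall>x'\<in>{c..d}. dist x' x < \<delta> \<longrightarrow> dist (f x') (f x) < e"
    if x: "x \<in> {c..d}" and e: "e > 0" for x e
  proof -
    obtain \<delta> where "\<delta> > 0" and *: "\<forall>D. finite D \<and> (\<forall>(u, v)\<in>D. u \<le> v \<and> {u..v} \<subseteq> {c..d}) \<and>
        disjoint_family_on (\<lambda>(u, v). {u<..<v}) D \<and> (\<Sum>(u, v)\<in>D. v - u) < \<delta>
        \<longrightarrow> (\<Sum>(u, v)\<in>D. cmod (f v - f u)) < e"
      using assms[unfolded abs_cont_on_def, rule_format, OF e] by blast
    have one: "cmod (f v - f u) < e" if "u \<le> v" "u \<in> {c..d}" "v \<in> {c..d}" "v - u < \<delta>" for u v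
      using *[rule_format, of "{(u, v)}"] that by (simp add: disjoint_family_on_def)
    have "dist (f x') (f x) < e" if x': "x' \<in> {c..d}" "dist x' x < \<delta>" for x'
    proof (cases "x \<le> x'")
      case True
      then show ?thesis using one[of x x'] x x' by (simp add: dist_norm)
    next
      case False
      then show ?thesis using one[of x' x] x x' by (simp add: dist_norm norm_minus_commute)
    qed
    with \<open>\<delta> > 0\<close> show ?thesis by blast
  qed
  then show ?thesis
    unfolding continuous_on_iff by blast
qed

lemma locally_abs_cont_on_imp_continuous_on:
  assumes "locally_abs_cont_on S f" "open S"
  shows "continuous_on S f"
proof -
  have "isCont f x" if x: "x \<in> S" for x
  proof -
    obtain e where e: "e > 0" "cball x e \<subseteq> S"
      using assms(2) x open_contains_cball by blast
    then have "{x - e..x + e} \<subseteq> S"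
      by (simp add: cball_eq_atLeastAtMost)
    then have "continuous_on {x - e..x + e} f"
      using assms(1) e(1) abs_cont_on_imp_continuous_on
      unfolding locally_abs_cont_on_def by simp
    then show ?thesis
      by (rule continuous_on_interior) (use e(1) in simp)
  qed
  then show ?thesis
    by (simp add: continuous_at_imp_continuous_on)
qed

lemma AE_eq_imp_eq_on_open:
  fixes f g :: "real \<Rightarrow> complex"
  assumes ae: "AE x in leb_pi. f x = g x" and S: "open S" "S \<subseteq> {-pi<..<pi}"
    and cont: "continuous_on S f" "continuous_on S g" and x: "x \<in> S"
  shows "f x = g x"
proof (rule ccontr)
  assume "f x \<noteq> g x"
  define N where "N = {x\<in>S. f x \<noteq> g x}"
  have "N = S \<inter> (\<lambda>x. f x - g x) -` (- {0})"
    unfolding N_def by (simp add: set_eq_iff)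
  moreover have "open (S \<inter> (\<lambda>x. f x - g x) -` (- {0}))"
    by (intro continuous_open_preimage[OF continuous_on_diff[OF cont] S(1)] open_Compl closed_singleton)
  ultimately have "open N" by simp
  obtain N' where N': "N' \<in> null_sets leb_pi" "{x \<in> space leb_pi. f x \<noteq> g x} \<subseteq> N'"
    using ae unfolding eventually_ae_filter by blast
  have "N' \<in> null_sets lebesgue"
    using N'(1) by (simp add: null_sets_restrict_space)
  then have "negligible N'"
    by (simp add: negligible_iff_null_sets)
  moreover have "N \<subseteq> N'"
  proof
    fix z assume "z \<in> N"
    then have "z \<in> space leb_pi" "f z \<noteq> g z"
      using S(2) unfolding N_def by (simp_all add: subset_iff)
    then show "z \<in> N'"
      using N'(2) by blast
  qed
  ultimately have "negligible N"
    by (rule negligible_subset)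
  moreover have "x \<in> N"
    using x \<open>f x \<noteq> g x\<close> by (simp add: N_def)
  ultimately show False
    using \<open>open N\<close> open_not_negligible by blast
qed

lemma vderiv_cong_open:
  assumes "open S" "\<And>x. x \<in> S \<Longrightarrow> f x = g x" "x \<in> S"
  shows "vderiv f x = vderiv g x"
  by (rule vector_derivative_cong_eq) (use assms in \<open>auto simp: eventually_nhds\<close>)

lemma represents_eq_iff:
  assumes "represents f u" "represents g v"
  shows "u = v \<longleftrightarrow> (AE x in leb_pi. f x = g x)"
  using assms Quotient_rel[OF Quotient_L2, of f g]
  by (auto simp: represents_def L2_rel_def)

lemma single_valued_S_op: "single_valued S_op"
proof (rule single_valuedI)
  fix u v v'
  assume "(u, v) \<in> S_op" "(u, v') \<in> S_op"
  then obtain y y' where *: "abs_cont_on {-pi..pi} y" "abs_cont_on {-pi..pi} y'"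
    "represents y u" "represents y' u" "represents (vderiv y) v" "represents (vderiv y') v'"
    unfolding S_op_def by auto
  have cont: "continuous_on {-pi<..<pi} y" "continuous_on {-pi<..<pi} y'"
    using *(1,2)[THEN abs_cont_on_imp_continuous_on]
    by (auto elim!: continuous_on_subset)
  have "AE x in leb_pi. y x = y' x"
    using represents_eq_iff[OF *(3,4)] by simp
  then have eq: "y x = y' x" if "x \<in> {-pi<..<pi}" for x
    using AE_eq_imp_eq_on_open[OF _ _ _ cont that] by simp
  have "vderiv y x = vderiv y' x" if "x \<in> {-pi<..<pi}" for x
    using vderiv_cong_open[of "{-pi<..<pi}" y y' x] eq that by simp
  then have "AE x in leb_pi. vderiv y x = vderiv y' x"
    by (intro AE_I2) simp
  then show "v = v'"
    using represents_eq_iff[OF *(5,6)] by simp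
qed

lemma single_valued_M_op: "single_valued (M_op a b)"
proof (rule single_valuedI)
  fix u v v'
  assume "(u, v) \<in> M_op a b" "(u, v') \<in> M_op a b"
  then obtain y y' where *: "locally_abs_cont_on ({-pi<..<0} \<union> {0<..<pi}) y"
    "locally_abs_cont_on ({-pi<..<0} \<union> {0<..<pi}) y'"
    "represents y u" "represents y' u" "represents (m_expr a b y) v" "represents (m_expr a b y') v'"
    unfolding M_op_def by auto
  let ?S = "{-pi<..<0} \<union> {0<..<pi}"
  have opn: "open ?S" by auto
  have sub: "?S \<subseteq> {-pi<..<pi}"
    using pi_gt_zero by (simp add: subset_iff)
  have cont: "continuous_on ?S y" "continuous_on ?S y'"
    using *(1,2) opn locally_abs_cont_on_imp_continuous_on by blast+
  have "AE x in leb_pi. y x = y' x"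
    using represents_eq_iff[OF *(3,4)] by simp
  then have eq: "y x = y' x" if "x \<in> ?S" for x
    using AE_eq_imp_eq_on_open[OF _ opn sub cont that] by simp
  have m: "m_expr a b y x = m_expr a b y' x" if "x \<in> ?S" for x
    using vderiv_cong_open[OF opn eq that] eq[OF that] by (simp add: m_expr_def)
  have "AE x in leb_pi. m_expr a b y x = m_expr a b y' x"
  proof (rule AE_I')
    show "{0} \<in> null_sets leb_pi"
      by (simp add: null_sets_restrict_space)
    show "{x \<in> space leb_pi. m_expr a b y x \<noteq> m_expr a b y' x} \<subseteq> {0}"
    proof
      fix x assume "x \<in> {x \<in> space leb_pi. m_expr a b y x \<noteq> m_expr a b y' x}"
      then have "-pi < x" "x < pi" "x \<notin> ?S"
        using m by (simp_all, blast)
      then show "x \<in> {0}" by simp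
    qed
  qed
  then show "v = v'"
    using represents_eq_iff[OF *(5,6)] by simp
qed

end

theory Submission
  imports Defs
begin

text \<open>
  With \<open>p = 1 - a cos x\<close>, the homogeneous equation \<open>p y + b sin x y' = 0\<close> has on each of \<open>(-pi, 0)\<close> and
  \<open>(0, pi)\<close> the solution \<open>hom\<close>, which behaves like \<open>\<bar>x\<bar>\<close> to the power \<open>- (1 - a) / b\<close> near \<open>0\<close>; it is not
  square integrable there because \<open>2 a + b < 2\<close>. So for absolutely continuous \<open>w\<close> with square integrable
  derivative, the equation \<open>M y = w\<close> has at most one square integrable solution, namely
  \<open>y = w / p - hom * \<integral> (w / p)' / hom\<close> with the integral taken from \<open>0\<close>. The weighted inequality
  \<open>\<integral> 1 / hom\<^sup>2 \<le> K \<bar>sin x\<bar> / hom\<^sup>2\<close> and Cauchy-Schwarz bound the second term by a multiple of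
  \<open>\<bar>sin x\<bar>\<close> to the power \<open>1/2\<close>, and \<open>y'\<close> by a multiple of the reciprocal, which is integrable. Hence \<open>y\<close> is
  absolutely continuous on \<open>[-pi, pi]\<close> and equals \<open>w / (1 + a)\<close> at the end points, which gives \<open>L = S M\<close>.
  Moreover \<open>L\<close> consists of the pairs \<open>(T v + c e, v)\<close> with \<open>v\<close> of mean zero, \<open>c\<close> complex, \<open>T\<close>
  (below \<open>sol_op\<close>) bounded linear and \<open>e\<close> (below \<open>sol_one\<close>) fixed, so that \<open>L\<close> and its range are closed.
\<close>

section \<open>Total variation of absolutely continuous functions\<close>

text \<open>The condition 2 a + b < 2 enters in three ways: it gives a < 1, so that \<open>p\<close>
  is bounded below by 1 - a; it is equivalent to \<alpha> > 1/2, which expels \<open>hom\<close>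
  from the Hilbert space on either side of 0; and it gives \<bar>b - 2 a\<bar> < 2, which makes the
  constant of the weighted inequality positive. The two sides of 0 are decoupled: on each one the
  free constant is fixed by square integrability near 0 alone, so no matching condition is imposed,
  and yet both branches meet at w(0) / (1 - a). At \<open>-pi\<close> and \<open>pi\<close> the
  function \<open>hom\<close> tends to 0 instead. Hence the values of y and w there differ by one
  common factor, and periodicity demanded of y (by L) or of w (by S) amounts to the same. The
  definition of absolute continuity speaks of finite families of intervals, while the argument
  integrates derivatives. The bridge is Jordan decomposition followed by Radon-Nikodym for the
  Stieltjes measures of the monotone parts. In the other direction it is enough to bound increments
  by integrals of an integrable majorant, and this is how the singular points are crossed.\<close>

definition nonoverlapping :: "real \<Rightarrow> real \<Rightarrow> (real \<times> real) set \<Rightarrow> bool" where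
  "nonoverlapping c d D \<longleftrightarrow> finite D \<and> (\<forall>(u, v)\<in>D. c \<le> u \<and> u \<le> v \<and> v \<le> d) \<and>
     disjoint_family_on (\<lambda>(u, v). {u<..<v}) D"

lemma abs_cont_on_iff_nonoverlapping:
  "abs_cont_on {c..d} f \<longleftrightarrow>
     (\<forall>\<epsilon>>0. \<exists>\<delta>>0. \<forall>D. nonoverlapping c d D \<and> (\<Sum>(u, v)\<in>D. v - u) < \<delta>
        \<longrightarrow> (\<Sum>(u, v)\<in>D. cmod (f v - f u)) < \<epsilon>)"
proof -
  have eq: "(\<forall>(u, v)\<in>D. u \<le> v \<and> {u..v} \<subseteq> {c..d}) \<longleftrightarrow> (\<forall>(u, v)\<in>D. c \<le> u \<and> u \<le> v \<and> v \<le> d)"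
    for D :: "(real \<times> real) set"
    by fastforce
  show ?thesis
    unfolding abs_cont_on_def nonoverlapping_def eq by (simp add: conj_assoc)
qed

text \<open>Families are sets of pairs, so equal degenerate intervals with different indices would
  collapse into one element. Dropping the degenerate ones makes the index map injective, because
  nondegenerate intervals with equal end points overlap; sums of \<phi> do not notice the
  loss.\<close>

lemma nonoverlapping_indexed:
  assumes "finite I" and uv: "\<And>i. i \<in> I \<Longrightarrow> c \<le> u i \<and> u i \<le> v i \<and> v i \<le> d"
    and disj: "disjoint_family_on (\<lambda>i. {u i<..<v i}) I"
  obtains D where "nonoverlapping c d D"
    "\<And>\<phi> :: real \<Rightarrow> real \<Rightarrow> real. (\<And>x. \<phi> x x = 0) \<Longrightarrow> (\<Sum>(x, y)\<in>D. \<phi> x y) = (\<Sum>i\<in>I. \<phi> (u i) (v i))"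
proof -
  define J where "J = {i \<in> I. u i < v i}"
  define D where "D = (\<lambda>i. (u i, v i)) ` J"
  have inj: "inj_on (\<lambda>i. (u i, v i)) J"
  proof (rule inj_onI)
    fix i j assume ij: "i \<in> J" "j \<in> J" "(u i, v i) = (u j, v j)"
    show "i = j"
    proof (rule ccontr)
      assume "i \<noteq> j"
      then have "{u i<..<v i} \<inter> {u j<..<v j} = {}"
        using disj ij unfolding disjoint_family_on_def J_def by blast
      then show False
        using ij by (auto simp: J_def)
    qed
  qed
  show thesis
  proof
    show "nonoverlapping c d D"
      unfolding nonoverlapping_def
    proof (intro conjI)
      show "finite D" using assms(1) by (simp add: D_def J_def)
      show "\<forall>(u, v)\<in>D. c \<le> u \<and> u \<le> v \<and> v \<le> d"
        using uv by (auto simp: D_def J_def)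
      show "disjoint_family_on (\<lambda>(u, v). {u<..<v}) D"
        unfolding disjoint_family_on_def
      proof (intro ballI impI)
        fix m n assume "m \<in> D" "n \<in> D" "m \<noteq> n"
        then obtain i j where ij: "i \<in> I" "j \<in> I" "m = (u i, v i)" "n = (u j, v j)" "i \<noteq> j"
          by (auto simp: D_def J_def)
        then show "(case m of (u, v) \<Rightarrow> {u<..<v}) \<inter> (case n of (u, v) \<Rightarrow> {u<..<v}) = {}"
          using disj unfolding disjoint_family_on_def by simp
      qed
    qed
    fix \<phi> :: "real \<Rightarrow> real \<Rightarrow> real" assume \<phi>: "\<And>x. \<phi> x x = 0"
    have "(\<Sum>(x, y)\<in>D. \<phi> x y) = (\<Sum>i\<in>J. \<phi> (u i) (v i))"
      unfolding D_def by (subst sum.reindex[OF inj]) simp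
    also have "\<dots> = (\<Sum>i\<in>I. \<phi> (u i) (v i))"
    proof (rule sum.mono_neutral_left)
      show "\<forall>i\<in>I - J. \<phi> (u i) (v i) = 0"
      proof
        fix i assume "i \<in> I - J"
        then have "u i = v i" using uv[of i] by (auto simp: J_def)
        then show "\<phi> (u i) (v i) = 0" using \<phi> by simp
      qed
    qed (use assms(1) in \<open>auto simp: J_def\<close>)
    finally show "(\<Sum>(x, y)\<in>D. \<phi> x y) = (\<Sum>i\<in>I. \<phi> (u i) (v i))" .
  qed
qed

lemma sum_lengths_le_measure:
  assumes "finite I" and uv: "\<And>i. i \<in> I \<Longrightarrow> u i \<le> v i \<and> {u i<..<v i :: real} \<subseteq> S"
    and disj: "disjoint_family_on (\<lambda>i. {u i<..<v i}) I" and S: "S \<in> lmeasurable"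
  shows "(\<Sum>i\<in>I. v i - u i) \<le> measure lebesgue S"
proof -
  have "(\<Sum>i\<in>I. v i - u i) = (\<Sum>i\<in>I. measure lebesgue {u i<..<v i})"
    by (rule sum.cong) (use uv in auto)
  also have "\<dots> = measure lebesgue (\<Union>i\<in>I. {u i<..<v i})"
    by (rule measure_finite_Union[symmetric]) (use assms in auto)
  also have "\<dots> \<le> measure lebesgue S"
    by (rule measure_mono_fmeasurable) (use assms in auto)
  finally show ?thesis .
qed

lemma nonoverlapping_length:
  assumes "nonoverlapping c d D" "c \<le> d"
  shows "(\<Sum>(u, v)\<in>D. v - u) \<le> d - c"
proof -
  have "(\<Sum>p\<in>D. snd p - fst p) \<le> measure lebesgue {c..d}"
    using assms unfolding nonoverlapping_def
    by (intro sum_lengths_le_measure) (auto simp: case_prod_beta')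
  then show ?thesis
    using assms(2) by (simp add: case_prod_beta')
qed

text \<open>A supremum of reals is meaningful only for bounded nonempty sets; hence the bound
  \<open>B\<close> in the context below, while the empty family provides an element.\<close>

definition variation :: "(real \<Rightarrow> complex) \<Rightarrow> real \<Rightarrow> real \<Rightarrow> real" where
  "variation f c x = (SUP D\<in>{D. nonoverlapping c x D}. \<Sum>(u, v)\<in>D. cmod (f v - f u))"

lemma nonoverlapping_empty: "nonoverlapping s t {}"
  by (simp add: nonoverlapping_def disjoint_family_on_def)

lemma variation_least:
  assumes "\<And>D. nonoverlapping s t D \<Longrightarrow> (\<Sum>(u, v)\<in>D. cmod (f v - f u)) \<le> K"
  shows "variation f s t \<le> K"
  unfolding variation_def
  by (rule cSUP_least) (use assms nonoverlapping_empty in auto)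

context
  fixes f :: "real \<Rightarrow> complex" and c d B :: real
  assumes bdd: "\<And>D. nonoverlapping c d D \<Longrightarrow> (\<Sum>(u, v)\<in>D. cmod (f v - f u)) \<le> B"
begin

lemma variation_upper:
  assumes "nonoverlapping s t D" "c \<le> s" "t \<le> d"
  shows "(\<Sum>(u, v)\<in>D. cmod (f v - f u)) \<le> variation f s t"
  unfolding variation_def
proof (rule cSUP_upper)
  show "D \<in> {D. nonoverlapping s t D}" using assms by simp
  have "nonoverlapping c d E" if "nonoverlapping s t E" for E
    using that assms unfolding nonoverlapping_def by fastforce
  then show "bdd_above ((\<lambda>D. \<Sum>(u, v)\<in>D. cmod (f v - f u)) ` {D. nonoverlapping s t D})"
    using bdd by (intro bdd_aboveI2[where M = B]) auto
qed

text \<open>A family in \<open>{c..x}\<close> stays nonoverlapping when the interval from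
  \<open>x\<close> to \<open>y\<close> joins it. Consequently the variation plus any 1-Lipschitz
  function of \<open>f\<close> is monotone.\<close>

lemma variation_superadditive:
  assumes "c \<le> x" "x \<le> y" "y \<le> d"
  shows "variation f c x + cmod (f y - f x) \<le> variation f c y"
proof (cases "x = y")
  case False
  then have xy: "x < y" using assms by simp
  have "variation f c x \<le> variation f c y - cmod (f y - f x)"
  proof (rule variation_least)
    fix D assume D: "nonoverlapping c x D"
    have fin: "finite D" using D by (simp add: nonoverlapping_def)
    have notin: "(x, y) \<notin> D" using D xy unfolding nonoverlapping_def by fastforce
    have emp: "{u<..<v} \<inter> {x<..<y} = {}" if "(u, v) \<in> D" for u v
      using D that unfolding nonoverlapping_def by fastforce
    have "nonoverlapping c y (insert (x, y) D)"
      unfolding nonoverlapping_def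
    proof (intro conjI)
      show "\<forall>(u, v)\<in>insert (x, y) D. c \<le> u \<and> u \<le> v \<and> v \<le> y"
        using D assms unfolding nonoverlapping_def by fastforce
      show "disjoint_family_on (\<lambda>(u, v). {u<..<v}) (insert (x, y) D)"
        using D emp notin unfolding nonoverlapping_def
        by (subst disjoint_family_on_insert) auto
    qed (use fin in simp)
    from variation_upper[OF this] show "(\<Sum>(u, v)\<in>D. cmod (f v - f u)) \<le> variation f c y - cmod (f y - f x)"
      using assms fin notin by simp
  qed
  then show ?thesis by simp
qed simp

text \<open>Each interval is cut at \<open>x\<close> by means of \<open>min x\<close> and \<open>max x\<close>, which also covers intervals on one side of \<open>x\<close>.\<close>

lemma variation_subadditive:
  assumes "c \<le> x" "x \<le> y" "y \<le> d"
  shows "variation f c y \<le> variation f c x + variation f x y"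
proof (rule variation_least)
  fix D assume D: "nonoverlapping c y D"
  have fin: "finite D" and D1: "\<And>p. p \<in> D \<Longrightarrow> c \<le> fst p \<and> fst p \<le> snd p \<and> snd p \<le> y"
    and dis: "disjoint_family_on (\<lambda>p. {fst p<..<snd p}) D"
    using D unfolding nonoverlapping_def by (auto simp: case_prod_beta')
  have "disjoint_family_on (\<lambda>p. {min x (fst p)<..<min x (snd p)}) D"
    "disjoint_family_on (\<lambda>p. {max x (fst p)<..<max x (snd p)}) D"
    using dis unfolding disjoint_family_on_def by fastforce+
  then obtain D1 D2 where D12: "nonoverlapping c x D1" "nonoverlapping x y D2"
    "\<And>\<phi> :: real \<Rightarrow> real \<Rightarrow> real. (\<And>x. \<phi> x x = 0) \<Longrightarrow> (\<Sum>(x, y)\<in>D1. \<phi> x y) = (\<Sum>p\<in>D. \<phi> (min x (fst p)) (min x (snd p)))"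
    "\<And>\<phi> :: real \<Rightarrow> real \<Rightarrow> real. (\<And>x. \<phi> x x = 0) \<Longrightarrow> (\<Sum>(x, y)\<in>D2. \<phi> x y) = (\<Sum>p\<in>D. \<phi> (max x (fst p)) (max x (snd p)))"
    using nonoverlapping_indexed[of D c "\<lambda>p. min x (fst p)" "\<lambda>p. min x (snd p)" x]
      nonoverlapping_indexed[of D x "\<lambda>p. max x (fst p)" "\<lambda>p. max x (snd p)" y] fin D1 assms
    by (smt (verit, best))
  have "(\<Sum>(u, v)\<in>D. cmod (f v - f u)) = (\<Sum>p\<in>D. cmod (f (snd p) - f (fst p)))"
    by (simp add: case_prod_beta')
  also have "\<dots> \<le> (\<Sum>p\<in>D. cmod (f (min x (snd p)) - f (min x (fst p)))
      + cmod (f (max x (snd p)) - f (max x (fst p))))"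
  proof (rule sum_mono)
    fix p assume "p \<in> D"
    have "f (snd p) - f (fst p) = (f (min x (snd p)) - f (min x (fst p))) + (f (max x (snd p)) - f (max x (fst p)))"
      by (simp add: min_def max_def)
    then show "cmod (f (snd p) - f (fst p)) \<le> cmod (f (min x (snd p)) - f (min x (fst p)))
      + cmod (f (max x (snd p)) - f (max x (fst p)))"
      by (metis norm_triangle_ineq)
  qed
  also have "\<dots> = (\<Sum>(u, v)\<in>D1. cmod (f v - f u)) + (\<Sum>(u, v)\<in>D2. cmod (f v - f u))"
    using D12(3)[of "\<lambda>u v. cmod (f v - f u)"] D12(4)[of "\<lambda>u v. cmod (f v - f u)"]
    by (simp add: sum.distrib)
  also have "\<dots> \<le> variation f c x + variation f x y"
    using D12 assms by (intro add_mono variation_upper) auto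
  finally show "(\<Sum>(u, v)\<in>D. cmod (f v - f u)) \<le> variation f c x + variation f x y" .
qed

text \<open>Each interval of \<open>D\<close> is refined by a family that nearly attains the
  variation over it. All refinements together form one family in \<open>{c..d}\<close> whose total
  length does not exceed that of \<open>D\<close>, so the smallness assumption on \<open>f\<close>
  applies to it. Thus the variation inherits the modulus of absolute continuity of
  \<open>f\<close>.\<close>

lemma sum_variation_le:
  assumes small: "\<And>E. nonoverlapping c d E \<Longrightarrow> (\<Sum>(u, v)\<in>E. v - u) < \<delta> \<Longrightarrow> (\<Sum>(u, v)\<in>E. cmod (f v - f u)) < \<epsilon>"
    and D: "nonoverlapping c d D" and len: "(\<Sum>(u, v)\<in>D. v - u) < \<delta>"
  shows "(\<Sum>(u, v)\<in>D. variation f c v - variation f c u) \<le> \<epsilon>"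
proof (rule field_le_epsilon)
  fix \<eta> :: real assume \<eta>: "\<eta> > 0"
  have fin: "finite D" and D1: "\<And>p. p \<in> D \<Longrightarrow> c \<le> fst p \<and> fst p \<le> snd p \<and> snd p \<le> d"
    and dis: "disjoint_family_on (\<lambda>p. {fst p<..<snd p}) D"
    using D unfolding nonoverlapping_def by (auto simp: case_prod_beta')
  \<comment> \<open>The error \<eta> is shared among the intervals of \<open>D\<close>, so that the
    errors add up to at most \<eta>.\<close>
  have "\<exists>E. nonoverlapping (fst p) (snd p) E \<and>
      variation f (fst p) (snd p) \<le> (\<Sum>(u, v)\<in>E. cmod (f v - f u)) + \<eta> / (card D + 1)" if "p \<in> D" for p
  proof (rule ccontr)
    assume *: "\<not> ?thesis"
    have "variation f (fst p) (snd p) \<le> variation f (fst p) (snd p) - \<eta> / (card D + 1)"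
      by (rule variation_least) (use * in force)
    then show False using \<eta> by (simp add: divide_le_0_iff not_less)
  qed
  then obtain E where E: "\<And>p. p \<in> D \<Longrightarrow> nonoverlapping (fst p) (snd p) (E p)"
    "\<And>p. p \<in> D \<Longrightarrow> variation f (fst p) (snd p) \<le> (\<Sum>(u, v)\<in>E p. cmod (f v - f u)) + \<eta> / (card D + 1)"
    by metis
  have finE: "finite (E p)" if "p \<in> D" for p
    using E(1)[OF that] by (simp add: nonoverlapping_def)
  have Ein: "fst p \<le> fst q \<and> fst q \<le> snd q \<and> snd q \<le> snd p" if "p \<in> D" "q \<in> E p" for p q
    using E(1)[OF that(1)] that(2) by (auto simp: nonoverlapping_def case_prod_beta')
  have finS: "finite (Sigma D E)" using fin finE by auto
  have disS: "disjoint_family_on (\<lambda>(p, q). {fst q<..<snd q}) (Sigma D E)"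
    unfolding disjoint_family_on_def
  proof (intro ballI impI)
    fix m n assume mn: "m \<in> Sigma D E" "n \<in> Sigma D E" "m \<noteq> n"
    obtain p q p' q' where [simp]: "m = (p, q)" "n = (p', q')" by (cases m; cases n) blast
    have in': "p \<in> D" "q \<in> E p" "p' \<in> D" "q' \<in> E p'" using mn by auto
    have "{fst q<..<snd q} \<inter> {fst q'<..<snd q'} = {}"
    proof (cases "p = p'")
      case True
      with mn have "q \<noteq> q'" by simp
      with True in' E(1)[of p] show ?thesis
        unfolding nonoverlapping_def disjoint_family_on_def case_prod_beta' by blast
    next
      case False
      then have "{fst p<..<snd p} \<inter> {fst p'<..<snd p'} = {}"
        using dis in' unfolding disjoint_family_on_def by blast
      moreover have "{fst q<..<snd q} \<subseteq> {fst p<..<snd p}" "{fst q'<..<snd q'} \<subseteq> {fst p'<..<snd p'}"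
        using Ein in' by fastforce+
      ultimately show ?thesis by blast
    qed
    then show "(case m of (p, q) \<Rightarrow> {fst q<..<snd q}) \<inter> (case n of (p, q) \<Rightarrow> {fst q<..<snd q}) = {}"
      by simp
  qed
  have inS: "c \<le> fst (snd m) \<and> fst (snd m) \<le> snd (snd m) \<and> snd (snd m) \<le> d" if "m \<in> Sigma D E" for m
    using that Ein D1 by force
  have "disjoint_family_on (\<lambda>m. {fst (snd m)<..<snd (snd m)}) (Sigma D E)"
    using disS by (simp add: case_prod_beta')
  from nonoverlapping_indexed[OF finS inS this]
  obtain E' where E': "nonoverlapping c d E'"
    "\<And>\<phi> :: real \<Rightarrow> real \<Rightarrow> real. (\<And>x. \<phi> x x = 0) \<Longrightarrow> (\<Sum>(x, y)\<in>E'. \<phi> x y) = (\<Sum>m\<in>Sigma D E. \<phi> (fst (snd m)) (snd (snd m)))"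
    by blast
  have Sig: "(\<Sum>(x, y)\<in>E'. \<phi> x y) = (\<Sum>p\<in>D. \<Sum>(x, y)\<in>E p. \<phi> x y)" if "\<And>x. \<phi> x x = 0" for \<phi> :: "real \<Rightarrow> real \<Rightarrow> real"
    unfolding E'(2)[of \<phi>, OF that]
    by (subst sum.Sigma) (use fin finE in \<open>auto simp: case_prod_beta'\<close>)
  have "(\<Sum>(x, y)\<in>E'. y - x) = (\<Sum>p\<in>D. \<Sum>(x, y)\<in>E p. y - x)"
    by (rule Sig) simp
  also have "\<dots> \<le> (\<Sum>p\<in>D. snd p - fst p)"
    by (intro sum_mono nonoverlapping_length E) (use D1 in auto)
  also have "\<dots> < \<delta>" using len by (simp add: case_prod_beta')
  finally have "(\<Sum>(u, v)\<in>E'. cmod (f v - f u)) < \<epsilon>"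
    using small E'(1) by blast
  then have *: "(\<Sum>p\<in>D. \<Sum>(u, v)\<in>E p. cmod (f v - f u)) < \<epsilon>"
    by (subst (asm) Sig) auto
  have "(\<Sum>(u, v)\<in>D. variation f c v - variation f c u) = (\<Sum>p\<in>D. variation f c (snd p) - variation f c (fst p))"
    by (simp add: case_prod_beta')
  also have "\<dots> \<le> (\<Sum>p\<in>D. (\<Sum>(u, v)\<in>E p. cmod (f v - f u)) + \<eta> / (card D + 1))"
  proof (rule sum_mono)
    fix p assume p: "p \<in> D"
    show "variation f c (snd p) - variation f c (fst p) \<le> (\<Sum>(u, v)\<in>E p. cmod (f v - f u)) + \<eta> / (card D + 1)"
      using variation_subadditive[of "fst p" "snd p"] D1[OF p] E(2)[OF p] by linarith
  qed
  also have "\<dots> = (\<Sum>p\<in>D. \<Sum>(u, v)\<in>E p. cmod (f v - f u)) + card D * (\<eta> / (card D + 1))"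
    by (simp add: sum.distrib)
  also have "\<dots> \<le> \<epsilon> + \<eta>"
  proof -
    have "card D * (\<eta> / (card D + 1)) \<le> \<eta>"
      using \<eta> by (simp add: field_simps)
    then show ?thesis using * by linarith
  qed
  finally show "(\<Sum>(u, v)\<in>D. variation f c v - variation f c u) \<le> \<epsilon> + \<eta>" .
qed

end

section \<open>Densities of monotone absolutely continuous functions\<close>

lemma mono_abs_cont_imp_continuous_on:
  fixes F :: "real \<Rightarrow> real"
  assumes mono: "\<And>x y. c \<le> x \<Longrightarrow> x \<le> y \<Longrightarrow> y \<le> d \<Longrightarrow> F x \<le> F y"
    and ac: "\<And>\<epsilon>. \<epsilon> > 0 \<Longrightarrow> \<exists>\<delta>>0. \<forall>D. nonoverlapping c d D \<and> (\<Sum>(u, v)\<in>D. v - u) < \<delta>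
        \<longrightarrow> (\<Sum>(u, v)\<in>D. F v - F u) < \<epsilon>"
  shows "continuous_on {c..d} F"
proof -
  have "(\<Sum>(u, v)\<in>D. cmod (of_real (F v) - of_real (F u))) = (\<Sum>(u, v)\<in>D. F v - F u)"
    if "nonoverlapping c d D" for D
  proof (rule sum.cong)
    fix p assume "p \<in> D"
    then have "F (fst p) \<le> F (snd p)"
      using that mono unfolding nonoverlapping_def by (auto simp: case_prod_beta')
    then show "(case p of (u, v) \<Rightarrow> cmod (of_real (F v) - of_real (F u))) = (case p of (u, v) \<Rightarrow> F v - F u)"
      by (simp add: case_prod_beta' flip: of_real_diff)
  qed simp
  then have "abs_cont_on {c..d} (\<lambda>x. of_real (F x))"
    unfolding abs_cont_on_iff_nonoverlapping using ac by metis
  then have "continuous_on {c..d} (\<lambda>x. Re (of_real (F x)))"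
    by (intro continuous_intros abs_cont_on_imp_continuous_on)
  then show ?thesis by simp
qed

text \<open>Every finite part of a thin cover of \<open>N\<close> by closed intervals has length
  below \<delta>, so absolute continuity bounds its Stieltjes mass by \<epsilon>; continuity of the
  measure from below passes to the whole cover. Composition with \<open>max c (min d x)\<close>
  continues \<open>F\<close> by constants, as \<open>interval_measure\<close> works with functions
  on the whole line.\<close>

lemma null_sets_interval_measure:
  fixes F :: "real \<Rightarrow> real"
  assumes cd: "c < d" and mono: "\<And>x y. c \<le> x \<Longrightarrow> x \<le> y \<Longrightarrow> y \<le> d \<Longrightarrow> F x \<le> F y"
    and ac: "\<And>\<epsilon>. \<epsilon> > 0 \<Longrightarrow> \<exists>\<delta>>0. \<forall>D. nonoverlapping c d D \<and> (\<Sum>(u, v)\<in>D. v - u) < \<delta>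
        \<longrightarrow> (\<Sum>(u, v)\<in>D. F v - F u) < \<epsilon>"
    and N: "N \<in> null_sets lborel" "bounded N"
  shows "emeasure (interval_measure (\<lambda>x. F (max c (min d x)))) N = 0"
proof -
  define F' where "F' x = F (max c (min d x))" for x
  have F'_eq: "F' = (\<lambda>x. F (max c (min d x)))"
    by (simp add: fun_eq_iff F'_def)
  have mono': "F' x \<le> F' y" if "x \<le> y" for x y
    unfolding F'_def by (rule mono) (use cd that in auto)
  have cont': "continuous_on UNIV F'"
    unfolding F'_def
    by (rule continuous_on_compose2[OF mono_abs_cont_imp_continuous_on[OF mono ac]])
       (use cd in \<open>auto intro!: continuous_intros\<close>)
  define M where "M = interval_measure F'"
  have Icc: "emeasure M {u..v} = ennreal (F' v - F' u)" if "u \<le> v" for u v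
    unfolding M_def by (rule emeasure_interval_measure_Icc[OF that mono' cont'])
  have Nnull: "N \<in> null_sets lebesgue"
    using N(1) by (auto simp: null_sets_completion_iff2 intro: null_sets_completionI)
  obtain n where n: "N \<subseteq> cbox (-n) n" "n > 0"
  proof -
    from N(2) obtain n where n: "\<And>x. x \<in> N \<Longrightarrow> norm x \<le> n" "n > 0"
      unfolding bounded_pos by blast
    have "x \<in> cbox (-n) n" if "x \<in> N" for x
      using n(1)[OF that] by (simp add: abs_le_iff)
    then show ?thesis using that[of n] n(2) by blast
  qed
  have "emeasure M N \<le> ennreal \<epsilon>" if \<epsilon>: "\<epsilon> > 0" for \<epsilon>
  proof -
    obtain \<delta> where \<delta>: "\<delta> > 0" and small: "\<And>D. nonoverlapping c d D \<Longrightarrow> (\<Sum>(u, v)\<in>D. v - u) < \<delta> \<Longrightarrow>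
        (\<Sum>(u, v)\<in>D. F v - F u) < \<epsilon>"
      using ac[OF \<epsilon>] by blast
    have Nl: "N \<in> lmeasurable" "measure lebesgue N = 0"
      using Nnull by (auto simp: fmeasurable_def null_sets_def measure_def)
    obtain \<D> where \<D>: "countable \<D>" "\<And>K. K \<in> \<D> \<Longrightarrow> K \<subseteq> cbox (-n) n \<and> K \<noteq> {} \<and> (\<exists>c d. K = cbox c d)"
      "pairwise (\<lambda>A B. interior A \<inter> interior B = {}) \<D>"
      "N \<subseteq> \<Union>\<D>" "\<Union>\<D> \<in> lmeasurable" "measure lebesgue (\<Union>\<D>) \<le> measure lebesgue N + \<delta>/2"
      by (rule measurable_outer_intervals_bounded[OF Nl(1) n(1) half_gt_zero[OF \<delta>]]) (rule that; assumption)
    have "\<forall>K\<in>\<D>. \<exists>u v. u \<le> v \<and> K = {u..v}"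
    proof
      fix K assume "K \<in> \<D>"
      then obtain u v where "K = cbox u v" "K \<noteq> {}" using \<D>(2) by blast
      then show "\<exists>u v. u \<le> v \<and> K = {u..v}" by (intro exI[of _ u] exI[of _ v]) auto
    qed
    then obtain l r where lr: "\<And>K. K \<in> \<D> \<Longrightarrow> l K \<le> r K \<and> K = {l K..r K}"
      by (auto dest!: bchoice)
    have borelD: "K \<in> sets borel" if "K \<in> \<D>" for K
    proof -
      have "K = {l K..r K}" using lr[OF that] by simp
      also have "\<dots> \<in> sets borel" by simp
      finally show ?thesis .
    qed
    have fin_le: "emeasure M (\<Union>\<D>') \<le> ennreal \<epsilon>" if \<D>': "finite \<D>'" "\<D>' \<subseteq> \<D>" for \<D>'
    proof -
      \<comment> \<open>Since \<open>F'\<close> is constant outside \<open>{c..d}\<close>, clipping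
        the end points preserves its increments and gives intervals to which the absolute continuity
        of \<open>F\<close> applies.\<close>
      let ?u = "\<lambda>K. max c (min d (l K))" and ?v = "\<lambda>K. max c (min d (r K))"
      have int: "interior K = {l K<..<r K}" if "K \<in> \<D>" for K
        using lr[OF that] interior_atLeastAtMost_real by metis
      have dis0: "disjoint_family_on (\<lambda>K. {l K<..<r K}) \<D>'"
        using \<D>(3) \<D>'(2) int unfolding disjoint_family_on_def pairwise_def by blast
      have sub: "{?u K<..<?v K} \<subseteq> {l K<..<r K}" for K
        using cd by auto
      have dis: "disjoint_family_on (\<lambda>K. {?u K<..<?v K}) \<D>'"
        using dis0 sub unfolding disjoint_family_on_def by blast
      have uv: "c \<le> ?u K \<and> ?u K \<le> ?v K \<and> ?v K \<le> d" if "K \<in> \<D>'" for K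
        using lr[of K] that \<D>'(2) cd by force
      obtain D where D: "nonoverlapping c d D" and Dsum:
        "\<And>\<phi> :: real \<Rightarrow> real \<Rightarrow> real. (\<And>x. \<phi> x x = 0) \<Longrightarrow> (\<Sum>(x, y)\<in>D. \<phi> x y) = (\<Sum>K\<in>\<D>'. \<phi> (?u K) (?v K))"
        using nonoverlapping_indexed[of \<D>' c ?u ?v d] \<D>'(1) uv dis by blast
      have "(\<Sum>(x, y)\<in>D. y - x) = (\<Sum>K\<in>\<D>'. ?v K - ?u K)"
        by (rule Dsum) simp
      also have "\<dots> \<le> measure lebesgue (\<Union>\<D>)"
      proof (rule sum_lengths_le_measure[OF \<D>'(1) _ dis \<D>(5)])
        fix K assume K: "K \<in> \<D>'"
        have "{l K<..<r K} \<subseteq> K" using lr[of K] K \<D>'(2) by fastforce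
        then show "?u K \<le> ?v K \<and> {?u K<..<?v K} \<subseteq> \<Union>\<D>"
          using uv[OF K] sub[of K] K \<D>'(2) by blast
      qed
      also have "\<dots> < \<delta>" using \<D>(6) Nl(2) \<delta> by simp
      finally have "(\<Sum>(x, y)\<in>D. F y - F x) < \<epsilon>" by (rule small[OF D])
      then have *: "(\<Sum>K\<in>\<D>'. F' (r K) - F' (l K)) < \<epsilon>"
        by (subst (asm) Dsum) (auto simp: F'_def)
      have "emeasure M (\<Union>\<D>') \<le> (\<Sum>K\<in>\<D>'. emeasure M K)"
        using emeasure_subadditive_finite[of \<D>' "\<lambda>K. K" M] \<D>' borelD by (auto simp: M_def)
      also have "\<dots> = (\<Sum>K\<in>\<D>'. ennreal (F' (r K) - F' (l K)))"
      proof (rule sum.cong)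
        fix K assume "K \<in> \<D>'"
        then have "l K \<le> r K" "K = {l K..r K}" using lr \<D>'(2) by blast+
        then show "emeasure M K = ennreal (F' (r K) - F' (l K))" using Icc[of "l K" "r K"] by simp
      qed simp
      also have "\<dots> = ennreal (\<Sum>K\<in>\<D>'. F' (r K) - F' (l K))"
        by (rule sum_ennreal) (use lr \<D>'(2) mono' in auto)
      also have "\<dots> \<le> ennreal \<epsilon>"
        using * by (intro ennreal_leI) simp
      finally show ?thesis .
    qed
    have "emeasure M (\<Union>\<D>) \<le> ennreal \<epsilon>"
    proof (cases "\<D> = {}")
      case False
      \<comment> \<open>For a finite cover \<open>from_nat_into\<close> repeats members, which does
        no harm as only the unions matter.\<close>
      define A where "A k = \<Union>(from_nat_into \<D> ` {..<k})" for k
      have inD: "from_nat_into \<D> k \<in> \<D>" for k using False by (rule from_nat_into)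
      have "(SUP k. emeasure M (A k)) = emeasure M (\<Union>k. A k)"
      proof (rule SUP_emeasure_incseq)
        show "range A \<subseteq> sets M" using inD borelD by (auto simp: A_def M_def)
        show "incseq A" unfolding A_def incseq_def by (intro allI impI Union_mono image_mono) auto
      qed
      moreover have "(\<Union>k. A k) = \<Union>\<D>"
      proof -
        have "(\<Union>k. A k) = \<Union>(range (from_nat_into \<D>))" unfolding A_def by auto
        then show ?thesis using range_from_nat_into[OF False \<D>(1)] by simp
      qed
      moreover have "(SUP k. emeasure M (A k)) \<le> ennreal \<epsilon>"
        unfolding A_def by (rule SUP_least, rule fin_le) (use inD in auto)
      ultimately show ?thesis by simp
    qed simp
    moreover have "emeasure M N \<le> emeasure M (\<Union>\<D>)"
    proof (rule emeasure_mono[OF \<D>(4)])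
      show "\<Union>\<D> \<in> sets M" unfolding M_def sets_interval_measure
        by (rule sets.countable_Union) (use \<D>(1) borelD in auto)
    qed
    ultimately show ?thesis by order
  qed
  then have "emeasure M N \<le> 0 + ennreal e" if "e > 0" for e
    using that by (metis add_0)
  then have "emeasure M N \<le> 0"
    by (rule ennreal_le_epsilon)
  then show ?thesis unfolding M_def F'_eq by simp
qed

text \<open>The Lebesgue-Stieltjes measure of \<open>F\<close> vanishes on Lebesgue null sets, so
  Radon-Nikodym provides a density with respect to \<open>lborel\<close>, and this density is
  \<open>g\<close>.\<close>

lemma mono_abs_cont_density:
  fixes F :: "real \<Rightarrow> real"
  assumes cd: "c < d" and mono: "\<And>x y. c \<le> x \<Longrightarrow> x \<le> y \<Longrightarrow> y \<le> d \<Longrightarrow> F x \<le> F y"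
    and ac: "\<And>\<epsilon>. \<epsilon> > 0 \<Longrightarrow> \<exists>\<delta>>0. \<forall>D. nonoverlapping c d D \<and> (\<Sum>(u, v)\<in>D. v - u) < \<delta>
        \<longrightarrow> (\<Sum>(u, v)\<in>D. F v - F u) < \<epsilon>"
  obtains g where "g absolutely_integrable_on {c..d}" "\<And>x. x \<in> {c..d} \<Longrightarrow> integral {c..x} g = F x - F c"
proof -
  define F' where "F' x = F (max c (min d x))" for x
  have F'_eq: "F' = (\<lambda>x. F (max c (min d x)))"
    by (simp add: fun_eq_iff F'_def)
  have mono': "F' x \<le> F' y" if "x \<le> y" for x y
    unfolding F'_def by (rule mono) (use cd that in auto)
  have cont': "continuous_on UNIV F'"
    unfolding F'_def
    by (rule continuous_on_compose2[OF mono_abs_cont_imp_continuous_on[OF mono ac]])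
       (use cd in \<open>auto intro!: continuous_intros\<close>)
  define M where "M = interval_measure F'"
  have Icc: "emeasure M {u..v} = ennreal (F' v - F' u)" if "u \<le> v" for u v
    unfolding M_def by (rule emeasure_interval_measure_Icc[OF that mono' cont'])
  have "absolutely_continuous lborel M"
    unfolding absolutely_continuous_def
  proof
    fix N :: "real set" assume N: "N \<in> null_sets lborel"
    \<comment> \<open>The preceding lemma treats bounded null sets, hence the exhaustion by
      balls.\<close>
    have "N \<inter> cball 0 (real k) \<in> null_sets M" for k
    proof -
      have "N \<inter> cball 0 (real k) \<in> null_sets lborel"
        by (rule null_set_Int2[OF N]) auto
      moreover have "bounded (N \<inter> cball 0 (real k))"
        by (simp add: bounded_Int)
      ultimately have "emeasure M (N \<inter> cball 0 (real k)) = 0"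
        using null_sets_interval_measure[OF cd mono ac] unfolding M_def F'_eq by blast
      then show ?thesis using \<open>N \<inter> cball 0 (real k) \<in> null_sets lborel\<close>
        by (simp add: null_sets_def M_def)
    qed
    then have "(\<Union>k. N \<inter> cball 0 (real k)) \<in> null_sets M" by blast
    moreover have "(\<Union>k. N \<inter> cball 0 (real k)) = N"
    proof -
      have "\<exists>k. norm x \<le> real k" for x :: real by (rule real_arch_simple)
      then show ?thesis by auto
    qed
    ultimately show "N \<in> null_sets M" by simp
  qed
  then obtain h where h: "h \<in> borel_measurable lborel" "density lborel h = M"
    using sigma_finite_measure.Radon_Nikodym[OF sigma_finite_lborel, of M] by (auto simp: M_def)
  have hb: "h \<in> borel_measurable borel" using h(1) by simp
  define g where "g x = enn2real (h x)" for x
  have gb: "g \<in> borel_measurable borel" unfolding g_def using hb by measurable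
  have hint: "(\<integral>\<^sup>+x\<in>{c..x}. h x \<partial>lborel) = ennreal (F' x - F' c)" if "c \<le> x" for x
  proof -
    have "(\<integral>\<^sup>+x\<in>{c..x}. h x \<partial>lborel) = emeasure M {c..x}"
      unfolding h(2)[symmetric] by (rule emeasure_density[symmetric]) (use h(1) in auto)
    then show ?thesis using Icc[OF that] by simp
  qed
  \<comment> \<open>The mass of \<open>{c..d}\<close> is finite, so \<open>h\<close> is finite
    almost everywhere there and \<open>enn2real\<close> loses nothing.\<close>
  have "AE x in lborel. h x * indicator {c..d} x \<noteq> \<infinity>"
    by (rule nn_integral_PInf_AE) (use hint[of d] cd hb in \<open>auto\<close>)
  then have hg: "AE x in lborel. h x * indicator {c..d} x = ennreal (g x) * indicator {c..d} x"
    by eventually_elim (auto simp: g_def indicator_def less_top split: if_splits)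
  have gint: "(\<integral>\<^sup>+x\<in>{c..x}. ennreal (g x) \<partial>lborel) = ennreal (F' x - F' c)" if "c \<le> x" "x \<le> d" for x
  proof -
    have "(\<integral>\<^sup>+x\<in>{c..x}. ennreal (g x) \<partial>lborel) = (\<integral>\<^sup>+x\<in>{c..x}. h x \<partial>lborel)"
    proof (rule nn_integral_cong_AE)
      show "AE t in lborel. ennreal (g t) * indicator {c..x} t = h t * indicator {c..x} t"
        using hg
      proof eventually_elim
        case (elim t)
        then show ?case using that by (cases "t \<in> {c..x}") auto
      qed
    qed
    then show ?thesis using hint that by simp
  qed
  have gi: "(g has_integral (F' x - F' c)) {c..x}" if "c \<le> x" "x \<le> d" for x
  proof -
    have "((\<lambda>t. g t * indicator {c..x} t) has_integral (F' x - F' c)) UNIV"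
    proof (rule nn_integral_has_integral)
      show "(\<lambda>t. g t * indicator {c..x} t) \<in> borel_measurable borel" using gb by measurable
      show "(\<integral>\<^sup>+ t. ennreal (g t * indicator {c..x} t) \<partial>lborel) = ennreal (F' x - F' c)"
        unfolding gint[OF that, symmetric]
        by (rule nn_integral_cong) (simp add: indicator_def)
    qed (use mono' that in \<open>auto simp: g_def\<close>)
    then have "((\<lambda>t. if t \<in> {c..x} then g t else 0) has_integral (F' x - F' c)) UNIV"
      by (rule has_integral_eq[rotated]) (auto simp: indicator_def)
    then show ?thesis by (rule has_integral_restrict_UNIV[THEN iffD1])
  qed
  show thesis
  proof
    show "g absolutely_integrable_on {c..d}"
      by (rule nonnegative_absolutely_integrable_1) (use gi[of d] cd in \<open>auto simp: g_def intro: has_integral_integrable\<close>)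
    show "integral {c..x} g = F x - F c" if "x \<in> {c..d}" for x
    proof -
      have "F' x = F x" "F' c = F c" using that cd by (auto simp: F'_def)
      then show ?thesis using integral_unique[OF gi, of x] that by simp
    qed
  qed
qed

section \<open>The fundamental theorem of calculus for absolutely continuous functions\<close>

text \<open>Jordan decomposition: the variation, the variation plus \<open>Re f\<close>, and the
  variation plus \<open>Im f\<close> are monotone and absolutely continuous, so each has a density.
  Differences of these densities are the real and imaginary parts of \<open>g\<close>.\<close>

lemma abs_cont_on_bounded_variation_density:
  assumes cd: "c < d" and ac: "abs_cont_on {c..d} f"
    and bdd: "\<And>D. nonoverlapping c d D \<Longrightarrow> (\<Sum>(u, v)\<in>D. cmod (f v - f u)) \<le> B"
  obtains g where "g absolutely_integrable_on {c..d}" "\<And>x. x \<in> {c..d} \<Longrightarrow> integral {c..x} g = f x - f c"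
proof -
  let ?V = "variation f c"
  have superadd: "?V u + cmod (f v - f u) \<le> ?V v" if "c \<le> u" "u \<le> v" "v \<le> d" for u v
    using variation_superadditive[of c d f B] bdd that by blast
  have density: "\<exists>g. g absolutely_integrable_on {c..d} \<and> (\<forall>x\<in>{c..d}. integral {c..x} g = (?V x + \<rho> (f x)) - (?V c + \<rho> (f c)))"
    if \<rho>: "\<And>z w. \<bar>\<rho> z - \<rho> w\<bar> \<le> cmod (z - w)" for \<rho>
  proof -
    define F where "F x = ?V x + \<rho> (f x)" for x
    have F2: "F v - F u \<le> 2 * (?V v - ?V u)" if "c \<le> u" "u \<le> v" "v \<le> d" for u v
      using superadd[OF that] \<rho>[of "f v" "f u"] by (simp add: F_def)
    have mono: "F u \<le> F v" if "c \<le> u" "u \<le> v" "v \<le> d" for u v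
      using superadd[OF that] \<rho>[of "f v" "f u"] by (simp add: F_def)
    have acF: "\<exists>\<delta>>0. \<forall>D. nonoverlapping c d D \<and> (\<Sum>(u, v)\<in>D. v - u) < \<delta>
        \<longrightarrow> (\<Sum>(u, v)\<in>D. F v - F u) < \<epsilon>" if \<epsilon>: "\<epsilon> > 0" for \<epsilon>
    proof -
      \<comment> \<open>A third of \<epsilon>, because increments of \<open>F\<close> are at most
        twice those of \<open>?V\<close> and \<open>sum_variation_le\<close> yields only a weak
        inequality.\<close>
      obtain \<delta> where \<delta>: "\<delta> > 0" and small: "\<And>D. nonoverlapping c d D \<Longrightarrow> (\<Sum>(u, v)\<in>D. v - u) < \<delta>
          \<Longrightarrow> (\<Sum>(u, v)\<in>D. cmod (f v - f u)) < \<epsilon> / 3"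
        using ac[unfolded abs_cont_on_iff_nonoverlapping, rule_format, of "\<epsilon> / 3"] \<epsilon> by auto
      have "(\<Sum>(u, v)\<in>D. F v - F u) < \<epsilon>" if D: "nonoverlapping c d D" "(\<Sum>(u, v)\<in>D. v - u) < \<delta>" for D
      proof -
        have "(\<Sum>(u, v)\<in>D. F v - F u) \<le> (\<Sum>(u, v)\<in>D. 2 * (?V v - ?V u))"
        proof (rule sum_mono)
          fix p assume "p \<in> D"
          then have "c \<le> fst p" "fst p \<le> snd p" "snd p \<le> d"
            using D(1) unfolding nonoverlapping_def by auto
          then show "(case p of (u, v) \<Rightarrow> F v - F u) \<le> (case p of (u, v) \<Rightarrow> 2 * (?V v - ?V u))"
            using F2 by (simp add: case_prod_beta')
        qed
        also have "\<dots> = 2 * (\<Sum>(u, v)\<in>D. ?V v - ?V u)"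
          by (simp add: sum_distrib_left case_prod_beta')
        also have "\<dots> \<le> 2 * (\<epsilon> / 3)"
          using sum_variation_le[of c d f B \<delta> "\<epsilon> / 3" D] bdd small D by simp
        finally show ?thesis using \<epsilon> by simp
      qed
      then show ?thesis using \<delta> by blast
    qed
    obtain g where "g absolutely_integrable_on {c..d}" "\<And>x. x \<in> {c..d} \<Longrightarrow> integral {c..x} g = F x - F c"
      using mono_abs_cont_density[OF cd mono acF] by blast
    then show ?thesis unfolding F_def by blast
  qed
  obtain g0 where g0: "g0 absolutely_integrable_on {c..d}" "\<forall>x\<in>{c..d}. integral {c..x} g0 = ?V x - ?V c"
    using density[of "\<lambda>_. 0"] by auto
  obtain g1 where g1: "g1 absolutely_integrable_on {c..d}"
    "\<forall>x\<in>{c..d}. integral {c..x} g1 = (?V x + Re (f x)) - (?V c + Re (f c))"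
    using density[of Re] by (metis abs_Re_le_cmod minus_complex.simps(1))
  obtain g2 where g2: "g2 absolutely_integrable_on {c..d}"
    "\<forall>x\<in>{c..d}. integral {c..x} g2 = (?V x + Im (f x)) - (?V c + Im (f c))"
    using density[of Im] by (metis abs_Im_le_cmod minus_complex.simps(2))
  define g where "g x = (g1 x - g0 x) *\<^sub>R (1::complex) + (g2 x - g0 x) *\<^sub>R \<i>" for x
  have hi: "(h has_integral integral {c..x} h) {c..x}" if "h absolutely_integrable_on {c..d}" "x \<in> {c..d}" for h :: "real \<Rightarrow> real" and x
    by (metis (no_types, lifting) absolutely_integrable_on_subinterval atLeastAtMost_iff atLeastatMost_subset_iff integrable_integral order_refl set_lebesgue_integral_eq_integral(1) that)
  have gi: "(g has_integral (f x - f c)) {c..x}" if x: "x \<in> {c..d}" for x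
  proof -
    have "((\<lambda>x. (g1 x - g0 x) *\<^sub>R (1::complex) + (g2 x - g0 x) *\<^sub>R \<i>) has_integral
      (integral {c..x} g1 - integral {c..x} g0) *\<^sub>R 1 + (integral {c..x} g2 - integral {c..x} g0) *\<^sub>R \<i>) {c..x}"
      by (intro has_integral_add has_integral_scaleR_left has_integral_diff hi g0 g1 g2 x)
    moreover have "(integral {c..x} g1 - integral {c..x} g0) *\<^sub>R 1 + (integral {c..x} g2 - integral {c..x} g0) *\<^sub>R \<i> = f x - f c"
      using g0(2) g1(2) g2(2) x by (auto simp: complex_eq_iff)
    ultimately show ?thesis by (simp add: g_def[abs_def])
  qed
  show thesis
  proof
    show "g absolutely_integrable_on {c..d}"
      unfolding g_def[abs_def]
      by (intro set_integral_add absolutely_integrable_scaleR_right absolutely_integrable_scaleR_left set_integral_diff g0 g1 g2)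
  qed (use gi integral_unique in blast)
qed

lemma nonoverlapping_subinterval:
  "nonoverlapping c' d' D \<Longrightarrow> c \<le> c' \<Longrightarrow> d' \<le> d \<Longrightarrow> nonoverlapping c d D"
  unfolding nonoverlapping_def by fastforce

lemma abs_cont_on_subinterval:
  assumes "abs_cont_on {c..d} f" "c \<le> c'" "d' \<le> d"
  shows "abs_cont_on {c'..d'} f"
  using assms nonoverlapping_subinterval unfolding abs_cont_on_iff_nonoverlapping by meson

lemma absolutely_integrable_combine:
  fixes g1 g2 :: "real \<Rightarrow> 'a::euclidean_space"
  assumes "g1 absolutely_integrable_on {u..m}" "g2 absolutely_integrable_on {m..v}" "u \<le> m" "m \<le> v"
  defines "g \<equiv> \<lambda>x. if x \<le> m then g1 x else g2 x"
  shows "g absolutely_integrable_on {u..v}"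
    and "\<And>x. x \<in> {u..m} \<Longrightarrow> integral {u..x} g = integral {u..x} g1"
    and "\<And>x. x \<in> {m..v} \<Longrightarrow> integral {u..x} g = integral {u..m} g1 + integral {m..x} g2"
proof -
  have g1: "g absolutely_integrable_on {u..m}"
    using assms(1) by (rule absolutely_integrable_spike[where S = "{}"]) (auto simp: g_def)
  have g2: "g absolutely_integrable_on {m..v}"
    using assms(2) by (rule absolutely_integrable_spike[where S = "{m}"]) (auto simp: g_def)
  have "{u..v} = {u..m} \<union> {m..v}" using assms by auto
  then show gi: "g absolutely_integrable_on {u..v}"
    using set_integrable_Un[OF g1 g2] by simp
  show i1: "integral {u..x} g = integral {u..x} g1" if "x \<in> {u..m}" for x
    by (rule integral_cong) (use that in \<open>auto simp: g_def\<close>)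
  show "integral {u..x} g = integral {u..m} g1 + integral {m..x} g2" if x: "x \<in> {m..v}" for x
  proof -
    have "g absolutely_integrable_on {u..x}"
      using gi by (rule absolutely_integrable_on_subinterval) (use x in auto)
    then have "integral {u..m} g + integral {m..x} g = integral {u..x} g"
      by (intro Henstock_Kurzweil_Integration.integral_combine) (use x assms in \<open>auto intro: absolutely_integrable_on_def[THEN iffD1, THEN conjunct1]\<close>)
    moreover have "integral {m..x} g = integral {m..x} g2"
      by (rule integral_spike[of "{m}"]) (auto simp: g_def)
    ultimately show ?thesis using i1[of m] assms by simp
  qed
qed

text \<open>Absolute continuity bounds the variation by 1 only on intervals shorter than some
  \<delta>, so densities are first available locally; the bisection principle \<open>Bolzano\<close>
  glues them together.\<close>

lemma abs_cont_on_density: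
  assumes cd: "c \<le> d" and ac: "abs_cont_on {c..d} f"
  obtains g where "g absolutely_integrable_on {c..d}" "\<And>x. x \<in> {c..d} \<Longrightarrow> integral {c..x} g = f x - f c"
proof -
  define P where "P u v \<longleftrightarrow> (c \<le> u \<and> v \<le> d \<longrightarrow>
     (\<exists>g. g absolutely_integrable_on {u..v} \<and> (\<forall>x\<in>{u..v}. integral {u..x} g = f x - f u)))" for u v
  have "P c d"
    using cd
  proof (induction rule: Bolzano)
    case (trans u m v)
    show ?case unfolding P_def
    proof
      assume uv: "c \<le> u \<and> v \<le> d"
      obtain g1 g2 where g: "g1 absolutely_integrable_on {u..m}" "g2 absolutely_integrable_on {m..v}"
        "\<forall>x\<in>{u..m}. integral {u..x} g1 = f x - f u" "\<forall>x\<in>{m..v}. integral {m..x} g2 = f x - f m"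
        using trans uv unfolding P_def by (meson order_trans)
      let ?g = "\<lambda>x. if x \<le> m then g1 x else g2 x"
      note comb = absolutely_integrable_combine[OF g(1,2) trans(3,4)]
      have "integral {u..x} ?g = f x - f u" if "x \<in> {u..v}" for x
        using comb(2)[of x] comb(3)[of x] g(3,4) that trans by (cases "x \<le> m") auto
      with comb(1) show "\<exists>g. g absolutely_integrable_on {u..v} \<and> (\<forall>x\<in>{u..v}. integral {u..x} g = f x - f u)"
        by blast
    qed
  next
    case (local x)
    obtain \<delta> where \<delta>: "\<delta> > 0" and small: "\<And>D. nonoverlapping c d D \<Longrightarrow> (\<Sum>(u, v)\<in>D. v - u) < \<delta>
          \<Longrightarrow> (\<Sum>(u, v)\<in>D. cmod (f v - f u)) < 1"
      using ac[unfolded abs_cont_on_iff_nonoverlapping, rule_format, of 1] by auto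
    have "P u v" if uv: "u \<le> x" "x \<le> v" "v - u < \<delta>" for u v
      unfolding P_def
    proof
      assume cuv: "c \<le> u \<and> v \<le> d"
      show "\<exists>g. g absolutely_integrable_on {u..v} \<and> (\<forall>x\<in>{u..v}. integral {u..x} g = f x - f u)"
      proof (cases "u = v")
        case True
        then show ?thesis by (intro exI[of _ "\<lambda>_. 0"]) simp
      next
        case False
        then have "u < v" using uv by simp
        moreover have "(\<Sum>(u, v)\<in>D. cmod (f v - f u)) \<le> 1" if "nonoverlapping u v D" for D
          using small[of D] nonoverlapping_length[OF that] nonoverlapping_subinterval[OF that] uv cuv by fastforce
        moreover have "abs_cont_on {u..v} f"
          using abs_cont_on_subinterval[OF ac] cuv by simp
        ultimately obtain g where "g absolutely_integrable_on {u..v}" "\<And>x. x \<in> {u..v} \<Longrightarrow> integral {u..x} g = f x - f u"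
          using abs_cont_on_bounded_variation_density by metis
        then show ?thesis by blast
      qed
    qed
    then show ?case using \<delta> by blast
  qed
  then show thesis using that unfolding P_def by blast
qed

text \<open>\<open>integrable_ccontinuous_explicit\<close> controls difference quotients from the
  right; applied to the reflected function it controls those from the left. Extension by zero to
  \<open>g0\<close> supplies integrability on every interval.\<close>

lemma indefinite_integral_has_vector_derivative_AE:
  fixes g :: "real \<Rightarrow> 'a::euclidean_space"
  assumes g: "g absolutely_integrable_on {c..d}"
  obtains N where "negligible N"
    "\<And>x. x \<in> {c<..<d} - N \<Longrightarrow> ((\<lambda>x. integral {c..x} g) has_vector_derivative g x) (at x)"
proof -
  define g0 where "g0 x = (if x \<in> {c..d} then g x else 0)" for x
  have "g0 absolutely_integrable_on UNIV"
    unfolding g0_def[abs_def] using g absolutely_integrable_restrict_UNIV by blast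
  then have "g0 absolutely_integrable_on {u..v}" for u v
    by (rule set_integrable_subset) auto
  then have g0: "g0 integrable_on {u..v}" for u v
    by (rule set_lebesgue_integral_eq_integral(1))
  have gr: "(\<lambda>x. g0 (- x)) integrable_on {u..v}" for u v
    using Henstock_Kurzweil_Integration.integrable_reflect_real[where f = g0 and a = "-v" and b = "-u"] g0[of "-v" "-u"] by simp
  obtain N1 where N1: "negligible N1" "\<And>x e. \<lbrakk>x \<notin> N1; 0 < e\<rbrakk> \<Longrightarrow>
       \<exists>d>0. \<forall>h. 0 < h \<and> h < d \<longrightarrow> norm (integral {x..x + h} g0 /\<^sub>R h - g0 x) < e"
    using integrable_ccontinuous_explicit[of g0] g0 by auto
  obtain N2 where N2: "negligible N2" "\<And>x e. \<lbrakk>x \<notin> N2; 0 < e\<rbrakk> \<Longrightarrow>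
       \<exists>d>0. \<forall>h. 0 < h \<and> h < d \<longrightarrow> norm (integral {x..x + h} (\<lambda>x. g0 (-x)) /\<^sub>R h - g0 (-x)) < e"
    using integrable_ccontinuous_explicit[of "\<lambda>x. g0 (-x)"] gr by auto
  have negN: "negligible (N1 \<union> uminus ` N2)"
    using N1(1) N2(1)
    by (auto intro!: negligible_differentiable_image_negligible derivative_intros)
  have der: "((\<lambda>x. integral {c..x} g) has_vector_derivative g x) (at x)"
    if x: "x \<in> {c<..<d} - (N1 \<union> uminus ` N2)" for x
  proof -
    have xN: "x \<notin> N1" "- x \<notin> N2" "c < x" "x < d" using x by force+
    have "((\<lambda>x. integral {c..x} g) has_derivative (\<lambda>h. h *\<^sub>R g x)) (at x)"
      unfolding has_derivative_within_alt
    proof (intro conjI allI impI)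
      show "bounded_linear (\<lambda>h. h *\<^sub>R g x)" by (rule bounded_linear_scaleR_left)
      fix e :: real assume e: "e > 0"
      obtain d1 where d1: "d1 > 0" "\<And>h. 0 < h \<Longrightarrow> h < d1 \<Longrightarrow> norm (integral {x..x + h} g0 /\<^sub>R h - g0 x) < e"
        using N1(2)[OF xN(1) e] by blast
      obtain d2 where d2: "d2 > 0" "\<And>h. 0 < h \<Longrightarrow> h < d2 \<Longrightarrow> norm (integral {-x..-x + h} (\<lambda>x. g0 (-x)) /\<^sub>R h - g0 x) < e"
        using N2(2)[OF xN(2) e] by auto
      have scale: "norm (I - h *\<^sub>R z) \<le> e * h" if "norm (I /\<^sub>R h - z) < e" "h > 0" for I z :: 'a and h :: real
      proof -
        have "norm (I - h *\<^sub>R z) = norm (h *\<^sub>R (I /\<^sub>R h - z))"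
          using that(2) by (simp add: algebra_simps)
        also have "\<dots> = h * norm (I /\<^sub>R h - z)" using that(2) by simp
        also have "\<dots> \<le> e * h" using that by simp
        finally show ?thesis .
      qed
      have intg: "integral {u..v} g0 = integral {u..v} g" if "c \<le> u" "v \<le> d" for u v
        by (rule integral_cong) (use that in \<open>auto simp: g0_def\<close>)
      have comb: "integral {c..v} g = integral {c..u} g + integral {u..v} g" if "c \<le> u" "u \<le> v" "v \<le> d" for u v
      proof -
        have "g integrable_on {c..v}"
          by (rule set_lebesgue_integral_eq_integral(1)[OF set_integrable_subset[OF g]]) (use that in auto)
        then show ?thesis using Henstock_Kurzweil_Integration.integral_combine[of c u v g] that by simp
      qed
      have "norm (integral {c..y} g - integral {c..x} g - (y - x) *\<^sub>R g x) \<le> e * norm (y - x)"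
        if y: "norm (y - x) < Min {d1, d2, x - c, d - x}" for y
      proof (cases y x rule: linorder_cases)
        case less
        define h where "h = x - y"
        have h: "0 < h" "h < d2" "c \<le> y" using less y by (auto simp: h_def)
        have "integral {-x..-x + h} (\<lambda>x. g0 (-x)) = integral {y..x} g0"
          using Henstock_Kurzweil_Integration.integral_reflect_real[where f = g0 and a = y and b = x] by (simp add: h_def)
        also have "\<dots> = integral {y..x} g" by (rule intg) (use h xN in auto)
        finally have "norm (integral {y..x} g /\<^sub>R h - g0 x) < e" using d2(2)[OF h(1,2)] by simp
        from scale[OF this h(1)] have "norm (integral {y..x} g - h *\<^sub>R g0 x) \<le> e * h" .
        moreover have "integral {c..y} g - integral {c..x} g - (y - x) *\<^sub>R g x = - (integral {y..x} g - h *\<^sub>R g0 x)"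
          using comb[of y x] h xN less by (simp add: h_def g0_def algebra_simps)
        ultimately show ?thesis using h by (simp only: norm_minus_cancel) (simp add: h_def)
      next
        case greater
        define h where "h = y - x"
        have h: "0 < h" "h < d1" "y \<le> d" using greater y by (auto simp: h_def)
        have "integral {x..x + h} g0 = integral {x..y} g"
          unfolding h_def using intg[of x y] h xN by simp
        then have "norm (integral {x..y} g /\<^sub>R h - g0 x) < e" using d1(2)[OF h(1,2)] by simp
        from scale[OF this h(1)] have "norm (integral {x..y} g - h *\<^sub>R g0 x) \<le> e * h" .
        moreover have "integral {c..y} g - integral {c..x} g - (y - x) *\<^sub>R g x = integral {x..y} g - h *\<^sub>R g0 x"
          using comb[of x y] h xN greater by (simp add: h_def g0_def)
        ultimately show ?thesis using h by (simp add: h_def)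
      qed simp
      then show "\<exists>\<delta>>0. \<forall>y\<in>UNIV. norm (y - x) < \<delta> \<longrightarrow>
          norm (integral {c..y} g - integral {c..x} g - (y - x) *\<^sub>R g x) \<le> e * norm (y - x)"
        using d1(1) d2(1) xN by (intro exI[of _ "Min {d1, d2, x - c, d - x}"]) simp
    qed
    then show ?thesis by (simp add: has_vector_derivative_def)
  qed
  show thesis using that negN der by blast
qed

theorem abs_cont_on_FTC:
  assumes cd: "c \<le> d" and ac: "abs_cont_on {c..d} f"
  shows "\<exists>N. negligible N \<and> (\<forall>x\<in>{c<..<d} - N. (f has_vector_derivative vderiv f x) (at x))"
    and "vderiv f absolutely_integrable_on {c..d}"
    and "\<And>x. x \<in> {c..d} \<Longrightarrow> integral {c..x} (vderiv f) = f x - f c"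
proof -
  obtain g where g: "g absolutely_integrable_on {c..d}" "\<And>x. x \<in> {c..d} \<Longrightarrow> integral {c..x} g = f x - f c"
    using abs_cont_on_density[OF cd ac] by blast
  obtain N where N: "negligible N"
    "\<And>x. x \<in> {c<..<d} - N \<Longrightarrow> ((\<lambda>x. integral {c..x} g) has_vector_derivative g x) (at x)"
    using indefinite_integral_has_vector_derivative_AE[OF g(1)] by blast
  have der: "(f has_vector_derivative g x) (at x)" if "x \<in> {c<..<d} - N" for x
  proof -
    have "((\<lambda>x. f c + integral {c..x} g) has_vector_derivative g x) (at x)"
      using has_vector_derivative_add[OF has_vector_derivative_const N(2)[OF that]] by simp
    then show ?thesis
      by (rule has_vector_derivative_transform_within_open[where S = "{c<..<d}"]) (use that g(2) in auto)
  qed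
  have vd: "vderiv f x = g x" if "x \<in> {c<..<d} - N" for x
    using der[OF that] by (rule vector_derivative_at)
  \<comment> \<open>At \<open>c\<close> and \<open>d\<close> the value of \<open>vderiv f\<close>
    depends on \<open>f\<close> outside the interval, so these points join the exceptional
    set.\<close>
  have neg: "negligible (N \<union> {c, d})" using N(1) by simp
  show "\<exists>N. negligible N \<and> (\<forall>x\<in>{c<..<d} - N. (f has_vector_derivative vderiv f x) (at x))"
    using N(1) der vd by (intro exI[of _ N]) auto
  show "vderiv f absolutely_integrable_on {c..d}"
    using g(1) neg by (rule absolutely_integrable_spike) (use vd in auto)
  show "integral {c..x} (vderiv f) = f x - f c" if x: "x \<in> {c..d}" for x
  proof -
    have "integral {c..x} (vderiv f) = integral {c..x} g"
      by (rule integral_spike[OF neg]) (use vd x in auto)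
    then show ?thesis using g(2)[OF x] by simp
  qed
qed

section \<open>Operations on absolutely continuous functions\<close>

lemma sum_integral_nonoverlapping_le:
  fixes \<phi> :: "real \<Rightarrow> real"
  assumes D: "nonoverlapping c d D" and \<phi>: "\<phi> absolutely_integrable_on {c..d}" "\<And>x. 0 \<le> \<phi> x"
  shows "(\<Sum>(u, v)\<in>D. integral {u..v} \<phi>) \<le> integral {c..d} \<phi>"
proof -
  have fin: "finite D" and D1: "\<And>p. p \<in> D \<Longrightarrow> c \<le> fst p \<and> fst p \<le> snd p \<and> snd p \<le> d"
    and dis: "disjoint_family_on (\<lambda>p. {fst p<..<snd p}) D"
    using D unfolding nonoverlapping_def by (auto simp: case_prod_beta')
  have int: "set_integrable lebesgue {fst p<..<snd p} \<phi>" if "p \<in> D" for p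
    by (rule set_integrable_subset[OF \<phi>(1)]) (use D1[OF that] in auto)
  have intU: "set_integrable lebesgue (\<Union>p\<in>D. {fst p<..<snd p}) \<phi>"
    by (rule set_integrable_UN) (use fin int in auto)
  have eq: "integral {fst p..snd p} \<phi> = (LINT x:{fst p<..<snd p}|lebesgue. \<phi> x)" if "p \<in> D" for p
    using set_lebesgue_integral_eq_integral(2)[OF int[OF that]] integral_open_interval_real[of "fst p" "snd p" \<phi>]
    by simp
  have "(\<Sum>(u, v)\<in>D. integral {u..v} \<phi>) = (\<Sum>p\<in>D. LINT x:{fst p<..<snd p}|lebesgue. \<phi> x)"
    by (rule sum.cong) (use eq in \<open>auto\<close>)
  also have "\<dots> = (LINT x:(\<Union>p\<in>D. {fst p<..<snd p})|lebesgue. \<phi> x)"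
    by (rule set_integral_finite_Union[symmetric]) (use fin dis int in auto)
  also have "\<dots> = integral (\<Union>p\<in>D. {fst p<..<snd p}) \<phi>"
    by (rule set_lebesgue_integral_eq_integral(2)[OF intU])
  also have "\<dots> \<le> integral {c..d} \<phi>"
  proof (rule integral_subset_le)
    show "(\<Union>p\<in>D. {fst p<..<snd p}) \<subseteq> {c..d}" using D1 by force
    show "\<phi> integrable_on (\<Union>p\<in>D. {fst p<..<snd p})"
      by (rule set_lebesgue_integral_eq_integral(1)[OF intU])
    show "\<phi> integrable_on {c..d}" by (rule set_lebesgue_integral_eq_integral(1)[OF \<phi>(1)])
  qed (use \<phi> in auto)
  finally show ?thesis .
qed

text \<open>Truncation at a level \<open>n\<close> splits \<psi> into a tail with integral below
  \<epsilon>/2 and a part bounded by \<open>n\<close>, which contributes at most \<open>n\<close>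
  times the total length. The majorant may thus be unbounded, as it is for the solution near the
  singular points.\<close>

lemma abs_cont_on_dominated:
  fixes \<psi> :: "real \<Rightarrow> real"
  assumes \<psi>: "\<psi> absolutely_integrable_on {c..d}" "\<And>x. 0 \<le> \<psi> x"
    and le: "\<And>u v. c \<le> u \<Longrightarrow> u \<le> v \<Longrightarrow> v \<le> d \<Longrightarrow> cmod (f v - f u) \<le> integral {u..v} \<psi>"
  shows "abs_cont_on {c..d} f"
  unfolding abs_cont_on_iff_nonoverlapping
proof (intro allI impI)
  fix \<epsilon> :: real assume \<epsilon>: "\<epsilon> > 0"
  have absint: "(\<lambda>x. min (\<psi> x) (real k)) absolutely_integrable_on {c..d}" for k
    by (rule absolutely_integrable_min_1[OF \<psi>(1)]) auto
  have absint': "(\<lambda>x. \<psi> x - min (\<psi> x) (real k)) absolutely_integrable_on {c..d}" for k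
    by (rule set_integral_diff(1)[OF \<psi>(1) absint])
  note int = set_lebesgue_integral_eq_integral(1)
  have "(\<lambda>k. integral {c..d} (\<lambda>x. \<psi> x - min (\<psi> x) (real k))) \<longlonglongrightarrow> integral {c..d} (\<lambda>x. 0)"
  proof (rule dominated_convergence(2)[where h = \<psi>])
    show "(\<lambda>x. \<psi> x - min (\<psi> x) (real k)) integrable_on {c..d}" for k using absint' by (rule int)
    show "\<psi> integrable_on {c..d}" using \<psi>(1) by (rule int)
    show "norm (\<psi> x - min (\<psi> x) (real k)) \<le> \<psi> x" for k x using \<psi>(2)[of x] by auto
    show "(\<lambda>k. \<psi> x - min (\<psi> x) (real k)) \<longlonglongrightarrow> 0" for x
    proof (rule tendsto_eventually)
      obtain n where "\<psi> x \<le> real n" using real_arch_simple by blast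
      then have "\<psi> x - min (\<psi> x) (real k) = 0" if "k \<ge> n" for k
        using that by auto
      then show "\<forall>\<^sub>F k in sequentially. \<psi> x - min (\<psi> x) (real k) = 0"
        unfolding eventually_sequentially by blast
    qed
  qed
  then have "\<forall>\<^sub>F k in sequentially. integral {c..d} (\<lambda>x. \<psi> x - min (\<psi> x) (real k)) < \<epsilon> / 2"
    by (rule order_tendstoD) (use \<epsilon> in simp)
  then obtain n where n: "integral {c..d} (\<lambda>x. \<psi> x - min (\<psi> x) (real n)) < \<epsilon> / 2"
    unfolding eventually_sequentially by blast
  \<comment> \<open>The added 1 keeps the quotient meaningful for \<open>n = 0\<close>.\<close>
  define \<delta> where "\<delta> = \<epsilon> / (2 * (real n + 1))"
  have "(\<Sum>(u, v)\<in>D. cmod (f v - f u)) < \<epsilon>" if D: "nonoverlapping c d D" and len: "(\<Sum>(u, v)\<in>D. v - u) < \<delta>" for D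
  proof -
    have D1: "\<And>p. p \<in> D \<Longrightarrow> c \<le> fst p \<and> fst p \<le> snd p \<and> snd p \<le> d"
      using D unfolding nonoverlapping_def by auto
    have "(\<Sum>(u, v)\<in>D. cmod (f v - f u)) \<le>
        (\<Sum>(u, v)\<in>D. integral {u..v} (\<lambda>x. \<psi> x - min (\<psi> x) (real n)) + real n * (v - u))"
    proof (rule sum_mono)
      fix p assume p: "p \<in> D"
      let ?u = "fst p" and ?v = "snd p"
      have sub: "{?u..?v} \<subseteq> {c..d}" using D1[OF p] by auto
      have i1: "(\<lambda>x. \<psi> x - min (\<psi> x) (real n)) integrable_on {?u..?v}"
        by (rule int[OF set_integrable_subset[OF absint' _ sub]]) auto
      have i2: "(\<lambda>x. min (\<psi> x) (real n)) integrable_on {?u..?v}"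
        by (rule int[OF set_integrable_subset[OF absint _ sub]]) auto
      have "cmod (f ?v - f ?u) \<le> integral {?u..?v} \<psi>"
        using le D1[OF p] by blast
      also have "\<dots> = integral {?u..?v} (\<lambda>x. \<psi> x - min (\<psi> x) (real n)) + integral {?u..?v} (\<lambda>x. min (\<psi> x) (real n))"
        using integral_add[OF i1 i2] by simp
      also have "integral {?u..?v} (\<lambda>x. min (\<psi> x) (real n)) \<le> integral {?u..?v} (\<lambda>x. real n)"
        by (rule integral_le[OF i2]) auto
      finally show "(case p of (u, v) \<Rightarrow> cmod (f v - f u)) \<le>
        (case p of (u, v) \<Rightarrow> integral {u..v} (\<lambda>x. \<psi> x - min (\<psi> x) (real n)) + real n * (v - u))"
        using D1[OF p] by (simp add: case_prod_beta' mult.commute)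
    qed
    also have "\<dots> = (\<Sum>(u, v)\<in>D. integral {u..v} (\<lambda>x. \<psi> x - min (\<psi> x) (real n))) + real n * (\<Sum>(u, v)\<in>D. v - u)"
      by (simp add: sum.distrib sum_distrib_left case_prod_beta')
    also have "\<dots> < \<epsilon> / 2 + \<epsilon> / 2"
    proof (rule add_less_le_mono)
      show "(\<Sum>(u, v)\<in>D. integral {u..v} (\<lambda>x. \<psi> x - min (\<psi> x) (real n))) < \<epsilon> / 2"
        using sum_integral_nonoverlapping_le[OF D absint', of n] n by fastforce
      have "real n * (\<Sum>(u, v)\<in>D. v - u) \<le> real n * \<delta>"
        using len by (intro mult_left_mono) auto
      also have "\<dots> \<le> \<epsilon> / 2" using \<epsilon> by (simp add: \<delta>_def field_simps)
      finally show "real n * (\<Sum>(u, v)\<in>D. v - u) \<le> \<epsilon> / 2" .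
    qed
    finally show ?thesis by simp
  qed
  then show "\<exists>\<delta>>0. \<forall>D. nonoverlapping c d D \<and> (\<Sum>(u, v)\<in>D. v - u) < \<delta>
        \<longrightarrow> (\<Sum>(u, v)\<in>D. cmod (f v - f u)) < \<epsilon>"
    using \<epsilon> by (intro exI[of _ \<delta>]) (auto simp: \<delta>_def)
qed

lemma abs_cont_on_indefinite_integral:
  assumes g: "g absolutely_integrable_on {c..d}"
    and f: "\<And>x. x \<in> {c..d} \<Longrightarrow> f x = C + integral {c..x} g"
  shows "abs_cont_on {c..d} f"
proof (rule abs_cont_on_dominated)
  show "(\<lambda>x. cmod (g x)) absolutely_integrable_on {c..d}"
    using g by (rule absolutely_integrable_norm[unfolded o_def])
  fix u v assume uv: "c \<le> u" "u \<le> v" "v \<le> d"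
  have gi: "g absolutely_integrable_on {s..t}" if "c \<le> s" "t \<le> d" for s t
    by (rule set_integrable_subset[OF g]) (use that in auto)
  have gi': "(\<lambda>x. cmod (g x)) integrable_on {u..v}" "g integrable_on {s..t}" if "c \<le> s" "t \<le> d" for s t
    using gi[of u v] gi[OF that] uv unfolding absolutely_integrable_on_def by auto
  have "integral {c..u} g + integral {u..v} g = integral {c..v} g"
    using uv gi' by (intro Henstock_Kurzweil_Integration.integral_combine) auto
  then have "f v - f u = integral {u..v} g" using f uv by (simp add: algebra_simps)
  moreover have "cmod (integral {u..v} g) \<le> integral {u..v} (\<lambda>x. cmod (g x))"
    by (rule integral_norm_bound_integral) (use gi' uv in auto)
  ultimately show "cmod (f v - f u) \<le> integral {u..v} (\<lambda>x. cmod (g x))" by simp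
qed simp

lemma abs_cont_on_C1:
  assumes der: "\<And>x. x \<in> {c..d} \<Longrightarrow> (f has_vector_derivative f' x) (at x within {c..d})"
    and cont: "continuous_on {c..d} f'"
  shows "abs_cont_on {c..d} f"
proof (rule abs_cont_on_indefinite_integral)
  show "f' absolutely_integrable_on {c..d}"
    using cont by (rule absolutely_integrable_continuous_real)
  fix x assume x: "x \<in> {c..d}"
  have "(f' has_integral (f x - f c)) {c..x}"
    by (rule fundamental_theorem_of_calculus)
       (use x in \<open>auto intro: has_vector_derivative_within_subset[OF der]\<close>)
  then show "f x = f c + integral {c..x} f'" by (simp add: integral_unique)
qed

text \<open>Common source of the closure of absolute continuity under differences and products.
  Enlarging \<open>K\<close> to at least 1 permits division by it.\<close>

lemma abs_cont_on_le_sum: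
  assumes f: "abs_cont_on {c..d} f" and g: "abs_cont_on {c..d} g"
    and le: "\<And>u v. c \<le> u \<Longrightarrow> u \<le> v \<Longrightarrow> v \<le> d \<Longrightarrow> cmod (h v - h u) \<le> K * (cmod (f v - f u) + cmod (g v - g u))"
  shows "abs_cont_on {c..d} h"
  unfolding abs_cont_on_iff_nonoverlapping
proof (intro allI impI)
  fix \<epsilon> :: real assume \<epsilon>: "\<epsilon> > 0"
  define K' where "K' = max 1 K"
  have K': "K' > 0" "K \<le> K'" by (auto simp: K'_def)
  obtain \<delta>1 where \<delta>1: "\<delta>1 > 0" "\<And>D. nonoverlapping c d D \<Longrightarrow> (\<Sum>(u, v)\<in>D. v - u) < \<delta>1
          \<Longrightarrow> (\<Sum>(u, v)\<in>D. cmod (f v - f u)) < \<epsilon> / (2 * K')"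
    using f[unfolded abs_cont_on_iff_nonoverlapping, rule_format, of "\<epsilon> / (2 * K')"] \<epsilon> K' by auto
  obtain \<delta>2 where \<delta>2: "\<delta>2 > 0" "\<And>D. nonoverlapping c d D \<Longrightarrow> (\<Sum>(u, v)\<in>D. v - u) < \<delta>2
          \<Longrightarrow> (\<Sum>(u, v)\<in>D. cmod (g v - g u)) < \<epsilon> / (2 * K')"
    using g[unfolded abs_cont_on_iff_nonoverlapping, rule_format, of "\<epsilon> / (2 * K')"] \<epsilon> K' by auto
  have "(\<Sum>(u, v)\<in>D. cmod (h v - h u)) < \<epsilon>"
    if D: "nonoverlapping c d D" and len: "(\<Sum>(u, v)\<in>D. v - u) < min \<delta>1 \<delta>2" for D
  proof -
    have "(\<Sum>(u, v)\<in>D. cmod (h v - h u)) \<le> (\<Sum>(u, v)\<in>D. K' * (cmod (f v - f u) + cmod (g v - g u)))"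
    proof (rule sum_mono)
      fix p assume "p \<in> D"
      then have p: "c \<le> fst p" "fst p \<le> snd p" "snd p \<le> d"
        using D unfolding nonoverlapping_def by auto
      have "K * (cmod (f (snd p) - f (fst p)) + cmod (g (snd p) - g (fst p)))
          \<le> K' * (cmod (f (snd p) - f (fst p)) + cmod (g (snd p) - g (fst p)))"
        using K'(2) by (intro mult_right_mono) auto
      then show "(case p of (u, v) \<Rightarrow> cmod (h v - h u)) \<le>
          (case p of (u, v) \<Rightarrow> K' * (cmod (f v - f u) + cmod (g v - g u)))"
        using le[OF p] by (simp add: case_prod_beta')
    qed
    also have "\<dots> = K' * ((\<Sum>(u, v)\<in>D. cmod (f v - f u)) + (\<Sum>(u, v)\<in>D. cmod (g v - g u)))"
      by (simp add: sum.distrib sum_distrib_left case_prod_beta' distrib_left)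
    also have "\<dots> < K' * (\<epsilon> / (2 * K') + \<epsilon> / (2 * K'))"
      using \<delta>1(2)[OF D] \<delta>2(2)[OF D] len K' by (intro mult_strict_left_mono add_strict_mono) auto
    also have "\<dots> = \<epsilon>" using K' by (simp add: field_simps)
    finally show ?thesis .
  qed
  then show "\<exists>\<delta>>0. \<forall>D. nonoverlapping c d D \<and> (\<Sum>(u, v)\<in>D. v - u) < \<delta>
        \<longrightarrow> (\<Sum>(u, v)\<in>D. cmod (h v - h u)) < \<epsilon>"
    using \<delta>1(1) \<delta>2(1) by (intro exI[of _ "min \<delta>1 \<delta>2"]) auto
qed

lemma abs_cont_on_diff:
  assumes "abs_cont_on {c..d} f" "abs_cont_on {c..d} g"
  shows "abs_cont_on {c..d} (\<lambda>x. f x - g x)"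
  using assms
proof (rule abs_cont_on_le_sum)
  show "cmod (f v - g v - (f u - g u)) \<le> 1 * (cmod (f v - f u) + cmod (g v - g u))" for u v
    using norm_triangle_ineq4[of "f v - f u" "g v - g u"] by (simp add: algebra_simps)
qed

lemma abs_cont_on_mult:
  assumes f: "abs_cont_on {c..d} f" and g: "abs_cont_on {c..d} g"
  shows "abs_cont_on {c..d} (\<lambda>x. f x * g x)"
proof -
  have "bounded (f ` {c..d})" "bounded (g ` {c..d})"
    using f g by (auto intro!: compact_imp_bounded compact_continuous_image abs_cont_on_imp_continuous_on)
  then obtain A B where A: "\<And>x. x \<in> {c..d} \<Longrightarrow> cmod (f x) \<le> A" and B: "\<And>x. x \<in> {c..d} \<Longrightarrow> cmod (g x) \<le> B"
    unfolding bounded_iff by blast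
  show ?thesis
    using f g
  proof (rule abs_cont_on_le_sum)
    fix u v assume uv: "c \<le> u" "u \<le> v" "v \<le> d"
    have "f v * g v - f u * g u = g v * (f v - f u) + f u * (g v - g u)"
      by (simp add: algebra_simps)
    then have "cmod (f v * g v - f u * g u) \<le> cmod (g v) * cmod (f v - f u) + cmod (f u) * cmod (g v - g u)"
      by (metis norm_mult norm_triangle_ineq)
    also have "\<dots> \<le> max A B * cmod (f v - f u) + max A B * cmod (g v - g u)"
      using A[of u] B[of v] uv by (intro add_mono mult_right_mono) auto
    finally show "cmod (f v * g v - f u * g u) \<le> max A B * (cmod (f v - f u) + cmod (g v - g u))"
      by (simp add: distrib_left)
  qed
qed

section \<open>The homogeneous solution\<close>

locale admissible_parameters =
  fixes a b :: real
  assumes a_pos: "a > 0" and b_pos: "b > 0" and ab: "2 * a + b < 2"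
begin

definition p :: "real \<Rightarrow> real" where "p x = 1 - a * cos x"

text \<open>The homogeneous equation prescribes the logarithmic derivative
  \<open>- p x / (b * sin x)\<close>, which has simple poles at 0 and at the end points. Their
  residues turn into the exponents -\<alpha> at 0 and \<beta> at \<open>-pi\<close> and
  \<open>pi\<close>.\<close>

definition \<alpha> :: real where "\<alpha> = (1 - a) / b"

definition \<beta> :: real where "\<beta> = (1 + a) / b"

text \<open>
  The square of the sine makes one formula serve both sides of \<open>0\<close>. Since \<open>0 powr r = 0\<close>, the function \<open>hom\<close>
  vanishes at \<open>0\<close>, near which it is unbounded, so \<open>sol\<close> below takes its limit values at \<open>0\<close> and \<open>\<plusminus>pi\<close>.
\<close>

definition hom :: "real \<Rightarrow> real" where
  "hom x = (sin (x/2))\<^sup>2 powr (-(\<alpha>/2)) * cos (x/2) powr \<beta>"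

text \<open>The reciprocal of \<open>hom\<close> away from the singular points. Its value 0 at 0 is
  a true limit as \<alpha> > 0, so \<open>hinv\<close> is continuous on the whole open interval; its
  value 0 at \<open>-pi\<close> and \<open>pi\<close>, where it is unbounded, is only the default of
  \<open>powr\<close>.\<close>

definition hinv :: "real \<Rightarrow> real" where
  "hinv x = (sin (x/2))\<^sup>2 powr (\<alpha>/2) * cos (x/2) powr (-\<beta>)"

lemma a_less_1: "a < 1"
  using b_pos ab by simp

lemma p_bounds: "1 - a \<le> p x" "p x \<le> 1 + a" "p x > 0"
proof -
  have "\<bar>a * cos x\<bar> \<le> a * 1"
    unfolding abs_mult using a_pos by (intro mult_mono) auto
  then show "1 - a \<le> p x" "p x \<le> 1 + a" unfolding p_def by linarith+
  with a_less_1 show "p x > 0" by linarith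
qed

text \<open>The first inequality is 2 a + b < 2 rewritten; 1/2 is the threshold at which the square
  of \<bar>x\<bar> to the power -\<alpha> ceases to be integrable at 0.\<close>

lemma \<alpha>_gt: "\<alpha> > 1/2" and \<beta>_gt: "\<beta> > 1/2"
  using a_pos b_pos ab by (auto simp: \<alpha>_def \<beta>_def field_simps)

lemma half_angle:
  assumes "-pi < x" "x < pi" "x \<noteq> 0"
  shows "sin (x/2) \<noteq> 0" "cos (x/2) > 0" "sin x \<noteq> 0" "sin x = 2 * sin (x/2) * cos (x/2)"
proof -
  show c: "cos (x/2) > 0" by (rule cos_gt_zero_pi) (use assms in auto)
  show s: "sin (x/2) \<noteq> 0"
  proof (cases "x > 0")
    case True
    then show ?thesis using sin_gt_zero[of "x/2"] assms by auto
  next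
    case False
    then show ?thesis using sin_gt_zero[of "-x/2"] assms by auto
  qed
  show "sin x = 2 * sin (x/2) * cos (x/2)" using sin_double[of "x/2"] by simp
  with c s show "sin x \<noteq> 0" by simp
qed

text \<open>Division by b sin x = 2 b sin(x/2) cos(x/2) turns this into \<alpha>/2 cot(x/2) +
  \<beta>/2 tan(x/2), which is the logarithmic derivative of \<open>hinv\<close>.\<close>

lemma p_half_angle: "p x = b * (\<alpha> * (cos (x/2))\<^sup>2 + \<beta> * (sin (x/2))\<^sup>2)"
proof -
  have cos_x: "cos x = (cos (x/2))\<^sup>2 - (sin (x/2))\<^sup>2" using cos_double[of "x/2"] by simp
  have "b * \<alpha> = 1 - a" "b * \<beta> = 1 + a" using b_pos by (simp_all add: \<alpha>_def \<beta>_def)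
  then have "b * (\<alpha> * (cos (x/2))\<^sup>2 + \<beta> * (sin (x/2))\<^sup>2) = (1 - a) * (cos (x/2))\<^sup>2 + (1 + a) * (sin (x/2))\<^sup>2"
    by (simp add: distrib_left flip: mult.assoc)
  also have "\<dots> = ((sin (x/2))\<^sup>2 + (cos (x/2))\<^sup>2) - a * cos x"
    unfolding cos_x by (simp only: algebra_simps)
  also have "\<dots> = p x" by (simp add: p_def)
  finally show ?thesis by simp
qed

lemma hom_hinv:
  assumes "-pi < x" "x < pi" "x \<noteq> 0"
  shows "hom x * hinv x = 1" "hom x > 0" "hinv x > 0"
  using half_angle[OF assms] unfolding hom_def hinv_def
  by (auto simp: powr_minus field_simps)

lemma hom_eq_0: "x \<in> {-pi, 0, pi} \<Longrightarrow> hom x = 0"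
  by (auto simp: hom_def)

lemma hinv_minus: "hinv (- x) = hinv x"
  by (simp add: hinv_def)

lemma hinv_deriv:
  assumes "-pi < x" "x < pi" "x \<noteq> 0"
  shows "(hinv has_real_derivative hinv x * (p x / (b * sin x))) (at x)"
proof -
  define s c where "s = sin (x/2)" and "c = cos (x/2)"
  note ha = half_angle[OF assms, folded s_def c_def]
  have d1: "((\<lambda>x. (sin (x/2))\<^sup>2 powr (\<alpha>/2)) has_real_derivative
      \<alpha>/2 * s\<^sup>2 powr (\<alpha>/2 - of_nat 1) * (s * c)) (at x)"
    unfolding s_def c_def
    by (rule DERIV_fun_powr) (use ha in \<open>auto intro!: derivative_eq_intros simp: s_def\<close>)
  have d2: "((\<lambda>x. cos (x/2) powr (-\<beta>)) has_real_derivative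
      (-\<beta>) * c powr (-\<beta> - of_nat 1) * (- s / 2)) (at x)"
    unfolding s_def c_def
    by (rule DERIV_fun_powr) (use ha in \<open>auto intro!: derivative_eq_intros simp: c_def\<close>)
  have d: "(hinv has_real_derivative (\<alpha>/2 * s\<^sup>2 powr (\<alpha>/2 - of_nat 1) * (s * c)) * c powr (-\<beta>)
      + (-\<beta>) * c powr (-\<beta> - of_nat 1) * (- s / 2) * s\<^sup>2 powr (\<alpha>/2)) (at x)"
    using DERIV_mult[OF d1 d2] unfolding hinv_def[abs_def] s_def c_def by simp
  have e1: "s\<^sup>2 powr (\<alpha>/2 - of_nat 1) = s\<^sup>2 powr (\<alpha>/2) / s\<^sup>2" "c powr (-\<beta> - of_nat 1) = c powr (-\<beta>) / c"
    using ha by (simp_all add: powr_diff)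
  have e2: "hinv x = s\<^sup>2 powr (\<alpha>/2) * c powr (-\<beta>)" by (simp add: hinv_def s_def c_def)
  have e3: "p x / (b * sin x) = (\<alpha> * c\<^sup>2 + \<beta> * s\<^sup>2) / (2 * s * c)"
    unfolding p_half_angle ha(4) using b_pos by (simp add: s_def c_def)
  have e4: "(\<alpha>/2 * (A / s\<^sup>2) * (s * c)) * B + (-\<beta>) * (B / c) * (- s / 2) * A
      = A * B * ((\<alpha> * c\<^sup>2 + \<beta> * s\<^sup>2) / (2 * s * c))" for A B
    using ha by (simp add: field_simps power2_eq_square)
  show ?thesis using d unfolding e1 e2 e3 e4 .
qed

lemma hom_deriv:
  assumes "-pi < x" "x < pi" "x \<noteq> 0"
  shows "(hom has_real_derivative - hom x * (p x / (b * sin x))) (at x)"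
proof -
  have "((\<lambda>x. inverse (hinv x)) has_real_derivative - hom x * (p x / (b * sin x))) (at x)"
  proof -
    have inv: "inverse (hinv x) = hom x" using hom_hinv[OF assms] by (simp add: field_simps)
    have eq: "- (hom x * (hinv x * Q) * hom x) = - hom x * Q" for Q
    proof -
      have "hom x * (hinv x * Q) * hom x = (hom x * hinv x) * (hom x * Q)" by (simp only: ac_simps)
      then show ?thesis unfolding hom_hinv(1)[OF assms] by simp
    qed
    have "hinv x \<noteq> 0" using hom_hinv(3)[OF assms] by simp
    from DERIV_inverse'[OF hinv_deriv[OF assms] this] show ?thesis
      unfolding inv eq .
  qed
  moreover have "open ({-pi<..<pi} - {0})" by auto
  ultimately show ?thesis
  proof (rule has_field_derivative_transform_within_open)
    show "x \<in> {-pi<..<pi} - {0}" using assms by simp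
    show "inverse (hinv y) = hom y" if "y \<in> {-pi<..<pi} - {0}" for y
      using hom_hinv[of y] that by (simp add: field_simps)
  qed
qed

lemma hinv_continuous: "continuous_on {-pi<..<pi} hinv"
  unfolding hinv_def[abs_def]
proof (intro continuous_on_mult)
  show "continuous_on {-pi<..<pi} (\<lambda>x. (sin (x/2))\<^sup>2 powr (\<alpha>/2))"
    by (rule continuous_on_powr') (use \<alpha>_gt in \<open>auto intro!: continuous_intros\<close>)
  have "cos (x/2) > 0" if "x \<in> {-pi<..<pi}" for x
    by (rule cos_gt_zero_pi) (use that in auto)
  then show "continuous_on {-pi<..<pi} (\<lambda>x. cos (x/2) powr (-\<beta>))"
    by (intro continuous_on_powr' continuous_intros) force+
qed

text \<open>The reciprocal of the least value of (2 + (b - 2 a) cos t) / b. It is positive because 0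
  < a < 1 and 0 < b < 2.\<close>

definition K\<^sub>0 :: real where "K\<^sub>0 = b / (2 - \<bar>b - 2 * a\<bar>)"

lemma K\<^sub>0_pos: "K\<^sub>0 > 0"
  using a_pos b_pos ab unfolding K\<^sub>0_def by (auto simp: abs_if)

text \<open>
  The right-hand side has derivative \<open>K\<^sub>0 (2 + (b - 2 a) cos x) / b\<close> times \<open>(hinv x)\<^sup>2\<close>, which is at least
  \<open>(hinv x)\<^sup>2\<close> by the choice of \<open>K\<^sub>0\<close>.
\<close>

lemma integral_hinv_square_le:
  assumes "0 \<le> x" "x < pi"
  shows "(\<lambda>t. (hinv t)\<^sup>2) integrable_on {0..x}" "integral {0..x} (\<lambda>t. (hinv t)\<^sup>2) \<le> K\<^sub>0 * sin x * (hinv x)\<^sup>2"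
proof -
  define F where "F t = K\<^sub>0 * sin t * (hinv t)\<^sup>2" for t
  define F' where "F' t = K\<^sub>0 * (hinv t)\<^sup>2 * (cos t + 2 * p t / b)" for t
  have sub: "{0..x} \<subseteq> {-pi<..<pi}" using assms pi_gt_zero by auto
  have cont: "continuous_on {0..x} hinv" by (rule continuous_on_subset[OF hinv_continuous sub])
  show i1: "(\<lambda>t. (hinv t)\<^sup>2) integrable_on {0..x}"
    by (intro integrable_continuous_interval continuous_intros cont)
  have "(F' has_integral (F x - F 0)) {0..x}"
  proof (rule fundamental_theorem_of_calculus_interior)
    show "continuous_on {0..x} F" unfolding F_def by (intro continuous_intros cont)
    fix t assume t: "t \<in> {0<..<x}"
    then have t': "-pi < t" "t < pi" "t \<noteq> 0" using assms pi_gt_zero by auto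
    have "sin t \<noteq> 0" using half_angle(3)[OF t'] .
    have "(F has_real_derivative F' t) (at t)"
      unfolding F_def F'_def
      by (rule derivative_eq_intros hinv_deriv[OF t'] refl)+
         (use \<open>sin t \<noteq> 0\<close> b_pos in \<open>simp add: field_simps power2_eq_square\<close>)
    then show "(F has_vector_derivative F' t) (at t)"
      by (simp add: has_real_derivative_iff_has_vector_derivative)
  qed (use assms in auto)
  then have F': "F' integrable_on {0..x}" "integral {0..x} F' = F x"
    by (auto simp: integral_unique F_def)
  have "(hinv t)\<^sup>2 \<le> F' t" for t
  proof -
    have "cos t + 2 * p t / b = (2 + (b - 2 * a) * cos t) / b"
      using b_pos by (simp add: p_def field_simps)
    moreover have "\<bar>(b - 2 * a) * cos t\<bar> \<le> \<bar>b - 2 * a\<bar> * 1"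
      unfolding abs_mult by (intro mult_left_mono) auto
    ultimately have "(2 - \<bar>b - 2 * a\<bar>) / b \<le> cos t + 2 * p t / b"
      using b_pos by (simp add: divide_right_mono)
    then have "1 / K\<^sub>0 \<le> cos t + 2 * p t / b" by (simp add: K\<^sub>0_def)
    then have "K\<^sub>0 * (hinv t)\<^sup>2 * (1 / K\<^sub>0) \<le> F' t"
      unfolding F'_def using K\<^sub>0_pos by (intro mult_left_mono) auto
    then show ?thesis using K\<^sub>0_pos by simp
  qed
  then show "integral {0..x} (\<lambda>t. (hinv t)\<^sup>2) \<le> K\<^sub>0 * sin x * (hinv x)\<^sup>2"
    using integral_le[OF i1 F'(1)] F'(2) by (simp add: F_def)
qed

text \<open>For a base of at most 1 the exponent -2\<alpha> < -1 gives a power of at least the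
  reciprocal, and \<bar>sin (x/2)\<bar> \<le> \<bar>x\<bar>. The restriction to \<bar>x\<bar> \<le>
  1 bounds the cosine factor from below. So the square of \<open>hom\<close> fails to be integrable
  on each side of 0.\<close>

lemma hom_square_ge:
  assumes "0 < \<bar>x\<bar>" "\<bar>x\<bar> \<le> 1"
  shows "cos (1/2) powr (2 * \<beta>) / \<bar>x\<bar> \<le> (hom x)\<^sup>2"
proof -
  define s where "s = \<bar>sin (x/2)\<bar>"
  have x: "-pi < x" "x < pi" "x \<noteq> 0" using assms pi_gt3 by auto
  have s: "0 < s" "s \<le> \<bar>x\<bar>" "s \<le> 1"
    using half_angle(1)[OF x] abs_sin_le_one[of "x/2"] abs_sin_x_le_abs_x[of "x/2"] by (auto simp: s_def)
  have c: "cos (1/2) \<le> cos (x/2)"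
  proof -
    have "cos (1/2) \<le> cos \<bar>x/2\<bar>"
      by (rule cos_monotone_0_pi_le) (use assms pi_gt3 in auto)
    also have "cos \<bar>x/2\<bar> = cos (x/2)" by (cases "x \<ge> 0") auto
    finally show ?thesis .
  qed
  have c0: "cos (1/2::real) > 0" by (rule cos_gt_zero_pi) (use pi_gt3 in auto)
  have "1 / \<bar>x\<bar> \<le> s powr (-1)" using s by (simp add: powr_minus field_simps)
  also have "\<dots> \<le> s powr (- (2 * \<alpha>))"
    using s \<alpha>_gt by (intro powr_mono') auto
  finally have 1: "1 / \<bar>x\<bar> \<le> s powr (- (2 * \<alpha>))" .
  have 2: "cos (1/2) powr (2 * \<beta>) \<le> cos (x/2) powr (2 * \<beta>)"
    using c c0 \<beta>_gt by (intro powr_mono2) auto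
  have "(sin (x/2))\<^sup>2 powr (-(\<alpha>/2)) = s powr (- \<alpha>)"
  proof -
    have "(sin (x/2))\<^sup>2 = s powr 2" using s by (simp add: s_def)
    then show ?thesis by (simp add: powr_powr)
  qed
  then have "(hom x)\<^sup>2 = (s powr (- \<alpha>))\<^sup>2 * (cos (x/2) powr \<beta>)\<^sup>2"
    by (simp add: hom_def power_mult_distrib)
  also have "\<dots> = s powr (- (2 * \<alpha>)) * cos (x/2) powr (2 * \<beta>)"
    using s c c0 by (simp add: power2_eq_square flip: powr_add)
  finally have "(hom x)\<^sup>2 = s powr (- (2 * \<alpha>)) * cos (x/2) powr (2 * \<beta>)" .
  moreover have "1 / \<bar>x\<bar> * cos (1/2) powr (2 * \<beta>) \<le> s powr (- (2 * \<alpha>)) * cos (x/2) powr (2 * \<beta>)"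
    using 1 2 by (intro mult_mono) auto
  ultimately show ?thesis by simp
qed

end

text \<open>
  A majorant of \<open>\<bar>sin x\<bar>\<close> to the power \<open>-1/2\<close> that has an elementary antiderivative.
\<close>

definition sing :: "real \<Rightarrow> real" where
  "sing x = \<bar>cos (x/2)\<bar> / sqrt \<bar>sin (x/2)\<bar> + \<bar>sin (x/2)\<bar> / sqrt \<bar>cos (x/2)\<bar>"

lemma sing_nonneg: "sing x \<ge> 0"
  by (simp add: sing_def)

lemma sing_minus: "sing (- x) = sing x"
  by (simp add: sing_def)

text \<open>With s and c the absolute sine and cosine of x/2, both at most 1, the sum of squares 1
  is at most s sqrt s + c sqrt c. Division by sqrt (s c) produces \<open>sing x\<close>, and
  \<bar>sin x\<bar> = 2 s c exceeds s c.\<close>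

lemma inverse_sqrt_sin_le_sing:
  assumes "-pi < x" "x < pi" "x \<noteq> 0"
  shows "1 / sqrt \<bar>sin x\<bar> \<le> sing x"
proof -
  define s c where "s = \<bar>sin (x/2)\<bar>" and "c = \<bar>cos (x/2)\<bar>"
  have "cos (x/2) > 0" by (rule cos_gt_zero_pi) (use assms in auto)
  moreover have "sin (x/2) \<noteq> 0"
    using sin_gt_zero[of "x/2"] sin_gt_zero[of "-x/2"] assms by (cases "x > 0") auto
  ultimately have sc: "0 < s" "0 < c" "s \<le> 1" "c \<le> 1" "s\<^sup>2 + c\<^sup>2 = 1" by (auto simp: s_def c_def)
  have abs_sin: "\<bar>sin x\<bar> = 2 * s * c"
    using sin_double[of "x/2"] by (simp add: s_def c_def abs_mult)
  have "1 = s\<^sup>2 + c\<^sup>2" using sc by simp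
  also have "\<dots> \<le> s * sqrt s + c * sqrt c"
  proof -
    have "t * t \<le> t * sqrt t" if "0 < t" "t \<le> 1" for t :: real
    proof (rule mult_left_mono)
      have "t\<^sup>2 \<le> t" using that by (simp add: power2_eq_square mult_left_le)
      then show "t \<le> sqrt t" by (rule real_le_rsqrt)
    qed (use that in simp)
    then show ?thesis using sc unfolding power2_eq_square by (intro add_mono) auto
  qed
  finally have "1 / (sqrt s * sqrt c) \<le> (s * sqrt s + c * sqrt c) / (sqrt s * sqrt c)"
    using sc by (intro divide_right_mono) auto
  also have "\<dots> = c / sqrt s + s / sqrt c"
    using sc by (simp add: field_simps)
  also have "\<dots> = sing x" by (simp add: sing_def s_def c_def)
  finally have *: "1 / (sqrt s * sqrt c) \<le> sing x" .
  have "sqrt s * sqrt c \<le> sqrt \<bar>sin x\<bar>"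
    unfolding abs_sin real_sqrt_mult[symmetric] using sc by simp
  then have "1 / sqrt \<bar>sin x\<bar> \<le> 1 / (sqrt s * sqrt c)"
    using sc abs_sin by (intro divide_left_mono) auto
  with * show ?thesis by linarith
qed

lemma sing_absolutely_integrable: "sing absolutely_integrable_on {-pi..pi}"
proof -
  \<comment> \<open>The elementary antiderivative on the right half; the left half follows because
    \<open>sing\<close> is even.\<close>
  define F where "F x = 4 * (sqrt (sin (x/2)) - sqrt (cos (x/2)))" for x :: real
  have "(sing has_integral (F pi - F 0)) {0..pi}"
  proof (rule fundamental_theorem_of_calculus_interior)
    show "continuous_on {0..pi} F" unfolding F_def by (intro continuous_intros) auto
    fix x :: real assume x: "x \<in> {0<..<pi}"
    have c: "cos (x/2) > 0" by (rule cos_gt_zero_pi) (use x in auto)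
    have s: "sin (x/2) > 0" using sin_gt_zero[of "x/2"] x by auto
    have "((\<lambda>x. sqrt (sin (x/2))) has_real_derivative inverse (sqrt (sin (x/2))) / 2 * (cos (x/2) * (1/2))) (at x)"
      by (rule DERIV_chain2[where f = sqrt and g = "\<lambda>x. sin (x/2)", OF DERIV_real_sqrt[OF s]]) (auto intro!: derivative_eq_intros)
    moreover have "((\<lambda>x. sqrt (cos (x/2))) has_real_derivative inverse (sqrt (cos (x/2))) / 2 * (- sin (x/2) * (1/2))) (at x)"
      by (rule DERIV_chain2[where f = sqrt and g = "\<lambda>x. cos (x/2)", OF DERIV_real_sqrt[OF c]]) (auto intro!: derivative_eq_intros)
    ultimately have "(F has_real_derivative 4 * (inverse (sqrt (sin (x/2))) / 2 * (cos (x/2) * (1/2)) -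
        inverse (sqrt (cos (x/2))) / 2 * (- sin (x/2) * (1/2)))) (at x)"
      unfolding F_def by (intro DERIV_cmult DERIV_diff)
    moreover have "4 * (inverse (sqrt (sin (x/2))) / 2 * (cos (x/2) * (1/2)) -
        inverse (sqrt (cos (x/2))) / 2 * (- sin (x/2) * (1/2))) = sing x"
    proof -
      have gen: "4 * (S / 2 * (c * (1/2)) - C / 2 * (- s * (1/2))) = c * S + s * C" for S C s c :: real
        by (simp add: algebra_simps)
      have "sing x = cos (x/2) * inverse (sqrt (sin (x/2))) + sin (x/2) * inverse (sqrt (cos (x/2)))"
        unfolding sing_def divide_inverse using s c by simp
      then show ?thesis unfolding gen by (rule sym)
    qed
    ultimately have "(F has_real_derivative sing x) (at x)" by simp
    then show "(F has_vector_derivative sing x) (at x)"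
      by (simp add: has_real_derivative_iff_has_vector_derivative)
  qed simp
  then have r: "sing absolutely_integrable_on {0..pi}"
    by (intro nonnegative_absolutely_integrable_1) (auto intro: sing_nonneg)
  then have "(\<lambda>x. sing (- x)) absolutely_integrable_on {-pi..-0}"
    by (subst absolutely_integrable_reflect_real)
  then have l: "sing absolutely_integrable_on {-pi..0}"
    by (simp add: sing_minus)
  show ?thesis
    using set_integrable_Un[OF l r] by (simp add: ivl_disj_un_two_touch)
qed

section \<open>Square integrable functions\<close>

lemma AE_leb_pi_iff_negligible:
  "(AE x in leb_pi. P x) \<longleftrightarrow> (\<exists>N. negligible N \<and> (\<forall>x\<in>{-pi<..<pi} - N. P x))"
proof -
  have "(AE x in leb_pi. P x) \<longleftrightarrow> (AE x in lebesgue. x \<in> {-pi<..<pi} \<longrightarrow> P x)"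
    by (rule AE_restrict_space_iff) simp
  also have "\<dots> \<longleftrightarrow> (\<exists>N. negligible N \<and> {x. \<not> (x \<in> {-pi<..<pi} \<longrightarrow> P x)} \<subseteq> N)"
    unfolding eventually_ae_filter_negligible by simp
  also have "\<dots> \<longleftrightarrow> (\<exists>N. negligible N \<and> (\<forall>x\<in>{-pi<..<pi} - N. P x))"
    by blast
  finally show ?thesis .
qed

lemma integrable_leb_pi_iff:
  fixes f :: "real \<Rightarrow> 'a::euclidean_space"
  shows "integrable leb_pi f \<longleftrightarrow> f absolutely_integrable_on {-pi..pi}"
proof -
  have "integrable leb_pi f \<longleftrightarrow> f absolutely_integrable_on {-pi<..<pi}"
    unfolding set_integrable_def by (rule integrable_restrict_space) simp
  then show ?thesis using absolutely_integrable_on_Icc_iff_Ioo[where f = f and a = "-pi" and b = pi] by simp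
qed

lemma integral_leb_pi:
  fixes f :: "real \<Rightarrow> 'a::euclidean_space"
  assumes "f absolutely_integrable_on {-pi..pi}"
  shows "(LINT x|leb_pi. f x) = integral {-pi..pi} f"
proof -
  have "(LINT x|leb_pi. f x) = integral {-pi<..<pi} f"
    using assms by (intro lebesgue_integral_eq_integral) (auto simp: integrable_leb_pi_iff)
  then show ?thesis using integral_open_interval_real[of "-pi" pi f] by simp
qed

lemma finite_measure_leb_pi: "finite_measure leb_pi"
  by (rule finite_measureI) (simp add: emeasure_restrict_space)

lemma square_integrable_imp_absolutely_integrable:
  assumes "square_integrable g"
  shows "g absolutely_integrable_on {-pi..pi}"
proof -
  have "integrable leb_pi g"
  proof (rule Bochner_Integration.integrable_bound)
    show "integrable leb_pi (\<lambda>x. 1 + (cmod (g x))\<^sup>2)"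
      using assms finite_measure.integrable_const[OF finite_measure_leb_pi, of "1::real"]
      by (simp add: square_integrable_def)
    show "g \<in> borel_measurable leb_pi" using assms by (simp add: square_integrable_def)
    have "t \<le> 1 + t\<^sup>2" for t :: real
      using sum_squares_bound[of 1 t] by (simp add: power2_eq_square) (smt (verit) zero_le_square)
    then show "AE x in leb_pi. norm (g x) \<le> norm (1 + (cmod (g x))\<^sup>2)" by simp
  qed
  then show ?thesis by (simp add: integrable_leb_pi_iff)
qed

definition l2norm :: "(real \<Rightarrow> complex) \<Rightarrow> real" where
  "l2norm f = sqrt (LINT x|leb_pi. (cmod (f x))\<^sup>2)"

lemma l2norm_nonneg: "l2norm f \<ge> 0"
  by (simp add: l2norm_def)

lemma norm_abs_L2: "square_integrable f \<Longrightarrow> norm (abs_L2 f) = l2norm f"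
  using norm_L2.abs_eq[of f] by (simp add: L2_rel_refl l2norm_def)

lemma inner_abs_L2: "square_integrable f \<Longrightarrow> square_integrable g \<Longrightarrow>
    inner (abs_L2 f) (abs_L2 g) = (LINT x|leb_pi. inner (f x) (g x))"
  using inner_L2.abs_eq[of f g] by (simp add: L2_rel_refl)

lemma square_integrable_bounded:
  assumes "f \<in> borel_measurable leb_pi" "\<And>x. x \<in> {-pi<..<pi} \<Longrightarrow> cmod (f x) \<le> B"
  shows "square_integrable f" "l2norm f \<le> B * sqrt (2 * pi)"
proof -
  have B: "B \<ge> 0" using assms(2)[of 0] norm_ge_zero[of "f 0"] by (simp del: norm_ge_zero)
  have le: "(cmod (f x))\<^sup>2 \<le> B\<^sup>2" if "x \<in> {-pi<..<pi}" for x
    by (rule power_mono[OF assms(2)[OF that]]) simp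
  have c: "integrable leb_pi (\<lambda>x. B\<^sup>2)"
    by (rule finite_measure.integrable_const[OF finite_measure_leb_pi])
  have i: "integrable leb_pi (\<lambda>x. (cmod (f x))\<^sup>2)"
  proof (rule Bochner_Integration.integrable_bound[OF c])
    show "(\<lambda>x. (cmod (f x))\<^sup>2) \<in> borel_measurable leb_pi"
      using assms(1) by measurable
    show "AE x in leb_pi. norm ((cmod (f x))\<^sup>2) \<le> norm (B\<^sup>2)"
      by (rule AE_I2) (use le in simp)
  qed
  with assms(1) show "square_integrable f" by (simp add: square_integrable_def)
  have "(LINT x|leb_pi. (cmod (f x))\<^sup>2) \<le> (LINT x|leb_pi. B\<^sup>2)"
    by (rule integral_mono[OF i c]) (use le in simp)
  also have "\<dots> = 2 * pi * B\<^sup>2"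
    by (simp add: measure_restrict_space)
  finally have "l2norm f \<le> sqrt (2 * pi * B\<^sup>2)" unfolding l2norm_def by (rule real_sqrt_le_mono)
  also have "\<dots> = B * sqrt (2 * pi)" using B by (simp add: real_sqrt_mult)
  finally show "l2norm f \<le> B * sqrt (2 * pi)" .
qed

lemma continuous_imp_measurable_leb_pi:
  fixes f :: "real \<Rightarrow> 'a::euclidean_space"
  assumes "continuous_on {-pi<..<pi} f"
  shows "f \<in> borel_measurable leb_pi"
  using assms by (rule continuous_imp_measurable_on_sets_lebesgue) simp

text \<open>Cauchy-Schwarz in \<open>L2\<close>. The inner product there is only the real part of
  the Hermitian one, so it is applied to the absolute values of \<open>k\<close> (extended by zero
  outside \<open>{u..v}\<close>) and of \<open>g\<close>, whose inner product is the integral of the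
  absolute value of the product.\<close>

lemma norm_integral_product_le:
  fixes k :: "real \<Rightarrow> real"
  assumes uv: "-pi \<le> u" "u \<le> v" "v \<le> pi" and k: "continuous_on {u..v} k" and g: "square_integrable g"
  shows "(\<lambda>x. k x *\<^sub>R g x) absolutely_integrable_on {u..v}"
    and "cmod (integral {u..v} (\<lambda>x. k x *\<^sub>R g x)) \<le> sqrt (integral {u..v} (\<lambda>x. (k x)\<^sup>2)) * l2norm g"
proof -
  define k1 where "k1 x = (indicator {u..v} x * k x)" for x :: real
  define K where "K x = complex_of_real \<bar>k1 x\<bar>" for x
  define g1 where "g1 x = complex_of_real (cmod (g x))" for x
  have "k absolutely_integrable_on {u..v}" by (rule absolutely_integrable_continuous_real[OF k])
  then have "k1 \<in> borel_measurable lebesgue"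
    unfolding set_integrable_def k1_def[abs_def] by (auto dest: borel_measurable_integrable)
  then have k1m: "k1 \<in> borel_measurable leb_pi" by (rule measurable_restrict_space1)
  have gm: "g \<in> borel_measurable leb_pi" using g by (simp add: square_integrable_def)
  have k2i: "(\<lambda>x. (k x)\<^sup>2) absolutely_integrable_on {u..v}"
    by (intro absolutely_integrable_continuous_real continuous_intros k)
  have k12: "(k1 x)\<^sup>2 = indicator {u..v} x *\<^sub>R (k x)\<^sup>2" for x
    by (simp add: k1_def indicator_def)
  have restr: "(\<lambda>x. indicat_real {u..v} x *\<^sub>R \<phi> x) absolutely_integrable_on {-pi..pi}"
    if "\<phi> absolutely_integrable_on {u..v}" for \<phi> :: "real \<Rightarrow> 'b::euclidean_space"
  proof -
    have "(\<lambda>x. indicat_real {-pi..pi} x *\<^sub>R indicat_real {u..v} x *\<^sub>R \<phi> x) = (\<lambda>x. indicat_real {u..v} x *\<^sub>R \<phi> x)"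
      using uv by (auto simp: fun_eq_iff indicator_def)
    then show ?thesis using that by (simp only: set_integrable_def)
  qed
  have restr_int: "integral {-pi..pi} (\<lambda>x. indicat_real {u..v} x *\<^sub>R \<phi> x) = integral {u..v} \<phi>"
    for \<phi> :: "real \<Rightarrow> 'b::euclidean_space"
  proof -
    have "integral {-pi..pi} (\<lambda>x. indicat_real {u..v} x *\<^sub>R \<phi> x) = integral {-pi..pi} (\<lambda>x. if x \<in> {u..v} then \<phi> x else 0)"
      by (rule integral_cong) (simp add: indicator_def)
    also have "\<dots> = integral ({u..v} \<inter> {-pi..pi}) \<phi>"
      by (rule integral_restrict_Int)
    also have "{u..v} \<inter> {-pi..pi} = {u..v}" using uv by auto
    finally show ?thesis .
  qed
  have normK: "(cmod (K x))\<^sup>2 = indicator {u..v} x *\<^sub>R (k x)\<^sup>2" for x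
    using k12[of x] by (simp add: K_def)
  have Ksq: "square_integrable K"
    unfolding square_integrable_def normK
  proof
    show "K \<in> borel_measurable leb_pi" unfolding K_def[abs_def] using k1m by measurable
    show "integrable leb_pi (\<lambda>x. indicat_real {u..v} x *\<^sub>R (k x)\<^sup>2)"
      unfolding integrable_leb_pi_iff by (rule restr[OF k2i])
  qed
  have Knorm: "l2norm K = sqrt (integral {u..v} (\<lambda>x. (k x)\<^sup>2))"
    unfolding l2norm_def normK by (simp only: integral_leb_pi[OF restr[OF k2i]] restr_int)
  have g1sq: "square_integrable g1"
    unfolding square_integrable_def
  proof
    show "g1 \<in> borel_measurable leb_pi" unfolding g1_def[abs_def] using gm by measurable
    show "integrable leb_pi (\<lambda>x. (cmod (g1 x))\<^sup>2)" using g by (simp add: g1_def square_integrable_def)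
  qed
  have g1norm: "l2norm g1 = l2norm g" by (simp add: l2norm_def g1_def)
  have inner: "inner (K x) (g1 x) = \<bar>k1 x\<bar> * cmod (g x)" for x
    by (simp add: K_def g1_def inner_complex_def)
  have int: "integrable leb_pi (\<lambda>x. \<bar>k1 x\<bar> * cmod (g x))"
    using square_integrable_inner[OF Ksq g1sq] by (simp add: inner)
  have CS: "(LINT x|leb_pi. \<bar>k1 x\<bar> * cmod (g x)) \<le> sqrt (integral {u..v} (\<lambda>x. (k x)\<^sup>2)) * l2norm g"
    using norm_cauchy_schwarz[of "abs_L2 K" "abs_L2 g1"]
    by (simp add: inner_abs_L2 norm_abs_L2 Ksq g1sq inner Knorm g1norm)
  have "integrable leb_pi (\<lambda>x. k1 x *\<^sub>R g x)"
    by (rule Bochner_Integration.integrable_bound[OF int]) (use k1m gm in \<open>auto\<close>)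
  then have kg: "(\<lambda>x. k1 x *\<^sub>R g x) absolutely_integrable_on {-pi..pi}"
    by (simp add: integrable_leb_pi_iff)
  then have "(\<lambda>x. k1 x *\<^sub>R g x) absolutely_integrable_on {u..v}"
    by (rule set_integrable_subset) (use uv in auto)
  then show "(\<lambda>x. k x *\<^sub>R g x) absolutely_integrable_on {u..v}"
    by (rule absolutely_integrable_spike[where S = "{}"]) (auto simp: k1_def)
  have "integral {u..v} (\<lambda>x. k x *\<^sub>R g x) = integral {-pi..pi} (\<lambda>x. k1 x *\<^sub>R g x)"
    using restr_int[of "\<lambda>x. k x *\<^sub>R g x"] by (simp add: k1_def)
  also have "\<dots> = (LINT x|leb_pi. k1 x *\<^sub>R g x)" by (rule integral_leb_pi[OF kg, symmetric])
  also have "cmod \<dots> \<le> (LINT x|leb_pi. cmod (k1 x *\<^sub>R g x))" by (rule integral_norm_bound)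
  also have "\<dots> = (LINT x|leb_pi. \<bar>k1 x\<bar> * cmod (g x))" by simp
  finally show "cmod (integral {u..v} (\<lambda>x. k x *\<^sub>R g x)) \<le> sqrt (integral {u..v} (\<lambda>x. (k x)\<^sup>2)) * l2norm g"
    using CS by linarith
qed

lemma abs_cont_on_deriv_bound:
  assumes cd: "c \<le> d" and f: "abs_cont_on {c..d} f" and N: "negligible N"
    and bound: "\<And>x D. x \<in> {c<..<d} - N \<Longrightarrow> (f has_vector_derivative D) (at x) \<Longrightarrow> cmod D \<le> \<psi> x"
    and \<psi>: "\<psi> integrable_on {c..d}" "\<And>x. \<psi> x \<ge> 0"
  shows "cmod (f d - f c) \<le> integral {c..d} \<psi>"
proof -
  obtain N' where N': "negligible N'" "\<forall>x\<in>{c<..<d} - N'. (f has_vector_derivative vderiv f x) (at x)"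
    using abs_cont_on_FTC(1)[OF cd f] by blast
  define S where "S = N \<union> N' \<union> {c, d}"
  have S: "negligible S" using N N' by (simp add: S_def)
  \<comment> \<open>The bound on the derivative is available off \<open>S\<close> only; the value 0
    on this null set makes it hold everywhere, since \<psi> is nonnegative.\<close>
  let ?g = "\<lambda>x. if x \<in> S then 0 else vderiv f x"
  have "f d - f c = integral {c..d} (vderiv f)"
    using abs_cont_on_FTC(3)[OF cd f, of d] cd by simp
  also have "\<dots> = integral {c..d} ?g"
    by (rule integral_spike[OF S]) auto
  also have "cmod \<dots> \<le> integral {c..d} \<psi>"
  proof (rule integral_norm_bound_integral)
    have "vderiv f integrable_on {c..d}"
      by (rule set_lebesgue_integral_eq_integral(1)[OF abs_cont_on_FTC(2)[OF cd f]])
    then show "?g integrable_on {c..d}"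
      by (rule integrable_spike[OF _ S]) auto
    show "cmod (?g x) \<le> \<psi> x" if "x \<in> {c..d}" for x
      using bound[of x "vderiv f x"] N'(2) \<psi>(2) that by (auto simp: S_def)
  qed (rule \<psi>(1))
  finally show ?thesis .
qed

text \<open>Serves to reach the singular points, where the solution is known to be continuous but
  has no derivative bound. Sequences approach the end points from inside; the midpoint
  \<open>m\<close> separates them, so that they never cross.\<close>

lemma norm_diff_le_integral_closure:
  fixes f :: "real \<Rightarrow> complex" and \<psi> :: "real \<Rightarrow> real"
  assumes f: "continuous_on {c..d} f" and \<psi>: "\<psi> absolutely_integrable_on {c..d}" "\<And>x. \<psi> x \<ge> 0"
    and le: "\<And>u v. c < u \<Longrightarrow> u \<le> v \<Longrightarrow> v < d \<Longrightarrow> cmod (f v - f u) \<le> integral {u..v} \<psi>"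
    and uv: "c \<le> u" "u \<le> v" "v \<le> d"
  shows "cmod (f v - f u) \<le> integral {u..v} \<psi>"
proof (cases "u = v")
  case False
  then have "u < v" using uv by simp
  define m where "m = (u + v) / 2"
  define s t where "s n = u + (m - u) * inverse (real (Suc n))" and "t n = v - (v - m) * inverse (real (Suc n))" for n
  have m: "u < m" "m < v" using \<open>u < v\<close> by (auto simp: m_def)
  have st: "u < s n" "s n \<le> m" "m \<le> t n" "t n < v" for n
  proof -
    have e: "0 < inverse (real (Suc n))" "inverse (real (Suc n)) \<le> 1"
      by (auto simp: field_simps)
    show "u < s n" "t n < v" using e m by (auto simp: s_def t_def)
    have "(m - u) * inverse (real (Suc n)) \<le> (m - u) * 1" "(v - m) * inverse (real (Suc n)) \<le> (v - m) * 1"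
      using e m by (intro mult_left_mono; simp)+
    then show "s n \<le> m" "m \<le> t n" by (auto simp: s_def t_def)
  qed
  have z: "(\<lambda>n. inverse (real (Suc n))) \<longlonglongrightarrow> 0" by (rule LIMSEQ_inverse_real_of_nat)
  have "s \<longlonglongrightarrow> u + (m - u) * 0" "t \<longlonglongrightarrow> v - (v - m) * 0"
    unfolding s_def[abs_def] t_def[abs_def] by (intro tendsto_intros z)+
  then have lim: "s \<longlonglongrightarrow> u" "t \<longlonglongrightarrow> v" by simp_all
  have in_cd: "u \<in> {c..d}" "v \<in> {c..d}" "s n \<in> {c..d}" "t n \<in> {c..d}" for n
    using st[of n] m uv by auto
  have "(\<lambda>n. f (s n)) \<longlonglongrightarrow> f u" "(\<lambda>n. f (t n)) \<longlonglongrightarrow> f v"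
    using f lim in_cd unfolding continuous_on_sequentially o_def by blast+
  then have "(\<lambda>n. cmod (f (t n) - f (s n))) \<longlonglongrightarrow> cmod (f v - f u)"
    by (intro tendsto_intros)
  moreover have "cmod (f (t n) - f (s n)) \<le> integral {u..v} \<psi>" for n
  proof -
    have int: "\<psi> integrable_on {x..y}" if "c \<le> x" "y \<le> d" for x y
      by (rule set_lebesgue_integral_eq_integral(1)[OF set_integrable_subset[OF \<psi>(1)]]) (use that in auto)
    have "cmod (f (t n) - f (s n)) \<le> integral {s n..t n} \<psi>"
      using st[of n] uv by (intro le) auto
    also have "\<dots> \<le> integral {u..v} \<psi>"
      using st[of n] uv \<psi>(2) by (intro integral_subset_le int) auto
    finally show ?thesis .
  qed
  ultimately show ?thesis by (intro LIMSEQ_le_const2) auto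
qed simp

lemma abs_cont_on_of_real_C1:
  fixes \<phi> :: "real \<Rightarrow> real"
  assumes "\<And>x. x \<in> {c..d} \<Longrightarrow> (\<phi> has_real_derivative \<phi>' x) (at x)" "continuous_on {c..d} \<phi>'"
  shows "abs_cont_on {c..d} (\<lambda>x. complex_of_real (\<phi> x))"
proof (rule abs_cont_on_C1)
  show "((\<lambda>x. complex_of_real (\<phi> x)) has_vector_derivative complex_of_real (\<phi>' x)) (at x within {c..d})"
    if "x \<in> {c..d}" for x
    using has_vector_derivative_of_real[of \<phi> "\<phi>' x" "at x within {c..d}"] assms(1)[OF that]
    by (simp add: has_field_derivative_at_within)
  show "continuous_on {c..d} (\<lambda>x. complex_of_real (\<phi>' x))"
    by (intro continuous_intros assms(2))
qed

section \<open>The square integrable solution\<close>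

lemma l2norm_scaleR_le:
  assumes m: "m \<in> borel_measurable leb_pi" "\<And>x. \<bar>m x\<bar> \<le> B" and g: "square_integrable g"
  shows "square_integrable (\<lambda>x. m x *\<^sub>R g x)" "l2norm (\<lambda>x. m x *\<^sub>R g x) \<le> B * l2norm g"
proof -
  have B: "B \<ge> 0" using m(2)[of 0] by linarith
  have gi: "integrable leb_pi (\<lambda>x. B\<^sup>2 * (cmod (g x))\<^sup>2)" and gm: "g \<in> borel_measurable leb_pi"
    using g by (auto simp: square_integrable_def)
  have le: "(cmod (m x *\<^sub>R g x))\<^sup>2 \<le> B\<^sup>2 * (cmod (g x))\<^sup>2" for x
  proof -
    have "cmod (m x *\<^sub>R g x) \<le> B * cmod (g x)"
      using m(2)[of x] by (simp add: mult_right_mono)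
    from power_mono[OF this, of 2] show ?thesis by (simp add: power_mult_distrib)
  qed
  have i: "integrable leb_pi (\<lambda>x. (cmod (m x *\<^sub>R g x))\<^sup>2)"
    by (rule Bochner_Integration.integrable_bound[OF gi]) (use m(1) gm le in \<open>auto\<close>)
  then show "square_integrable (\<lambda>x. m x *\<^sub>R g x)"
    using m(1) gm by (auto simp: square_integrable_def)
  have "(LINT x|leb_pi. (cmod (m x *\<^sub>R g x))\<^sup>2) \<le> (LINT x|leb_pi. B\<^sup>2 * (cmod (g x))\<^sup>2)"
    by (rule integral_mono[OF i gi le])
  then have "l2norm (\<lambda>x. m x *\<^sub>R g x) \<le> sqrt (B\<^sup>2 * (LINT x|leb_pi. (cmod (g x))\<^sup>2))"
    unfolding l2norm_def by (intro real_sqrt_le_mono) simp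
  then show "l2norm (\<lambda>x. m x *\<^sub>R g x) \<le> B * l2norm g"
    using B by (simp add: l2norm_def real_sqrt_mult)
qed

lemma l2norm_diff_le:
  assumes "square_integrable f" "square_integrable g"
  shows "square_integrable (\<lambda>x. f x - g x)" "l2norm (\<lambda>x. f x - g x) \<le> l2norm f + l2norm g"
proof -
  show sq: "square_integrable (\<lambda>x. f x - g x)"
    using square_integrable_add[OF assms(1) square_integrable_cmult[OF assms(2), of "-1"]] by simp
  have "abs_L2 f - abs_L2 g = abs_L2 (\<lambda>x. f x - g x)"
    by (rule minus_L2.abs_eq) (use assms in \<open>simp_all add: L2_rel_refl\<close>)
  then show "l2norm (\<lambda>x. f x - g x) \<le> l2norm f + l2norm g"
    using norm_triangle_ineq4[of "abs_L2 f" "abs_L2 g"] by (simp add: norm_abs_L2 assms sq)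
qed

text \<open>\<open>g\<close> is kept as a separate argument instead of \<open>vderiv w\<close>, so
  that an arbitrary representative of a class, such as \<open>rep_L2 v\<close>, can be taken as the
  derivative.\<close>

definition primitive :: "(real \<Rightarrow> complex) \<Rightarrow> (real \<Rightarrow> complex) \<Rightarrow> bool" where
  "primitive w g \<longleftrightarrow> square_integrable g \<and> (\<forall>x\<in>{-pi..pi}. w x = w (-pi) + integral {-pi..x} g)"

lemma primitive_abs_cont:
  assumes "primitive w g"
  shows "abs_cont_on {-pi..pi} w"
proof (rule abs_cont_on_indefinite_integral)
  show "g absolutely_integrable_on {-pi..pi}"
    using assms by (simp add: primitive_def square_integrable_imp_absolutely_integrable)
  show "w x = w (-pi) + integral {-pi..x} g" if "x \<in> {-pi..pi}" for x
    using assms that unfolding primitive_def by blast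
qed

lemma primitive_continuous: "primitive w g \<Longrightarrow> continuous_on {-pi..pi} w"
  by (intro abs_cont_on_imp_continuous_on primitive_abs_cont)

lemma primitive_deriv:
  assumes "primitive w g"
  obtains N where "negligible N" "\<And>x. x \<in> {-pi<..<pi} - N \<Longrightarrow> (w has_vector_derivative g x) (at x)"
proof -
  have g: "g absolutely_integrable_on {-pi..pi}"
    using assms by (simp add: primitive_def square_integrable_imp_absolutely_integrable)
  obtain N where N: "negligible N"
    "\<And>x. x \<in> {-pi<..<pi} - N \<Longrightarrow> ((\<lambda>x. integral {-pi..x} g) has_vector_derivative g x) (at x)"
    using indefinite_integral_has_vector_derivative_AE[OF g] by blast
  show thesis
  proof
    fix x assume x: "x \<in> {-pi<..<pi} - N"
    have "((\<lambda>x. w (-pi) + integral {-pi..x} g) has_vector_derivative g x) (at x)"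
      using has_vector_derivative_add[OF has_vector_derivative_const N(2)[OF x]] by simp
    then show "(w has_vector_derivative g x) (at x)"
    proof (rule has_vector_derivative_transform_within_open[where S = "{-pi<..<pi}"])
      show "w (-pi) + integral {-pi..y} g = w y" if "y \<in> {-pi<..<pi}" for y
      proof -
        have "y \<in> {-pi..pi}" using that by simp
        then have "w y = w (-pi) + integral {-pi..y} g"
          using assms unfolding primitive_def by blast
        then show ?thesis by (rule sym)
      qed
    qed (use x in auto)
  qed (rule N(1))
qed

context admissible_parameters
begin

text \<open>\<open>dquot w g\<close> is the derivative of \<open>w / p\<close> when \<open>g\<close> is the derivative of \<open>w\<close>.\<close>

definition dquot :: "(real \<Rightarrow> complex) \<Rightarrow> (real \<Rightarrow> complex) \<Rightarrow> real \<Rightarrow> complex" where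
  "dquot w g x = (1 / p x) *\<^sub>R g x - (a * sin x / (p x)\<^sup>2) *\<^sub>R w x"

text \<open>The oriented integral from 0. Another base point would change the solution by a multiple
  of \<open>hom\<close>, and only the base point 0 avoids such a component on both sides.\<close>

definition hinv_integral :: "(real \<Rightarrow> complex) \<Rightarrow> (real \<Rightarrow> complex) \<Rightarrow> real \<Rightarrow> complex" where
  "hinv_integral w g x = (if 0 \<le> x then integral {0..x} (\<lambda>t. hinv t *\<^sub>R dquot w g t)
     else - integral {x..0} (\<lambda>t. hinv t *\<^sub>R dquot w g t))"

text \<open>Variation of constants suggests \<open>hom\<close> times the integral of w / (b sin x
  hom). The integrand is (w / p) (1 / hom)', and integration by parts, with vanishing boundary term
  at 0, removes the singular factor 1 / sin x at the price of differentiating w / p.\<close>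

definition sol :: "(real \<Rightarrow> complex) \<Rightarrow> (real \<Rightarrow> complex) \<Rightarrow> real \<Rightarrow> complex" where
  "sol w g x = (1 / p x) *\<^sub>R w x - hom x *\<^sub>R hinv_integral w g x"

lemma p_continuous: "continuous_on S p"
  unfolding p_def[abs_def] by (intro continuous_intros)

lemma p_deriv: "(p has_real_derivative a * sin x) (at x)"
  unfolding p_def[abs_def] by (auto intro!: derivative_eq_intros)

text \<open>The bound comes from p \<ge> 1 - a. Its explicit dependence on \<open>g\<close> and
  \<open>W\<close> is what later makes the solution operator bounded.\<close>

lemma dquot_square_integrable:
  assumes w: "primitive w g" and W: "\<And>x. x \<in> {-pi<..<pi} \<Longrightarrow> cmod (w x) \<le> W"
  shows "square_integrable (dquot w g)"
    and "l2norm (dquot w g) \<le> 1 / (1 - a) * l2norm g + a / (1 - a)\<^sup>2 * (W * sqrt (2 * pi))"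
proof -
  have wm: "w \<in> borel_measurable leb_pi"
    by (rule continuous_imp_measurable_leb_pi)
       (rule continuous_on_subset[OF primitive_continuous[OF w]], auto)
  note ws = square_integrable_bounded[OF wm W]
  have g: "square_integrable g" using w by (simp add: primitive_def)
  have p0: "p x \<noteq> 0" for x using p_bounds(3)[of x] by simp
  have m: "(\<lambda>x. 1 / p x) \<in> borel_measurable leb_pi" "(\<lambda>x. a * sin x / (p x)\<^sup>2) \<in> borel_measurable leb_pi"
    by (rule continuous_imp_measurable_leb_pi, intro continuous_intros p_continuous, simp add: p0)+
  have b1: "\<bar>1 / p x\<bar> \<le> 1 / (1 - a)" for x
    using p_bounds[of x] a_less_1 by (simp add: frac_le)
  have b2: "\<bar>a * sin x / (p x)\<^sup>2\<bar> \<le> a / (1 - a)\<^sup>2" for x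
  proof -
    have "\<bar>a * sin x / (p x)\<^sup>2\<bar> = a * \<bar>sin x\<bar> / (p x)\<^sup>2" using a_pos by (simp add: abs_mult)
    also have "\<dots> \<le> a * 1 / (1 - a)\<^sup>2"
      using p_bounds[of x] a_less_1 a_pos by (intro frac_le mult_left_mono power_mono) auto
    finally show ?thesis by simp
  qed
  note d1 = l2norm_scaleR_le[OF m(1) b1 g] and d2 = l2norm_scaleR_le[OF m(2) b2 ws(1)]
  show "square_integrable (dquot w g)"
    unfolding dquot_def[abs_def] by (rule l2norm_diff_le[OF d1(1) d2(1)])
  have "l2norm (dquot w g) \<le> l2norm (\<lambda>x. (1 / p x) *\<^sub>R g x) + l2norm (\<lambda>x. (a * sin x / (p x)\<^sup>2) *\<^sub>R w x)"
    unfolding dquot_def[abs_def] by (rule l2norm_diff_le[OF d1(1) d2(1)])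
  also have "\<dots> \<le> 1 / (1 - a) * l2norm g + a / (1 - a)\<^sup>2 * (W * sqrt (2 * pi))"
  proof (intro add_mono d1(2) order_trans[OF d2(2)] mult_left_mono ws(2))
    show "0 \<le> a / (1 - a)\<^sup>2" using a_pos by simp
  qed
  finally show "l2norm (dquot w g) \<le> 1 / (1 - a) * l2norm g + a / (1 - a)\<^sup>2 * (W * sqrt (2 * pi))" .
qed

lemma primitive_bounded:
  assumes "primitive w g"
  obtains W where "\<And>x. x \<in> {-pi..pi} \<Longrightarrow> cmod (w x) \<le> W"
proof -
  have "bounded (w ` {-pi..pi})"
    by (intro compact_imp_bounded compact_continuous_image primitive_continuous[OF assms]) auto
  then show thesis using that unfolding bounded_iff by blast
qed

lemma dquot_square_integrable':
  assumes w: "primitive w g"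
  shows "square_integrable (dquot w g)"
proof -
  obtain W where "\<And>x. x \<in> {-pi..pi} \<Longrightarrow> cmod (w x) \<le> W" using primitive_bounded[OF w] by blast
  then show ?thesis by (intro dquot_square_integrable[OF w, of W]) auto
qed

lemma hinv_continuous_Icc: "-pi < u \<Longrightarrow> v < pi \<Longrightarrow> continuous_on {u..v} hinv"
  by (rule continuous_on_subset[OF hinv_continuous]) auto

lemma abs_cont_on_hom:
  assumes "{u..v} \<subseteq> {-pi<..<0} \<union> {0<..<pi}"
  shows "abs_cont_on {u..v} (\<lambda>x. of_real (hom x))" "abs_cont_on {u..v} (\<lambda>x. of_real (hinv x))"
proof -
  have x: "-pi < x" "x < pi" "x \<noteq> 0" if "x \<in> {u..v}" for x
    using subsetD[OF assms that] by auto
  have cont: "continuous_on {u..v} hom" "continuous_on {u..v} hinv"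
    by (intro continuous_at_imp_continuous_on ballI DERIV_isCont[OF hom_deriv] DERIV_isCont[OF hinv_deriv] x; assumption)+
  have nz: "b * sin t \<noteq> 0" if "t \<in> {u..v}" for t
    using half_angle(3)[OF x[OF that]] b_pos by simp
  show "abs_cont_on {u..v} (\<lambda>x. of_real (hom x))"
    by (rule abs_cont_on_of_real_C1[OF hom_deriv[OF x]])
       (use nz in \<open>auto intro!: continuous_intros cont p_continuous\<close>)
  show "abs_cont_on {u..v} (\<lambda>x. of_real (hinv x))"
    by (rule abs_cont_on_of_real_C1[OF hinv_deriv[OF x]])
       (use nz in \<open>auto intro!: continuous_intros cont p_continuous\<close>)
qed

context
  fixes w g :: "real \<Rightarrow> complex"
  assumes w: "primitive w g"
begin

lemma integrand_absolutely_integrable: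
  assumes "-pi < u" "v < pi"
  shows "(\<lambda>t. hinv t *\<^sub>R dquot w g t) absolutely_integrable_on {u..v}"
proof (cases "u \<le> v")
  case True
  then show ?thesis
    using norm_integral_product_le(1)[OF less_imp_le[OF assms(1)] True less_imp_le[OF assms(2)] hinv_continuous_Icc[OF assms] dquot_square_integrable'[OF w]] by simp
qed (simp add: set_integrable_def)

lemma integral_hinv_dquot_le:
  assumes "-pi < u" "u \<le> v" "v < pi"
  shows "cmod (integral {u..v} (\<lambda>t. hinv t *\<^sub>R dquot w g t))
    \<le> sqrt (integral {u..v} (\<lambda>t. (hinv t)\<^sup>2)) * l2norm (dquot w g)"
  using assms by (intro norm_integral_product_le(2) hinv_continuous_Icc dquot_square_integrable'[OF w]) auto

lemma hinv_integral_diff: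
  assumes "-pi < u" "u \<le> v" "v < pi"
  shows "hinv_integral w g v - hinv_integral w g u = integral {u..v} (\<lambda>t. hinv t *\<^sub>R dquot w g t)"
proof -
  let ?k = "\<lambda>t. hinv t *\<^sub>R dquot w g t"
  have comb: "integral {r..s} ?k + integral {s..t} ?k = integral {r..t} ?k" if "-pi < r" "r \<le> s" "s \<le> t" "t < pi" for r s t
    using that by (intro Henstock_Kurzweil_Integration.integral_combine
        set_lebesgue_integral_eq_integral(1)[OF integrand_absolutely_integrable]) auto
  show ?thesis
    using comb[of 0 u v] comb[of u v 0] comb[of u 0 v] assms
    unfolding hinv_integral_def by (auto simp: algebra_simps)
qed

lemma hinv_integral_abs_cont:
  assumes "-pi < u" "v < pi"
  shows "abs_cont_on {u..v} (hinv_integral w g)"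
proof (rule abs_cont_on_indefinite_integral[OF integrand_absolutely_integrable[OF assms]])
  show "hinv_integral w g x = hinv_integral w g u + integral {u..x} (\<lambda>t. hinv t *\<^sub>R dquot w g t)" if "x \<in> {u..v}" for x
    using hinv_integral_diff[of u x] that assms by (simp add: algebra_simps)
qed

lemma hinv_integral_continuous: "continuous_on {-pi<..<pi} (hinv_integral w g)"
proof (rule locally_abs_cont_on_imp_continuous_on)
  show "locally_abs_cont_on {-pi<..<pi} (hinv_integral w g)"
    unfolding locally_abs_cont_on_def
  proof (intro allI impI)
    fix c d assume cd: "c \<le> d \<and> {c..d} \<subseteq> {-pi<..<pi}"
    then have "c \<in> {-pi<..<pi}" "d \<in> {-pi<..<pi}" by auto
    then show "abs_cont_on {c..d} (hinv_integral w g)" by (intro hinv_integral_abs_cont) auto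
  qed
qed simp

text \<open>\<open>hinv\<close> is unbounded at \<open>-pi\<close> and \<open>pi\<close>, so the
  integrand is known to be integrable only on compact subintervals. These exhaust the open interval,
  and the countably many exceptional null sets are united.\<close>

lemma hinv_integral_deriv:
  obtains N where "negligible N"
    "\<And>x. x \<in> {-pi<..<pi} - N \<Longrightarrow> (hinv_integral w g has_vector_derivative hinv x *\<^sub>R dquot w g x) (at x)"
proof -
  let ?k = "\<lambda>t. hinv t *\<^sub>R dquot w g t"
  define r where "r n = pi - pi * inverse (real (Suc n))" for n
  have r: "r n < pi" for n by (simp add: r_def)
  have "\<exists>N. negligible N \<and> (\<forall>x\<in>{- r n<..<r n} - N. (hinv_integral w g has_vector_derivative ?k x) (at x))" for n
  proof -
    obtain N where N: "negligible N" "\<And>x. x \<in> {- r n<..<r n} - N \<Longrightarrow> ((\<lambda>x. integral {- r n..x} ?k) has_vector_derivative ?k x) (at x)"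
      using indefinite_integral_has_vector_derivative_AE[OF integrand_absolutely_integrable[of "- r n" "r n"]] r[of n] by auto
    have "(hinv_integral w g has_vector_derivative ?k x) (at x)" if x: "x \<in> {- r n<..<r n} - N" for x
    proof -
      have "((\<lambda>x. hinv_integral w g (- r n) + integral {- r n..x} ?k) has_vector_derivative ?k x) (at x)"
        using has_vector_derivative_add[OF has_vector_derivative_const N(2)[OF x]] by simp
      then show ?thesis
      proof (rule has_vector_derivative_transform_within_open[where S = "{- r n<..<r n}"])
        show "hinv_integral w g (- r n) + integral {- r n..y} ?k = hinv_integral w g y" if "y \<in> {- r n<..<r n}" for y
          using hinv_integral_diff[of "- r n" y] that r[of n] by (simp add: algebra_simps)
      qed (use x in auto)
    qed
    then show ?thesis using N(1) by blast
  qed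
  then obtain N where N: "\<And>n. negligible (N n)"
    "\<And>n x. x \<in> {- r n<..<r n} - N n \<Longrightarrow> (hinv_integral w g has_vector_derivative ?k x) (at x)"
    by metis
  show thesis
  proof
    show "negligible (\<Union>n. N n)" using N(1) by (rule negligible_Union_nat)
    fix x assume x: "x \<in> {-pi<..<pi} - (\<Union>n. N n)"
    have "r \<longlonglongrightarrow> pi - pi * 0"
      unfolding r_def[abs_def] by (intro tendsto_intros LIMSEQ_inverse_real_of_nat)
    then have "r \<longlonglongrightarrow> pi" by simp
    then have "\<forall>\<^sub>F n in sequentially. \<bar>x\<bar> < r n" by (rule order_tendstoD) (use x in auto)
    then obtain n where "\<bar>x\<bar> < r n" unfolding eventually_sequentially by blast
    then show "(hinv_integral w g has_vector_derivative ?k x) (at x)"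
      using x by (intro N(2)[of x n]) auto
  qed
qed

lemma hinv_integral_bound:
  assumes x: "-pi < x" "x < pi"
  shows "cmod (hinv_integral w g x) \<le> sqrt (K\<^sub>0 * \<bar>sin x\<bar>) * hinv x * l2norm (dquot w g)"
proof -
  have hn: "hinv x \<ge> 0" by (simp add: hinv_def)
  have "cmod (hinv_integral w g x) \<le> sqrt (K\<^sub>0 * \<bar>sin x\<bar> * (hinv x)\<^sup>2) * l2norm (dquot w g)"
  proof (cases "x \<ge> 0")
    case True
    have "cmod (hinv_integral w g x) \<le> sqrt (integral {0..x} (\<lambda>t. (hinv t)\<^sup>2)) * l2norm (dquot w g)"
      using integral_hinv_dquot_le[of 0 x] True x by (simp add: hinv_integral_def)
    also have "\<dots> \<le> sqrt (K\<^sub>0 * \<bar>sin x\<bar> * (hinv x)\<^sup>2) * l2norm (dquot w g)"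
      using integral_hinv_square_le(2)[OF True x(2)] sin_ge_zero[OF True] x
      by (intro mult_right_mono real_sqrt_le_mono l2norm_nonneg) simp
    finally show ?thesis .
  next
    case False
    have refl: "integral {x..0} (\<lambda>t. (hinv t)\<^sup>2) = integral {0..-x} (\<lambda>t. (hinv t)\<^sup>2)"
      using Henstock_Kurzweil_Integration.integral_reflect_real[where a = x and b = 0 and f = "\<lambda>t. (hinv t)\<^sup>2"]
      by (simp add: hinv_minus)
    have "cmod (hinv_integral w g x) \<le> sqrt (integral {x..0} (\<lambda>t. (hinv t)\<^sup>2)) * l2norm (dquot w g)"
      using integral_hinv_dquot_le[of x 0] False x by (simp add: hinv_integral_def)
    also have "\<dots> \<le> sqrt (K\<^sub>0 * \<bar>sin x\<bar> * (hinv x)\<^sup>2) * l2norm (dquot w g)"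
      unfolding refl
      using integral_hinv_square_le(2)[of "-x"] sin_ge_zero[of "-x"] x False
      by (intro mult_right_mono real_sqrt_le_mono l2norm_nonneg) (simp add: hinv_minus)
    finally show ?thesis .
  qed
  also have "sqrt (K\<^sub>0 * \<bar>sin x\<bar> * (hinv x)\<^sup>2) = sqrt (K\<^sub>0 * \<bar>sin x\<bar>) * hinv x"
    using hn by (simp add: real_sqrt_mult)
  finally show ?thesis .
qed

text \<open>The factor \<open>hinv x\<close> in the preceding bound cancels against
  \<open>hom x\<close>. What remains vanishes at 0, \<open>-pi\<close> and \<open>pi\<close>; this
  gives continuity of the solution there, with the default \<open>hom x = 0\<close> supplying the
  limit value.\<close>

lemma hom_G_bound:
  assumes "x \<in> {-pi..pi}"
  shows "cmod (hom x *\<^sub>R hinv_integral w g x) \<le> sqrt (K\<^sub>0 * \<bar>sin x\<bar>) * l2norm (dquot w g)"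
proof (cases "x \<in> {-pi, 0, pi}")
  case True
  then show ?thesis using hom_eq_0[OF True] K\<^sub>0_pos l2norm_nonneg by simp
next
  case False
  then have x: "-pi < x" "x < pi" "x \<noteq> 0" using assms by auto
  have "cmod (hom x *\<^sub>R hinv_integral w g x) = hom x * cmod (hinv_integral w g x)" using hom_hinv(2)[OF x] by simp
  also have "\<dots> \<le> hom x * (sqrt (K\<^sub>0 * \<bar>sin x\<bar>) * hinv x * l2norm (dquot w g))"
    using hom_hinv(2)[OF x] by (intro mult_left_mono hinv_integral_bound x) simp
  also have "\<dots> = (hom x * hinv x) * (sqrt (K\<^sub>0 * \<bar>sin x\<bar>) * l2norm (dquot w g))" by (simp only: ac_simps)
  finally show ?thesis unfolding hom_hinv(1)[OF x] by simp
qed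

text \<open>The factor is the same at both ends, so the solution is periodic if and only if
  \<open>w\<close> is.\<close>

lemma sol_at_singular_points:
  shows "sol w g pi = (1 / (1 + a)) *\<^sub>R w pi" "sol w g (-pi) = (1 / (1 + a)) *\<^sub>R w (-pi)"
  by (simp_all add: sol_def hom_eq_0 p_def)

lemma sol_continuous: "continuous_on {-pi..pi} (sol w g)"
proof -
  have "continuous_on {-pi..pi} (\<lambda>x. hom x *\<^sub>R hinv_integral w g x)"
    unfolding continuous_on_def
  proof
    fix x assume x: "x \<in> {-pi..pi}"
    show "((\<lambda>x. hom x *\<^sub>R hinv_integral w g x) \<longlongrightarrow> hom x *\<^sub>R hinv_integral w g x) (at x within {-pi..pi})"
    proof (cases "x \<in> {-pi, 0, pi}")
      case True
      then have "sin x = 0" by auto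
      have "hom x = 0" using True by (rule hom_eq_0)
      have "((\<lambda>y. sqrt (K\<^sub>0 * \<bar>sin y\<bar>) * l2norm (dquot w g)) \<longlongrightarrow> sqrt (K\<^sub>0 * \<bar>sin x\<bar>) * l2norm (dquot w g)) (at x within {-pi..pi})"
        by (intro tendsto_intros)
      then have "((\<lambda>y. sqrt (K\<^sub>0 * \<bar>sin y\<bar>) * l2norm (dquot w g)) \<longlongrightarrow> 0) (at x within {-pi..pi})"
        using \<open>sin x = 0\<close> by simp
      then have "((\<lambda>y. hom y *\<^sub>R hinv_integral w g y) \<longlongrightarrow> 0) (at x within {-pi..pi})"
        by (rule Lim_null_comparison[rotated]) (auto simp: eventually_at_filter intro!: always_eventually hom_G_bound[simplified])
      then show ?thesis using \<open>hom x = 0\<close> by simp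
    next
      case False
      then have x': "-pi < x" "x < pi" "x \<noteq> 0" using x by auto
      have "isCont hom x" using hom_deriv[OF x'] by (rule DERIV_isCont)
      moreover have "isCont (hinv_integral w g) x"
        using hinv_integral_continuous x' by (simp add: continuous_on_eq_continuous_at)
      ultimately have "isCont (\<lambda>x. hom x *\<^sub>R hinv_integral w g x) x" by (rule continuous_scaleR)
      then show ?thesis unfolding isCont_def by (rule Lim_at_imp_Lim_at_within)
    qed
  qed
  moreover have "p x \<noteq> 0" for x using p_bounds(3)[of x] by simp
  then have "continuous_on {-pi..pi} (\<lambda>x. (1 / p x) *\<^sub>R w x)"
    by (intro continuous_intros p_continuous primitive_continuous[OF w]) auto
  ultimately show ?thesis
    unfolding sol_def[abs_def] by (intro continuous_on_diff)
qed

text \<open>As \<open>hom\<close> and \<open>hinv\<close> are reciprocal, the derivative of the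
  integral cancels the derivative of w / p, and only the term with the derivative of
  \<open>hom\<close> survives. Thus \<open>hom_G_bound\<close> controls the derivative although
  \<open>g\<close> is merely square integrable.\<close>

lemma sol_deriv:
  obtains N where "negligible N"
    "\<And>x. x \<in> {-pi<..<pi} - {0} - N \<Longrightarrow>
       (sol w g has_vector_derivative (p x / (b * sin x)) *\<^sub>R (hom x *\<^sub>R hinv_integral w g x)) (at x)"
proof -
  obtain N1 where N1: "negligible N1" "\<And>x. x \<in> {-pi<..<pi} - N1 \<Longrightarrow> (w has_vector_derivative g x) (at x)"
    using primitive_deriv[OF w] by blast
  obtain N2 where N2: "negligible N2"
    "\<And>x. x \<in> {-pi<..<pi} - N2 \<Longrightarrow> (hinv_integral w g has_vector_derivative hinv x *\<^sub>R dquot w g x) (at x)"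
    using hinv_integral_deriv by blast
  show thesis
  proof
    show "negligible (N1 \<union> N2)" using N1 N2 by simp
    fix x assume x: "x \<in> {-pi<..<pi} - {0} - (N1 \<union> N2)"
    then have x': "-pi < x" "x < pi" "x \<noteq> 0" by auto
    have p0: "p x \<noteq> 0" using p_bounds(3)[of x] by simp
    have "((\<lambda>x. 1 / p x) has_real_derivative - (a * sin x / (p x)\<^sup>2)) (at x)"
      using p0 by (auto intro!: derivative_eq_intros p_deriv simp: power2_eq_square)
    then have d1: "((\<lambda>x. (1 / p x) *\<^sub>R w x) has_vector_derivative (1 / p x) *\<^sub>R g x + - (a * sin x / (p x)\<^sup>2) *\<^sub>R w x) (at x)"
      by (rule has_vector_derivative_scaleR) (use N1(2) x in blast)
    have d2: "((\<lambda>x. hom x *\<^sub>R hinv_integral w g x) has_vector_derivative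
        hom x *\<^sub>R (hinv x *\<^sub>R dquot w g x) + (- hom x * (p x / (b * sin x))) *\<^sub>R hinv_integral w g x) (at x)"
      using hom_deriv[OF x'] by (rule has_vector_derivative_scaleR) (use N2(2) x in blast)
    have "(1 / p x) *\<^sub>R g x + - (a * sin x / (p x)\<^sup>2) *\<^sub>R w x -
        (hom x *\<^sub>R (hinv x *\<^sub>R dquot w g x) + (- hom x * (p x / (b * sin x))) *\<^sub>R hinv_integral w g x)
        = (p x / (b * sin x)) *\<^sub>R (hom x *\<^sub>R hinv_integral w g x)"
      unfolding scaleR_scaleR hom_hinv(1)[OF x'] by (simp add: dquot_def mult.commute)
    then show "(sol w g has_vector_derivative (p x / (b * sin x)) *\<^sub>R (hom x *\<^sub>R hinv_integral w g x)) (at x)"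
      using has_vector_derivative_diff[OF d1 d2] unfolding sol_def[abs_def] by simp
  qed
qed

lemma sol_abs_cont_local:
  assumes uv: "u \<le> v" "{u..v} \<subseteq> {-pi<..<0} \<union> {0<..<pi}"
  shows "abs_cont_on {u..v} (sol w g)"
proof -
  have "u \<in> {u..v}" "v \<in> {u..v}" using uv by auto
  then have b: "-pi < u" "v < pi" using uv(2) pi_gt_zero by force+
  have p0: "p x \<noteq> 0" for x using p_bounds(3)[of x] by simp
  have "abs_cont_on {u..v} (\<lambda>x. of_real (1 / p x))"
  proof (rule abs_cont_on_of_real_C1)
    show "((\<lambda>x. 1 / p x) has_real_derivative - (a * sin x / (p x)\<^sup>2)) (at x)" for x
      using p0[of x] by (auto intro!: derivative_eq_intros p_deriv simp: power2_eq_square)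
  qed (use p0 in \<open>auto intro!: continuous_intros p_continuous\<close>)
  moreover have "abs_cont_on {u..v} w"
    by (rule abs_cont_on_subinterval[OF primitive_abs_cont[OF w]]) (use b in auto)
  ultimately have "abs_cont_on {u..v} (\<lambda>x. of_real (1 / p x) * w x - of_real (hom x) * hinv_integral w g x)"
    by (intro abs_cont_on_diff abs_cont_on_mult abs_cont_on_hom uv hinv_integral_abs_cont b)
  then show ?thesis by (simp add: sol_def[abs_def] scaleR_conv_of_real)
qed

text \<open>Away from the singular points the derivative bound integrates to a bound of increments
  by the integral of \<psi>. Continuity carries this to the closed halves \<open>{-pi..0}\<close>
  and \<open>{0..pi}\<close>, an interval across 0 is cut there, and domination by \<psi> gives
  absolute continuity.\<close>

lemma sol_abs_cont: "abs_cont_on {-pi..pi} (sol w g)"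
proof -
  \<comment> \<open>\<open>(1 + a) / b\<close> bounds \<open>p x / b\<close>; the other factor is
    the one of \<open>hom_G_bound\<close> without the square root of \<bar>sin x\<bar>.\<close>
  define C where "C = (1 + a) / b * (sqrt K\<^sub>0 * l2norm (dquot w g))"
  define \<psi> where "\<psi> x = C * sing x" for x
  have C: "C \<ge> 0" unfolding C_def using a_pos b_pos K\<^sub>0_pos l2norm_nonneg by (intro mult_nonneg_nonneg) auto
  have \<psi>: "\<psi> absolutely_integrable_on {-pi..pi}" "\<And>x. \<psi> x \<ge> 0"
    unfolding \<psi>_def[abs_def] using sing_absolutely_integrable C sing_nonneg by auto
  have \<psi>i: "\<psi> integrable_on {u..v}" if "-pi \<le> u" "v \<le> pi" for u v
    by (rule set_lebesgue_integral_eq_integral(1)[OF set_integrable_subset[OF \<psi>(1)]]) (use that in auto)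
  obtain N where N: "negligible N"
    "\<And>x. x \<in> {-pi<..<pi} - {0} - N \<Longrightarrow>
       (sol w g has_vector_derivative (p x / (b * sin x)) *\<^sub>R (hom x *\<^sub>R hinv_integral w g x)) (at x)"
    using sol_deriv by blast
  have local: "cmod (sol w g v - sol w g u) \<le> integral {u..v} \<psi>"
    if uv: "u \<le> v" "{u..v} \<subseteq> {-pi<..<0} \<union> {0<..<pi}" for u v
  proof (rule abs_cont_on_deriv_bound[OF uv(1) sol_abs_cont_local[OF uv] N(1) _ _ \<psi>(2)])
    have "u \<in> {u..v}" "v \<in> {u..v}" using uv by auto
    then have "u \<in> {-pi<..<0} \<union> {0<..<pi}" "v \<in> {-pi<..<0} \<union> {0<..<pi}" using uv(2) by blast+
    then have "-pi \<le> u" "v \<le> pi" using pi_gt_zero by force+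
    then show "\<psi> integrable_on {u..v}" by (rule \<psi>i)
    fix x D assume x: "x \<in> {u<..<v} - N" and D: "(sol w g has_vector_derivative D) (at x)"
    have "x \<in> {u..v}" using x by auto
    then have "x \<in> {-pi<..<0} \<union> {0<..<pi}" using uv(2) by blast
    then have x': "-pi < x" "x < pi" "x \<noteq> 0" using pi_gt_zero by auto
    have "D = (p x / (b * sin x)) *\<^sub>R (hom x *\<^sub>R hinv_integral w g x)"
      by (rule vector_derivative_unique_at[OF D N(2)]) (use x x' in auto)
    then have "cmod D = p x / (b * \<bar>sin x\<bar>) * cmod (hom x *\<^sub>R hinv_integral w g x)"
      using p_bounds(3)[of x] b_pos by (simp add: abs_mult)
    also have "\<dots> \<le> (1 + a) / (b * \<bar>sin x\<bar>) * (sqrt (K\<^sub>0 * \<bar>sin x\<bar>) * l2norm (dquot w g))"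
      using p_bounds[of x] b_pos a_pos x' by (intro mult_mono divide_right_mono hom_G_bound) auto
    also have "\<dots> = C * (sqrt \<bar>sin x\<bar> / \<bar>sin x\<bar>)"
      by (simp add: C_def real_sqrt_mult)
    also have "sqrt \<bar>sin x\<bar> / \<bar>sin x\<bar> = 1 / sqrt \<bar>sin x\<bar>"
      using half_angle(3)[OF x'] by (simp add: real_div_sqrt divide_eq_eq nonzero_eq_divide_eq)
    also have "C * (1 / sqrt \<bar>sin x\<bar>) \<le> \<psi> x"
      unfolding \<psi>_def by (intro mult_left_mono inverse_sqrt_sin_le_sing x' C)
    finally show "cmod D \<le> \<psi> x" .
  qed
  have right: "cmod (sol w g v - sol w g u) \<le> integral {u..v} \<psi>" if "0 \<le> u" "u \<le> v" "v \<le> pi" for u v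
  proof (rule norm_diff_le_integral_closure[where c = 0 and d = pi])
    show "continuous_on {0..pi} (sol w g)" by (rule continuous_on_subset[OF sol_continuous]) auto
    show "\<psi> absolutely_integrable_on {0..pi}" by (rule set_integrable_subset[OF \<psi>(1)]) auto
  qed (use that \<psi>(2) in \<open>auto intro!: local\<close>)
  have left: "cmod (sol w g v - sol w g u) \<le> integral {u..v} \<psi>" if "-pi \<le> u" "u \<le> v" "v \<le> 0" for u v
  proof (rule norm_diff_le_integral_closure[where c = "-pi" and d = 0])
    show "continuous_on {-pi..0} (sol w g)" by (rule continuous_on_subset[OF sol_continuous]) auto
    show "\<psi> absolutely_integrable_on {-pi..0}" by (rule set_integrable_subset[OF \<psi>(1)]) auto
  qed (use that \<psi>(2) in \<open>auto intro!: local\<close>)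
  show ?thesis
  proof (rule abs_cont_on_dominated[OF \<psi>])
    fix u v assume uv: "-pi \<le> u" "u \<le> v" "v \<le> pi"
    show "cmod (sol w g v - sol w g u) \<le> integral {u..v} \<psi>"
    proof (cases "u < 0 \<and> 0 < v")
      case True
      have "sol w g v - sol w g u = (sol w g v - sol w g 0) + (sol w g 0 - sol w g u)" by simp
      then have "cmod (sol w g v - sol w g u) \<le> cmod (sol w g v - sol w g 0) + cmod (sol w g 0 - sol w g u)"
        by (metis norm_triangle_ineq)
      also have "\<dots> \<le> integral {0..v} \<psi> + integral {u..0} \<psi>"
        using left[of u 0] right[of 0 v] True uv by auto
      also have "\<dots> = integral {u..v} \<psi>"
        using Henstock_Kurzweil_Integration.integral_combine[of u 0 v \<psi>] True uv \<psi>i by auto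
      finally show ?thesis .
    qed (use uv left right in force)
  qed
qed

lemma m_expr_sol: "AE x in leb_pi. m_expr a b (sol w g) x = w x"
  unfolding AE_leb_pi_iff_negligible
proof -
  obtain N where N: "negligible N"
    "\<And>x. x \<in> {-pi<..<pi} - {0} - N \<Longrightarrow>
       (sol w g has_vector_derivative (p x / (b * sin x)) *\<^sub>R (hom x *\<^sub>R hinv_integral w g x)) (at x)"
    using sol_deriv by blast
  have "m_expr a b (sol w g) x = w x" if x: "x \<in> {-pi<..<pi} - (N \<union> {0})" for x
  proof -
    have x': "-pi < x" "x < pi" "x \<noteq> 0" using x by auto
    have d: "vderiv (sol w g) x = (p x / (b * sin x)) *\<^sub>R (hom x *\<^sub>R hinv_integral w g x)"
      by (rule vector_derivative_at[OF N(2)]) (use x in auto)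
    have "p x \<noteq> 0" using p_bounds(3)[of x] by simp
    have "m_expr a b (sol w g) x = p x *\<^sub>R sol w g x + (b * sin x) *\<^sub>R vderiv (sol w g) x"
      by (simp add: m_expr_def p_def scaleR_conv_of_real)
    also have "\<dots> = w x"
      unfolding d sol_def using half_angle(3)[OF x'] b_pos \<open>p x \<noteq> 0\<close>
      by (simp add: scaleR_diff_right)
    finally show ?thesis .
  qed
  moreover have "negligible (N \<union> {0})" using N(1) by simp
  ultimately show "\<exists>N. negligible N \<and> (\<forall>x\<in>{-pi<..<pi} - N. m_expr a b (sol w g) x = w x)" by blast
qed

end

end

section \<open>Uniqueness, linearity and boundedness of the solution\<close>

lemma inverse_not_integrable:
  fixes \<phi> :: "real \<Rightarrow> real"
  assumes \<phi>: "\<phi> integrable_on {0..1}" "\<And>t. 0 \<le> \<phi> t" and K: "K > 0" and le: "\<And>t. 0 < t \<Longrightarrow> t \<le> 1 \<Longrightarrow> K / t \<le> \<phi> t"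
  shows False
proof -
  define I where "I = integral {0..1} \<phi>"
  have I: "I \<ge> 0" unfolding I_def using \<phi> by (intro integral_nonneg) auto
  \<comment> \<open>Chosen so that K / t has integral K ln (1 / \<epsilon>) = I + 1 over
    \<open>{\<epsilon>..1}\<close>, more than \<phi> has over the whole interval.\<close>
  define \<epsilon> where "\<epsilon> = exp (- (I + 1) / K)"
  have \<epsilon>: "0 < \<epsilon>" "\<epsilon> \<le> 1" using I K by (auto simp: \<epsilon>_def divide_le_0_iff)
  have "((\<lambda>t. K / t) has_integral (K * ln 1 - K * ln \<epsilon>)) {\<epsilon>..1}"
  proof (rule fundamental_theorem_of_calculus[OF \<epsilon>(2)])
    fix t assume t: "t \<in> {\<epsilon>..1}"
    then have "((\<lambda>t. K * ln t) has_real_derivative K / t) (at t)"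
      using \<epsilon> by (auto intro!: derivative_eq_intros)
    then show "((\<lambda>t. K * ln t) has_vector_derivative K / t) (at t within {\<epsilon>..1})"
      by (simp add: has_real_derivative_iff_has_vector_derivative has_vector_derivative_at_within)
  qed
  moreover have "K * ln 1 - K * ln \<epsilon> = I + 1" using K by (simp add: \<epsilon>_def)
  ultimately have i: "((\<lambda>t. K / t) has_integral (I + 1)) {\<epsilon>..1}" by simp
  have s: "\<phi> integrable_on {\<epsilon>..1}"
    by (rule integrable_on_subinterval[OF \<phi>(1)]) (use \<epsilon> in auto)
  have "I + 1 \<le> integral {\<epsilon>..1} \<phi>"
    by (rule has_integral_le[OF i integrable_integral[OF s]]) (use \<epsilon> in \<open>auto intro!: le\<close>)
  also have "\<dots> \<le> I"
    unfolding I_def by (rule integral_subset_le) (use s \<phi> \<epsilon> in auto)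
  finally show False by simp
qed

lemma abs_cont_on_locally:
  assumes "abs_cont_on {c..d} f" "S \<subseteq> {c..d}"
  shows "locally_abs_cont_on S f"
  unfolding locally_abs_cont_on_def
proof (intro allI impI)
  fix u v assume uv: "u \<le> v \<and> {u..v} \<subseteq> S"
  then have "u \<in> {u..v}" "v \<in> {u..v}" by auto
  then have "u \<in> {c..d}" "v \<in> {c..d}" using uv assms(2) by blast+
  then show "abs_cont_on {u..v} f" by (intro abs_cont_on_subinterval[OF assms(1)]) auto
qed

lemma abs_cont_on_imp_square_integrable:
  assumes "abs_cont_on {-pi..pi} f"
  shows "square_integrable f"
proof -
  have c: "continuous_on {-pi..pi} f" by (rule abs_cont_on_imp_continuous_on[OF assms])
  then have "bounded (f ` {-pi..pi})" by (intro compact_imp_bounded compact_continuous_image) auto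
  then obtain B where "\<And>x. x \<in> {-pi..pi} \<Longrightarrow> cmod (f x) \<le> B" unfolding bounded_iff by blast
  moreover have "f \<in> borel_measurable leb_pi"
    by (rule continuous_imp_measurable_leb_pi, rule continuous_on_subset[OF c]) auto
  ultimately show ?thesis by (intro square_integrable_bounded(1)[of f B]) auto
qed

lemma primitive_linear:
  assumes "primitive w1 g1" "primitive w2 g2"
  shows "primitive (\<lambda>x. c1 * w1 x + c2 * w2 x) (\<lambda>x. c1 * g1 x + c2 * g2 x)"
  unfolding primitive_def
proof (intro conjI ballI)
  show "square_integrable (\<lambda>x. c1 * g1 x + c2 * g2 x)"
    by (rule square_integrable_add[of "\<lambda>x. c1 * g1 x" "\<lambda>x. c2 * g2 x"];
        rule square_integrable_cmult) (use assms in \<open>simp_all add: primitive_def\<close>)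
  fix x assume x: "x \<in> {-pi..pi}"
  have i: "g integrable_on {-pi..x}" if "square_integrable g" for g
    by (rule set_lebesgue_integral_eq_integral(1)[OF set_integrable_subset[OF square_integrable_imp_absolutely_integrable[OF that]]])
       (use x in auto)
  have e: "w1 x = w1 (-pi) + integral {-pi..x} g1" "w2 x = w2 (-pi) + integral {-pi..x} g2"
    using assms x unfolding primitive_def by blast+
  have "integral {-pi..x} (\<lambda>x. c1 * g1 x + c2 * g2 x) = c1 * integral {-pi..x} g1 + c2 * integral {-pi..x} g2"
  proof (subst integral_add)
    show "(\<lambda>x. c1 * g1 x) integrable_on {-pi..x}" "(\<lambda>x. c2 * g2 x) integrable_on {-pi..x}"
      by (intro integrable_on_mult_right i; use assms in \<open>simp add: primitive_def\<close>)+
  qed simp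
  then show "c1 * w1 x + c2 * w2 x = c1 * w1 (-pi) + c2 * w2 (-pi) + integral {-pi..x} (\<lambda>x. c1 * g1 x + c2 * g2 x)"
    by (subst e(1), subst e(2)) (simp add: algebra_simps)
qed

lemma abs_cont_on_const: "abs_cont_on {c..d} (\<lambda>_. k)"
  by (rule abs_cont_on_C1[where f' = "\<lambda>_. 0"]) auto

lemma abs_cont_on_lin:
  assumes "abs_cont_on {c..d} f1" "abs_cont_on {c..d} f2"
  shows "abs_cont_on {c..d} (\<lambda>x. c1 * f1 x + c2 * f2 x)"
  using abs_cont_on_diff[OF abs_cont_on_mult[OF abs_cont_on_const[of c d c1] assms(1)]
      abs_cont_on_mult[OF abs_cont_on_const[of c d "-c2"] assms(2)]]
  by simp

context admissible_parameters
begin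

abbreviation punctured :: "real set" where
  "punctured \<equiv> {-pi<..<0} \<union> {0<..<pi}"

text \<open>The difference \<open>z\<close> solves the homogeneous equation, so on each side of 0
  its quotient \<open>f\<close> by \<open>hom\<close> is absolutely continuous with zero derivative,
  hence constant. A nonzero constant would make the square of \<open>z\<close> at least a multiple
  of 1 / \<bar>t\<bar>, contrary to square integrability.\<close>

lemma sol_unique:
  assumes w: "primitive w g" and y: "locally_abs_cont_on punctured y" "square_integrable y"
    and m: "AE x in leb_pi. m_expr a b y x = w x" and x: "x \<in> punctured"
  shows "y x = sol w g x"
proof -
  define z where "z t = y t - sol w g t" for t
  define f where "f t = z t * of_real (hinv t)" for t
  obtain N1 where N1: "negligible N1"
    "\<And>x. x \<in> {-pi<..<pi} - {0} - N1 \<Longrightarrow>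
       (sol w g has_vector_derivative (p x / (b * sin x)) *\<^sub>R (hom x *\<^sub>R hinv_integral w g x)) (at x)"
    using sol_deriv[OF w] by blast
  obtain N2 where N2: "negligible N2" "\<And>x. x \<in> {-pi<..<pi} - N2 \<Longrightarrow> m_expr a b y x = w x"
    using m unfolding AE_leb_pi_iff_negligible by blast
  have f_const: "f v = f u" if uv: "u \<le> v" "{u..v} \<subseteq> punctured" for u v
  proof -
    have "abs_cont_on {u..v} y" using y(1) uv unfolding locally_abs_cont_on_def by blast
    then have ac: "abs_cont_on {u..v} f"
      unfolding f_def[abs_def] z_def[abs_def]
      by (intro abs_cont_on_mult abs_cont_on_diff sol_abs_cont_local[OF w] abs_cont_on_hom uv)
    have "cmod (f v - f u) \<le> integral {u..v} (\<lambda>_. 0)"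
    proof (rule abs_cont_on_deriv_bound[OF uv(1) ac, of "N1 \<union> N2"])
      fix t D assume t: "t \<in> {u<..<v} - (N1 \<union> N2)" and D: "(f has_vector_derivative D) (at t)"
      have "t \<in> {u..v}" using t by auto
      then have tp: "t \<in> punctured" using uv(2) by blast
      then have t': "-pi < t" "t < pi" "t \<noteq> 0" using pi_gt_zero by auto
      define Q where "Q = p t / (b * sin t)"
      have bs: "b * sin t \<noteq> 0" using half_angle(3)[OF t'] b_pos by simp
      \<comment> \<open>The derivative that y = hom f + sol w g has once \<open>f\<close> has
        derivative \<open>D\<close>. Inserted into the equation for \<open>y\<close> it leaves b sin
        t hom t D = 0.\<close>
      define E where "E = (hom t *\<^sub>R D + (- hom t * Q) *\<^sub>R f t) + Q *\<^sub>R (hom t *\<^sub>R hinv_integral w g t)"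
      have "((\<lambda>t. hom t *\<^sub>R f t + sol w g t) has_vector_derivative E) (at t)"
        unfolding E_def Q_def
        by (intro has_vector_derivative_add has_vector_derivative_scaleR hom_deriv[OF t'] D N1(2)) (use t t' in auto)
      then have "(y has_vector_derivative E) (at t)"
      proof (rule has_vector_derivative_transform_within_open[where S = punctured])
        show "hom s *\<^sub>R f s + sol w g s = y s" if "s \<in> punctured" for s
        proof -
          have "hom s * hinv s = 1" by (rule hom_hinv) (use that pi_gt_zero in auto)
          then have "of_real (hom s) * of_real (hinv s) = (1::complex)" by (metis of_real_1 of_real_mult)
          then have "hom s *\<^sub>R f s = z s" by (simp add: f_def scaleR_conv_of_real algebra_simps)
          then show ?thesis by (simp add: z_def)
        qed
      qed (use tp in auto)
      then have "vderiv y t = E" by (rule vector_derivative_at)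
      then have "w t = p t *\<^sub>R y t + (b * sin t) *\<^sub>R E"
        using N2(2)[of t] t t' by (simp add: m_expr_def p_def scaleR_conv_of_real)
      moreover have "y t = hom t *\<^sub>R f t + sol w g t"
      proof -
        have "of_real (hom t) * of_real (hinv t) = (1::complex)"
          using hom_hinv(1)[OF t'] by (metis of_real_1 of_real_mult)
        then have "hom t *\<^sub>R f t = z t" by (simp add: f_def scaleR_conv_of_real algebra_simps)
        then show ?thesis by (simp add: z_def)
      qed
      moreover have "p t *\<^sub>R sol w g t = w t - (p t * hom t) *\<^sub>R hinv_integral w g t"
        using p_bounds(3)[of t] by (simp add: sol_def scaleR_diff_right)
      moreover have "(b * sin t) *\<^sub>R E = (b * sin t * hom t) *\<^sub>R D - (p t * hom t) *\<^sub>R f t + (p t * hom t) *\<^sub>R hinv_integral w g t"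
      proof -
        have "b * sin t * Q = p t" using bs by (simp add: Q_def)
        then have e: "b * sin t * (hom t * Q) = p t * hom t" "b * sin t * (Q * hom t) = p t * hom t"
          by (metis mult.assoc mult.commute)+
        show ?thesis unfolding E_def by (simp add: scaleR_add_right scaleR_diff_right e)
      qed
      ultimately have "(b * sin t * hom t) *\<^sub>R D = 0"
        by (simp add: scaleR_add_right)
      then have "D = 0" using bs hom_hinv(2)[OF t'] by simp
      then show "cmod D \<le> 0" by simp
    qed (use N1 N2 in auto)
    then show ?thesis by simp
  qed
  have z_eq: "z t = of_real (hom t) * f t" if "t \<in> punctured" for t
  proof -
    have "hom t * hinv t = 1" by (rule hom_hinv) (use that pi_gt_zero in auto)
    then have "of_real (hom t) * of_real (hinv t) = (1::complex)" by (metis of_real_1 of_real_mult)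
    then show ?thesis by (simp add: f_def algebra_simps)
  qed
  have zsq: "square_integrable z"
    unfolding z_def[abs_def]
    by (rule l2norm_diff_le(1)[OF y(2) abs_cont_on_imp_square_integrable[OF sol_abs_cont[OF w]]])
  have zi: "(\<lambda>t. (cmod (z t))\<^sup>2) integrable_on {u..v}" if "-pi \<le> u" "v \<le> pi" for u v
  proof (rule set_lebesgue_integral_eq_integral(1), rule set_integrable_subset)
    show "(\<lambda>t. (cmod (z t))\<^sup>2) absolutely_integrable_on {-pi..pi}"
      using zsq by (simp add: square_integrable_def flip: integrable_leb_pi_iff)
  qed (use that in auto)
  have "f x = 0"
  proof (rule ccontr)
    assume fx: "f x \<noteq> 0"
    \<comment> \<open>On the side of 0 containing \<open>x\<close> the function \<open>z\<close> is
      \<open>hom\<close> times the constant \<open>f x\<close>; the cosine power is the constant of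
      \<open>hom_square_ge\<close>.\<close>
    define K where "K = (cmod (f x))\<^sup>2 * cos (1/2) powr (2 * \<beta>)"
    have "cos (1/2::real) > 0" by (rule cos_gt_zero_pi) (use pi_gt3 in auto)
    then have K: "K > 0" using fx by (simp add: K_def)
    have z_ge: "K / \<bar>t\<bar> \<le> (cmod (z t))\<^sup>2" if t: "t \<in> punctured" "\<bar>t\<bar> \<le> 1" "f t = f x" for t
    proof -
      have "K / \<bar>t\<bar> = (cmod (f x))\<^sup>2 * (cos (1/2) powr (2 * \<beta>) / \<bar>t\<bar>)" by (simp add: K_def)
      also have "\<dots> \<le> (cmod (f x))\<^sup>2 * (hom t)\<^sup>2"
        by (intro mult_left_mono hom_square_ge) (use t in auto)
      also have "\<dots> = (cmod (z t))\<^sup>2"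
        unfolding z_eq[OF t(1)] t(3) by (simp add: norm_mult power_mult_distrib mult.commute)
      finally show ?thesis .
    qed
    show False
    proof (cases "x > 0")
      case True
      have same: "f t = f x" if "t \<in> {0<..<pi}" for t
      proof (cases "t \<le> x")
        case True
        then show ?thesis using f_const[of t x] that x by force
      next
        case False
        then show ?thesis using f_const[of x t] that x \<open>x > 0\<close> by force
      qed
      show False
      proof (rule inverse_not_integrable[OF zi _ K])
        show "K / t \<le> (cmod (z t))\<^sup>2" if "0 < t" "t \<le> 1" for t
          using z_ge[of t] same[of t] that pi_gt3 by simp
      qed (use pi_gt3 in auto)
    next
      case False
      then have xn: "x \<in> {-pi<..<0}" using x by auto
      have same: "f t = f x" if "t \<in> {-pi<..<0}" for t
      proof (cases "t \<le> x")
        case True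
        then show ?thesis using f_const[of t x] that xn by force
      next
        case False
        then show ?thesis using f_const[of x t] that xn by force
      qed
      \<comment> \<open>Reflection moves the left half to the right, where nonintegrability of K / t
        is known.\<close>
      have "(\<lambda>t. (cmod (z (- t)))\<^sup>2) integrable_on {-0..-(-1)}"
        by (subst Henstock_Kurzweil_Integration.integrable_reflect_real) (rule zi, use pi_gt3 in auto)
      then have "(\<lambda>t. (cmod (z (- t)))\<^sup>2) integrable_on {0..1}" by simp
      then show False
      proof (rule inverse_not_integrable[OF _ _ K])
        show "K / t \<le> (cmod (z (- t)))\<^sup>2" if "0 < t" "t \<le> 1" for t
          using z_ge[of "-t"] same[of "-t"] that pi_gt3 by simp
      qed simp
    qed
  qed
  then show ?thesis using z_eq[OF x] by (simp add: z_def)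
qed

lemma sol_eqI:
  assumes w: "primitive w g" and y: "abs_cont_on {-pi..pi} y"
    and m: "AE x in leb_pi. m_expr a b y x = w x" and x: "x \<in> punctured"
  shows "sol w g x = y x"
proof (rule sol_unique[OF w _ _ m x, symmetric])
  show "locally_abs_cont_on punctured y"
    by (rule abs_cont_on_locally[OF y]) (use pi_gt_zero in auto)
  show "square_integrable y" by (rule abs_cont_on_imp_square_integrable[OF y])
qed

text \<open>Linearity follows from uniqueness instead of the formula: the combination on the right
  is absolutely continuous and solves the equation for \<open>w\<close>. Therefore different
  representatives of the same derivative may be used on the two sides.\<close>

lemma sol_linear:
  assumes w: "primitive w1 g1" "primitive w2 g2" "primitive w g"
    and eq: "\<And>x. x \<in> {-pi<..<pi} \<Longrightarrow> w x = c1 * w1 x + c2 * w2 x" and x: "x \<in> punctured"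
  shows "sol w g x = c1 * sol w1 g1 x + c2 * sol w2 g2 x"
proof (rule sol_eqI[OF w(3) _ _ x])
  show "abs_cont_on {-pi..pi} (\<lambda>x. c1 * sol w1 g1 x + c2 * sol w2 g2 x)"
    by (intro abs_cont_on_lin sol_abs_cont w)
  obtain N1 where N1: "negligible N1"
    "\<And>x. x \<in> {-pi<..<pi} - {0} - N1 \<Longrightarrow>
       (sol w1 g1 has_vector_derivative (p x / (b * sin x)) *\<^sub>R (hom x *\<^sub>R hinv_integral w1 g1 x)) (at x)"
    using sol_deriv[OF w(1)] by blast
  obtain N2 where N2: "negligible N2"
    "\<And>x. x \<in> {-pi<..<pi} - {0} - N2 \<Longrightarrow>
       (sol w2 g2 has_vector_derivative (p x / (b * sin x)) *\<^sub>R (hom x *\<^sub>R hinv_integral w2 g2 x)) (at x)"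
    using sol_deriv[OF w(2)] by blast
  obtain N3 N4 where N34: "negligible N3" "negligible N4"
    "\<And>x. x \<in> {-pi<..<pi} - N3 \<Longrightarrow> m_expr a b (sol w1 g1) x = w1 x"
    "\<And>x. x \<in> {-pi<..<pi} - N4 \<Longrightarrow> m_expr a b (sol w2 g2) x = w2 x"
    using m_expr_sol[OF w(1)] m_expr_sol[OF w(2)] unfolding AE_leb_pi_iff_negligible by blast
  let ?N = "N1 \<union> N2 \<union> N3 \<union> N4 \<union> {0}"
  have "m_expr a b (\<lambda>x. c1 * sol w1 g1 x + c2 * sol w2 g2 x) x = w x" if x: "x \<in> {-pi<..<pi} - ?N" for x
  proof -
    have d: "(sol w1 g1 has_vector_derivative vderiv (sol w1 g1) x) (at x)"
        "(sol w2 g2 has_vector_derivative vderiv (sol w2 g2) x) (at x)"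
      using N1(2)[of x] N2(2)[of x] x by (auto simp: vector_derivative_at)
    have "vderiv (\<lambda>x. c1 * sol w1 g1 x + c2 * sol w2 g2 x) x = c1 * vderiv (sol w1 g1) x + c2 * vderiv (sol w2 g2) x"
      by (intro vector_derivative_at has_vector_derivative_add has_vector_derivative_mult_right d)
    then have "m_expr a b (\<lambda>x. c1 * sol w1 g1 x + c2 * sol w2 g2 x) x
        = c1 * m_expr a b (sol w1 g1) x + c2 * m_expr a b (sol w2 g2) x"
      by (simp add: m_expr_def algebra_simps)
    then show ?thesis using N34(3)[of x] N34(4)[of x] eq[of x] x by simp
  qed
  moreover have "negligible ?N" using N1(1) N2(1) N34(1,2) by simp
  ultimately show "AE x in leb_pi. m_expr a b (\<lambda>x. c1 * sol w1 g1 x + c2 * sol w2 g2 x) x = w x"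
    unfolding AE_leb_pi_iff_negligible by blast
qed

text \<open>Because w vanishes at \<open>-pi\<close>, the norm of \<open>g\<close> controls the
  supremum of \<open>w\<close>, then the norm of \<open>dquot w g\<close>, and through
  \<open>hom_G_bound\<close> the supremum of the solution.\<close>

lemma l2norm_sol_le:
  obtains K where "\<And>w g. primitive w g \<Longrightarrow> w (-pi) = 0 \<Longrightarrow> l2norm (sol w g) \<le> l2norm g * K"
proof
  define A where "A = 1 / (1 - a) + a / (1 - a)\<^sup>2 * (sqrt (2 * pi) * sqrt (2 * pi))"
  fix w g assume w: "primitive w g" and w0: "w (-pi) = 0"
  have g: "square_integrable g" using w by (simp add: primitive_def)
  have W: "cmod (w x) \<le> sqrt (2 * pi) * l2norm g" if x: "x \<in> {-pi..pi}" for x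
  proof -
    \<comment> \<open>The factor 1 prepares for Cauchy-Schwarz.\<close>
    have "w x = integral {-pi..x} (\<lambda>x. 1 *\<^sub>R g x)"
      using w w0 x unfolding primitive_def by auto
    also have "cmod \<dots> \<le> sqrt (integral {-pi..x} (\<lambda>x. 1\<^sup>2)) * l2norm g"
      by (rule norm_integral_product_le(2)) (use x g in auto)
    also have "\<dots> \<le> sqrt (2 * pi) * l2norm g"
      using x by (intro mult_right_mono real_sqrt_le_mono l2norm_nonneg) auto
    finally show ?thesis .
  qed
  have "l2norm (dquot w g) \<le> 1 / (1 - a) * l2norm g + a / (1 - a)\<^sup>2 * ((sqrt (2 * pi) * l2norm g) * sqrt (2 * pi))"
    by (rule dquot_square_integrable(2)[OF w]) (use W in auto)
  then have dq: "l2norm (dquot w g) \<le> A * l2norm g"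
    by (simp add: A_def algebra_simps)
  have "cmod (sol w g x) \<le> (1 / (1 - a) * sqrt (2 * pi) + sqrt K\<^sub>0 * A) * l2norm g" if x: "x \<in> {-pi<..<pi}" for x
  proof -
    have x': "x \<in> {-pi..pi}" using x by auto
    have "cmod (sol w g x) \<le> cmod ((1 / p x) *\<^sub>R w x) + cmod (hom x *\<^sub>R hinv_integral w g x)"
      unfolding sol_def by (rule norm_triangle_ineq4)
    also have "\<dots> \<le> 1 / (1 - a) * (sqrt (2 * pi) * l2norm g) + sqrt K\<^sub>0 * (A * l2norm g)"
    proof (rule add_mono)
      have "cmod ((1 / p x) *\<^sub>R w x) = 1 / p x * cmod (w x)"
        using p_bounds(3)[of x] by simp
      also have "\<dots> \<le> 1 / (1 - a) * (sqrt (2 * pi) * l2norm g)"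
        using p_bounds[of x] a_less_1 by (intro mult_mono W[OF x']) (auto simp: frac_le)
      finally show "cmod ((1 / p x) *\<^sub>R w x) \<le> 1 / (1 - a) * (sqrt (2 * pi) * l2norm g)" .
      have "cmod (hom x *\<^sub>R hinv_integral w g x) \<le> sqrt (K\<^sub>0 * \<bar>sin x\<bar>) * l2norm (dquot w g)"
        by (rule hom_G_bound[OF w x'])
      also have "\<dots> \<le> sqrt K\<^sub>0 * (A * l2norm g)"
        using K\<^sub>0_pos abs_sin_le_one[of x] dq l2norm_nonneg
        by (intro mult_mono) (auto simp: mult_left_le)
      finally show "cmod (hom x *\<^sub>R hinv_integral w g x) \<le> sqrt K\<^sub>0 * (A * l2norm g)" .
    qed
    finally show ?thesis by (simp add: algebra_simps)
  qed
  moreover have "sol w g \<in> borel_measurable leb_pi"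
    by (rule continuous_imp_measurable_leb_pi, rule continuous_on_subset[OF sol_continuous[OF w]]) auto
  ultimately have "l2norm (sol w g) \<le> (1 / (1 - a) * sqrt (2 * pi) + sqrt K\<^sub>0 * A) * l2norm g * sqrt (2 * pi)"
    by (intro square_integrable_bounded(2))
  then show "l2norm (sol w g) \<le> l2norm g * ((1 / (1 - a) * sqrt (2 * pi) + sqrt K\<^sub>0 * A) * sqrt (2 * pi))"
    by (simp add: mult.commute mult.left_commute)
qed

end

section \<open>The graph of the operator\<close>

lemma rep_L2: "square_integrable (rep_L2 u)" "abs_L2 (rep_L2 u) = u"
  using Quotient_rep_reflp[OF Quotient_L2, of u] Quotient_abs_rep[OF Quotient_L2, of u]
  by (simp_all add: L2_rel_refl)

lemma represents_rep_L2: "represents (rep_L2 u) u"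
  by (simp add: represents_def rep_L2)

lemma abs_L2_eqI:
  assumes "square_integrable f" "square_integrable g" "\<And>x. x \<in> {-pi<..<0} \<union> {0<..<pi} \<Longrightarrow> f x = g x"
  shows "abs_L2 f = abs_L2 g"
proof -
  have "AE x in leb_pi. f x = g x"
    unfolding AE_leb_pi_iff_negligible
  proof (intro exI[of _ "{0}"] conjI ballI)
    fix x :: real assume "x \<in> {-pi<..<pi} - {0}"
    then have "x \<in> {-pi<..<0} \<union> {0<..<pi}" by auto
    then show "f x = g x" by (rule assms(3))
  qed simp
  then show ?thesis
    using represents_eq_iff[of f "abs_L2 f" g "abs_L2 g"] assms by (simp add: represents_def)
qed

section \<open>Complex scalars and complex lines in \<open>L2\<close>\<close>

lemma abs_L2_add: "square_integrable f \<Longrightarrow> square_integrable g \<Longrightarrow> abs_L2 f + abs_L2 g = abs_L2 (\<lambda>x. f x + g x)"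
  by (rule plus_L2.abs_eq) (simp_all add: L2_rel_refl)

lemma scaleC_abs_L2: "square_integrable f \<Longrightarrow> scaleC_L2 c (abs_L2 f) = abs_L2 (\<lambda>x. c * f x)"
  by (rule scaleC_L2.abs_eq) (simp add: L2_rel_refl)

lemma abs_L2_lin:
  assumes "square_integrable f" "square_integrable g"
  shows "scaleC_L2 c (abs_L2 f) + scaleC_L2 d (abs_L2 g) = abs_L2 (\<lambda>x. c * f x + d * g x)"
  by (simp add: scaleC_abs_L2 abs_L2_add square_integrable_cmult assms)

lemma scaleC_one: "scaleC_L2 1 u = u"
  using scaleC_abs_L2[OF rep_L2(1)[of u], of 1] by (simp add: rep_L2)

lemma scaleC_scaleC: "scaleC_L2 c (scaleC_L2 d u) = scaleC_L2 (c * d) u"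
  using scaleC_abs_L2[OF rep_L2(1)[of u]] scaleC_abs_L2[OF square_integrable_cmult[OF rep_L2(1)[of u]]]
  by (simp add: rep_L2 mult.assoc)

lemma scaleC_zero_left: "scaleC_L2 0 u = 0"
  using scaleC_abs_L2[OF rep_L2(1)[of u], of 0] by (simp add: rep_L2 zero_L2_def)

lemma scaleC_add_right: "scaleC_L2 c (u + v) = scaleC_L2 c u + scaleC_L2 c v"
  using rep_L2[of u] rep_L2[of v]
    abs_L2_lin[OF rep_L2(1)[of u] rep_L2(1)[of v], of c c]
    abs_L2_add[OF rep_L2(1)[of u] rep_L2(1)[of v]]
    scaleC_abs_L2[OF square_integrable_add[OF rep_L2(1)[of u] rep_L2(1)[of v]], of c]
  by (simp add: distrib_left)

lemma scaleC_add_left: "scaleC_L2 (c + d) u = scaleC_L2 c u + scaleC_L2 d u"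
  using rep_L2[of u] abs_L2_lin[OF rep_L2(1)[of u] rep_L2(1)[of u], of c d]
    scaleC_abs_L2[OF rep_L2(1)[of u], of "c + d"]
  by (simp add: distrib_right)

lemma scaleR_eq_scaleC: "r *\<^sub>R u = scaleC_L2 (of_real r) u"
proof -
  have "r *\<^sub>R abs_L2 (rep_L2 u) = abs_L2 (\<lambda>x. r *\<^sub>R rep_L2 u x)"
    by (rule scaleR_L2.abs_eq) (simp add: L2_rel_refl rep_L2)
  then show ?thesis
    using scaleC_abs_L2[OF rep_L2(1)[of u], of "of_real r"] by (simp add: rep_L2 scaleR_conv_of_real)
qed

text \<open>For the real inner product, u and its multiple by the imaginary unit are orthogonal and
  of equal norm; they serve as an orthogonal basis of the complex line of u.\<close>

lemma inner_scaleC: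
  "inner (scaleC_L2 \<i> u) u = 0" "inner (scaleC_L2 \<i> u) (scaleC_L2 \<i> u) = inner u u"
proof -
  have u: "scaleC_L2 \<i> u = abs_L2 (\<lambda>x. \<i> * rep_L2 u x)"
    using scaleC_abs_L2[OF rep_L2(1)[of u], of \<i>] by (simp add: rep_L2)
  note sq = square_integrable_cmult[OF rep_L2(1)[of u], of \<i>]
  have c: "inner (\<i> * z) z = 0" "inner (\<i> * z) (\<i> * z) = inner z z" for z :: complex
    by (simp_all add: inner_complex_def)
  have "inner (scaleC_L2 \<i> u) (abs_L2 (rep_L2 u)) = 0"
    unfolding u inner_abs_L2[OF sq rep_L2(1)] c by simp
  then show "inner (scaleC_L2 \<i> u) u = 0" unfolding rep_L2(2) .
  have "inner (scaleC_L2 \<i> u) (scaleC_L2 \<i> u) = inner (abs_L2 (rep_L2 u)) (abs_L2 (rep_L2 u))"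
    unfolding u inner_abs_L2[OF sq sq] inner_abs_L2[OF rep_L2(1) rep_L2(1)] c ..
  then show "inner (scaleC_L2 \<i> u) (scaleC_L2 \<i> u) = inner u u" unfolding rep_L2(2) .
qed

lemma closed_complex_line: "closed (range (\<lambda>c. scaleC_L2 c e))"
proof -
  \<comment> \<open>The orthogonal projection onto the line. It is continuous, so the line is closed
    as its fixed point set; \<open>inverse 0 = 0\<close> covers \<open>e = 0\<close>.\<close>
  let ?P = "\<lambda>x. (inner x e * inverse (inner e e)) *\<^sub>R e + (inner x (scaleC_L2 \<i> e) * inverse (inner e e)) *\<^sub>R scaleC_L2 \<i> e"
  have expand: "scaleC_L2 c e = Re c *\<^sub>R e + Im c *\<^sub>R scaleC_L2 \<i> e" for c
    unfolding scaleR_eq_scaleC scaleC_scaleC scaleC_add_left[symmetric]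
    by (rule arg_cong[where f = "\<lambda>c. scaleC_L2 c e"]) (simp add: complex_eq_iff)
  have "range (\<lambda>c. scaleC_L2 c e) = {x. x = ?P x}"
  proof (intro equalityI subsetI)
    fix x assume "x \<in> range (\<lambda>c. scaleC_L2 c e)"
    then obtain c where "x = scaleC_L2 c e" by blast
    then have x: "x = Re c *\<^sub>R e + Im c *\<^sub>R scaleC_L2 \<i> e" by (rule trans[OF _ expand])
    show "x \<in> {x. x = ?P x}"
    proof (cases "e = 0")
      case True
      have "scaleC_L2 \<i> 0 = 0"
        using scaleC_scaleC[of \<i> 0 0] by (simp add: scaleC_zero_left)
      with True x show ?thesis by simp
    next
      case False
      then have "inner e e \<noteq> 0" by simp
      moreover have "inner e (scaleC_L2 \<i> e) = 0" using inner_scaleC(1)[of e] by (simp add: inner_commute)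
      ultimately show ?thesis
        unfolding x by (simp add: inner_add_left inner_scaleC mult.assoc del: inner_eq_zero_iff)
    qed
  next
    fix x assume "x \<in> {x. x = ?P x}"
    then have "x = ?P x" by blast
    then have "x = scaleC_L2 (Complex (inner x e * inverse (inner e e)) (inner x (scaleC_L2 \<i> e) * inverse (inner e e))) e"
      by (rule trans) (simp only: expand[of "Complex _ _"] complex.sel)
    then show "x \<in> range (\<lambda>c. scaleC_L2 c e)" by blast
  qed
  moreover have "closed {x. x = ?P x}"
    by (intro closed_Collect_eq continuous_intros)
  ultimately show ?thesis by simp
qed

text \<open>The inner product is real, so two conditions are imposed: the constants 1 and
  \<open>\<i>\<close> pick the real and the imaginary part of the integral. In this form closedness
  is immediate.\<close>

definition mean_zero :: "L2 set" where
  "mean_zero = {v. inner v (abs_L2 (\<lambda>_. 1)) = 0 \<and> inner v (abs_L2 (\<lambda>_. \<i>)) = 0}"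

lemma closed_mean_zero: "closed mean_zero"
  unfolding mean_zero_def by (intro closed_Collect_conj closed_Collect_eq continuous_intros)

lemma square_integrable_const: "square_integrable (\<lambda>_. c)"
  using abs_cont_on_imp_square_integrable[of "\<lambda>_. c"] abs_cont_on_C1[where f = "\<lambda>_. c" and f' = "\<lambda>_. 0"] by auto

lemma mean_zero_iff:
  assumes "represents f v"
  shows "v \<in> mean_zero \<longleftrightarrow> integral {-pi..pi} f = 0"
proof -
  have f: "square_integrable f" "v = abs_L2 f" using assms by (auto simp: represents_def)
  have ai: "f absolutely_integrable_on {-pi..pi}" by (rule square_integrable_imp_absolutely_integrable[OF f(1)])
  then have i: "integrable leb_pi f" by (simp add: integrable_leb_pi_iff)
  have "inner v (abs_L2 (\<lambda>_. 1)) = (LINT x|leb_pi. Re (f x))" "inner v (abs_L2 (\<lambda>_. \<i>)) = (LINT x|leb_pi. Im (f x))"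
    unfolding f(2) by (simp_all add: inner_abs_L2 f(1) square_integrable_const inner_complex_def)
  then have "inner v (abs_L2 (\<lambda>_. 1)) = Re (integral {-pi..pi} f)" "inner v (abs_L2 (\<lambda>_. \<i>)) = Im (integral {-pi..pi} f)"
    using i integral_leb_pi[OF ai] by simp_all
  then show ?thesis by (simp add: mean_zero_def complex_eq_iff)
qed

section \<open>Primitives, their derivatives and their end point values\<close>

lemma primitive_vderiv:
  assumes w: "abs_cont_on {-pi..pi} w" and v: "represents (vderiv w) v"
  shows "primitive w (vderiv w)"
  unfolding primitive_def
proof (intro conjI ballI)
  show "square_integrable (vderiv w)" using v by (simp add: represents_def)
  show "w x = w (-pi) + integral {-pi..x} (vderiv w)" if "x \<in> {-pi..pi}" for x
    using abs_cont_on_FTC(3)[OF _ w that] by simp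
qed

lemma represents_AE_cong:
  assumes g: "represents g v" and ae: "AE x in leb_pi. f x = g x" and f: "f \<in> borel_measurable leb_pi"
  shows "represents f v"
proof -
  have gs: "square_integrable g" using g by (simp add: represents_def)
  have "integrable leb_pi (\<lambda>x. (cmod (f x))\<^sup>2) \<longleftrightarrow> integrable leb_pi (\<lambda>x. (cmod (g x))\<^sup>2)"
  proof (rule integrable_cong_AE)
    show "(\<lambda>x. (cmod (f x))\<^sup>2) \<in> borel_measurable leb_pi" using f by measurable
    show "(\<lambda>x. (cmod (g x))\<^sup>2) \<in> borel_measurable leb_pi"
      by (rule borel_measurable_integrable) (use gs in \<open>simp add: square_integrable_def\<close>)
    show "AE x in leb_pi. (cmod (f x))\<^sup>2 = (cmod (g x))\<^sup>2" using ae by eventually_elim simp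
  qed
  with f gs have "square_integrable f" by (simp add: square_integrable_def)
  then have "represents f (abs_L2 f)" by (simp add: represents_def)
  then show ?thesis using represents_eq_iff[OF _ g] ae by metis
qed

lemma vderiv_measurable:
  assumes "abs_cont_on {-pi..pi} w"
  shows "vderiv w \<in> borel_measurable leb_pi"
  using abs_cont_on_FTC(2)[OF _ assms] by (simp add: integrable_leb_pi_iff[symmetric] borel_measurable_integrable)

lemma primitive_represents_vderiv:
  assumes w: "primitive w g" and v: "represents g v"
  shows "represents (vderiv w) v"
proof (rule represents_AE_cong[OF v])
  obtain N where "negligible N" "\<And>x. x \<in> {-pi<..<pi} - N \<Longrightarrow> (w has_vector_derivative g x) (at x)"
    using primitive_deriv[OF w] by blast
  then show "AE x in leb_pi. vderiv w x = g x"
    unfolding AE_leb_pi_iff_negligible using vector_derivative_at by blast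
  show "vderiv w \<in> borel_measurable leb_pi" by (rule vderiv_measurable[OF primitive_abs_cont[OF w]])
qed

lemma continuous_on_eq_endpoints:
  fixes f g :: "real \<Rightarrow> complex"
  assumes "continuous_on {-pi..pi} f" "continuous_on {-pi..pi} g"
    and eq: "\<And>x. x \<in> {-pi<..<0} \<union> {0<..<pi} \<Longrightarrow> f x = g x"
  shows "f pi = g pi" "f (-pi) = g (-pi)"
proof -
  \<comment> \<open>The factor \<open>pi / 2\<close> keeps \<open>r n\<close> strictly between 0 and
    \<open>pi\<close>, so that both \<open>r n\<close> and \<open>- r n\<close> lie where
    \<open>f\<close> and \<open>g\<close> are known to agree.\<close>
  define r where "r n = pi - pi / 2 * inverse (real (Suc n))" for n
  have r: "0 < r n" "r n < pi" for n
  proof -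
    have "0 < inverse (real (Suc n))" "inverse (real (Suc n)) \<le> 1" by (auto simp: field_simps)
    then have "0 < pi / 2 * inverse (real (Suc n))" "pi / 2 * inverse (real (Suc n)) \<le> pi / 2 * 1"
      by (intro mult_pos_pos mult_left_mono; simp)+
    then show "0 < r n" "r n < pi" unfolding r_def using pi_gt_zero by linarith+
  qed
  have "r \<longlonglongrightarrow> pi - pi / 2 * 0"
    unfolding r_def[abs_def] by (intro tendsto_intros LIMSEQ_inverse_real_of_nat)
  then have lim: "r \<longlonglongrightarrow> pi" "(\<lambda>n. - r n) \<longlonglongrightarrow> - pi" by (auto intro: tendsto_minus)
  have in1: "r n \<in> {-pi..pi}" "- r n \<in> {-pi..pi}" for n using r[of n] by auto
  have l: "(\<lambda>n. h (r n)) \<longlonglongrightarrow> h pi" "(\<lambda>n. h (- r n)) \<longlonglongrightarrow> h (-pi)" if "continuous_on {-pi..pi} h" for h :: "real \<Rightarrow> complex"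
    using that in1 lim unfolding continuous_on_sequentially o_def by auto
  have "f (r n) = g (r n)" "f (- r n) = g (- r n)" for n using eq[of "r n"] eq[of "- r n"] r[of n] by auto
  then show "f pi = g pi" "f (-pi) = g (-pi)"
    using l(1)[OF assms(1)] l(1)[OF assms(2)] l(2)[OF assms(1)] l(2)[OF assms(2)] LIMSEQ_unique by auto
qed

lemma primitive_rep: "primitive (\<lambda>x. c + integral {-pi..x} (rep_L2 v)) (rep_L2 v)"
  by (simp add: primitive_def rep_L2)

lemma primitive_one: "primitive (\<lambda>_. 1) (\<lambda>_. 0)"
  by (simp add: primitive_def square_integrable_zero)

lemma integral_rep_L2:
  assumes "represents f v" "x \<in> {-pi..pi}"
  shows "integral {-pi..x} f = integral {-pi..x} (rep_L2 v)"
proof -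
  have "AE x in leb_pi. f x = rep_L2 v x"
    using represents_eq_iff[OF assms(1) represents_rep_L2[of v]] by simp
  then obtain N where N: "negligible N" "\<forall>x\<in>{-pi<..<pi} - N. f x = rep_L2 v x"
    unfolding AE_leb_pi_iff_negligible by blast
  show ?thesis
    by (rule integral_spike[of "N \<union> {-pi, pi}"]) (use N assms(2) in auto)
qed

lemma mean_zero_lin:
  assumes "v1 \<in> mean_zero" "v2 \<in> mean_zero"
  shows "scaleC_L2 c1 v1 + scaleC_L2 c2 v2 \<in> mean_zero"
proof -
  note r = primitive_rep[of 0, simplified]
  let ?g = "\<lambda>x. c1 * rep_L2 v1 x + c2 * rep_L2 v2 x"
  have rep: "represents ?g (scaleC_L2 c1 v1 + scaleC_L2 c2 v2)"
    using abs_L2_lin[OF rep_L2(1)[of v1] rep_L2(1)[of v2], of c1 c2] primitive_linear[OF r[of v1] r[of v2], of c1 c2]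
    by (simp add: represents_def rep_L2 primitive_def)
  have "c1 * integral {-pi..pi} (rep_L2 v1) + c2 * integral {-pi..pi} (rep_L2 v2) = integral {-pi..pi} ?g"
    using primitive_linear[OF r[of v1] r[of v2], of c1 c2] unfolding primitive_def by auto
  then show ?thesis
    using assms mean_zero_iff[OF rep] mean_zero_iff[OF represents_rep_L2] by simp
qed

section \<open>The solution operator and the parametrisation of the graph\<close>

context admissible_parameters
begin

text \<open>The primitive vanishing at \<open>-pi\<close> is a normalisation that makes the operator
  linear; other primitives of v add a multiple of \<open>sol_one\<close>. Independence of the chosen
  representative is contained in \<open>abs_L2_sol\<close>.\<close>

definition sol_op :: "L2 \<Rightarrow> L2" where
  "sol_op v = abs_L2 (sol (\<lambda>x. integral {-pi..x} (rep_L2 v)) (rep_L2 v))"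

definition sol_one :: L2 where "sol_one = abs_L2 (sol (\<lambda>_. 1) (\<lambda>_. 0))"

lemma sol_square_integrable: "primitive w g \<Longrightarrow> square_integrable (sol w g)"
  by (intro abs_cont_on_imp_square_integrable sol_abs_cont)

text \<open>\<open>w\<close> is the sum of the constant \<open>w (-pi)\<close> and the normalised
  primitive, and integrals do not distinguish \<open>g\<close> from \<open>rep_L2 v\<close>;
  linearity of the solution does the rest.\<close>

lemma abs_L2_sol:
  assumes w: "primitive w g" and v: "represents g v"
  shows "abs_L2 (sol w g) = sol_op v + scaleC_L2 (w (-pi)) sol_one"
proof -
  note r = primitive_rep[of 0 v, simplified]
  have "abs_L2 (sol w g) = abs_L2 (\<lambda>x. 1 * sol (\<lambda>x. integral {-pi..x} (rep_L2 v)) (rep_L2 v) x + w (-pi) * sol (\<lambda>_. 1) (\<lambda>_. 0) x)"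
  proof (rule abs_L2_eqI[OF sol_square_integrable[OF w]])
    show "square_integrable (\<lambda>x. 1 * sol (\<lambda>x. integral {-pi..x} (rep_L2 v)) (rep_L2 v) x + w (-pi) * sol (\<lambda>_. 1) (\<lambda>_. 0) x)"
      by (rule square_integrable_add; rule square_integrable_cmult)
         (intro sol_square_integrable r primitive_one)+
    fix x :: real assume x: "x \<in> punctured"
    show "sol w g x = 1 * sol (\<lambda>x. integral {-pi..x} (rep_L2 v)) (rep_L2 v) x + w (-pi) * sol (\<lambda>_. 1) (\<lambda>_. 0) x"
    proof (rule sol_linear[OF r primitive_one w _ x])
      fix x :: real assume "x \<in> {-pi<..<pi}"
      then have x: "x \<in> {-pi..pi}" by auto
      then have "w x = w (-pi) + integral {-pi..x} g" using w unfolding primitive_def by blast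
      then show "w x = 1 * integral {-pi..x} (rep_L2 v) + w (-pi) * 1"
        using integral_rep_L2[OF v x] by simp
    qed
  qed
  also have "\<dots> = scaleC_L2 1 (sol_op v) + scaleC_L2 (w (-pi)) sol_one"
    unfolding sol_op_def sol_one_def by (rule abs_L2_lin[symmetric]) (intro sol_square_integrable r primitive_one)+
  finally show ?thesis by (simp add: scaleC_one)
qed

text \<open>\<open>rep_L2\<close> is a choice and need not be linear. Hence the combination of the
  two representatives is used as a representative of the combination, and \<open>abs_L2_sol\<close>
  compares it with the chosen one.\<close>

lemma sol_op_linear: "sol_op (scaleC_L2 c1 v1 + scaleC_L2 c2 v2) = scaleC_L2 c1 (sol_op v1) + scaleC_L2 c2 (sol_op v2)"
proof -
  note r = primitive_rep[of 0, simplified]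
  let ?w = "\<lambda>v x. integral {-pi..x} (rep_L2 v)"
  let ?W = "\<lambda>x. c1 * ?w v1 x + c2 * ?w v2 x" and ?g = "\<lambda>x. c1 * rep_L2 v1 x + c2 * rep_L2 v2 x"
  have p: "primitive ?W ?g" by (rule primitive_linear[OF r r])
  have rep: "represents ?g (scaleC_L2 c1 v1 + scaleC_L2 c2 v2)"
    using abs_L2_lin[OF rep_L2(1)[of v1] rep_L2(1)[of v2], of c1 c2] p
    by (simp add: represents_def rep_L2 primitive_def)
  have "sol_op (scaleC_L2 c1 v1 + scaleC_L2 c2 v2) = abs_L2 (sol ?W ?g)"
    using abs_L2_sol[OF p rep] by (simp add: scaleC_zero_left)
  also have "\<dots> = abs_L2 (\<lambda>x. c1 * sol (?w v1) (rep_L2 v1) x + c2 * sol (?w v2) (rep_L2 v2) x)"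
  proof (rule abs_L2_eqI[OF sol_square_integrable[OF p]])
    show "square_integrable (\<lambda>x. c1 * sol (?w v1) (rep_L2 v1) x + c2 * sol (?w v2) (rep_L2 v2) x)"
      by (rule square_integrable_add; rule square_integrable_cmult) (intro sol_square_integrable r)+
    show "sol ?W ?g x = c1 * sol (?w v1) (rep_L2 v1) x + c2 * sol (?w v2) (rep_L2 v2) x"
      if "x \<in> punctured" for x
      by (rule sol_linear[OF r r p _ that]) simp
  qed
  also have "\<dots> = scaleC_L2 c1 (sol_op v1) + scaleC_L2 c2 (sol_op v2)"
    unfolding sol_op_def by (rule abs_L2_lin[symmetric]) (intro sol_square_integrable r)+
  finally show ?thesis .
qed

lemma sol_op_continuous: "continuous_on UNIV sol_op"
proof -
  obtain K where K: "\<And>w g. primitive w g \<Longrightarrow> w (-pi) = 0 \<Longrightarrow> l2norm (sol w g) \<le> l2norm g * K"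
    using l2norm_sol_le by blast
  note r = primitive_rep[of 0, simplified]
  have "bounded_linear sol_op"
  proof (rule bounded_linear_intro)
    show "sol_op (u + v) = sol_op u + sol_op v" for u v
      using sol_op_linear[of 1 u 1 v] by (simp add: scaleC_one)
    show "sol_op (s *\<^sub>R u) = s *\<^sub>R sol_op u" for s u
      using sol_op_linear[of "of_real s" u 0 u] by (simp add: scaleC_zero_left scaleR_eq_scaleC)
    show "norm (sol_op v) \<le> norm v * K" for v
      using K[OF r[of v]] norm_abs_L2[OF sol_square_integrable[OF r[of v]]] norm_abs_L2[OF rep_L2(1)[of v]]
      by (simp add: sol_op_def rep_L2)
  qed
  then show ?thesis by (rule bounded_linear.continuous_on) (rule continuous_on_id)
qed

lemma L_op_I:
  assumes "v \<in> mean_zero"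
  shows "(sol_op v + scaleC_L2 c sol_one, v) \<in> L_op a b"
proof -
  let ?w = "\<lambda>x. c + integral {-pi..x} (rep_L2 v)"
  note w = primitive_rep[of c v]
  \<comment> \<open>Mean zero makes \<open>?w\<close> periodic, and the common factor at the end
    points makes the solution periodic.\<close>
  have "integral {-pi..pi} (rep_L2 v) = 0"
    using mean_zero_iff[OF represents_rep_L2] assms by simp
  then have "sol ?w (rep_L2 v) (-pi) = sol ?w (rep_L2 v) pi"
    by (simp add: sol_at_singular_points[OF w])
  moreover have "represents (sol ?w (rep_L2 v)) (sol_op v + scaleC_L2 c sol_one)"
    using abs_L2_sol[OF w represents_rep_L2] sol_square_integrable[OF w] by (simp add: represents_def)
  moreover have "represents (vderiv ?w) v"
    by (rule primitive_represents_vderiv[OF w represents_rep_L2])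
  ultimately show ?thesis
    unfolding L_op_def using sol_abs_cont[OF w] primitive_abs_cont[OF w] m_expr_sol[OF w] by blast
qed

text \<open>The function \<open>y\<close> is only locally absolutely continuous here, without any
  condition at 0 or the end points. Uniqueness identifies it with the solution, which is regular at
  these points; periodicity of \<open>w\<close> gives mean zero of v.\<close>

lemma M_S_D:
  assumes "(u, m) \<in> M_op a b" "(m, v) \<in> S_op"
  shows "v \<in> mean_zero \<and> (\<exists>c. u = sol_op v + scaleC_L2 c sol_one)"
proof -
  obtain y where y: "locally_abs_cont_on punctured y" "represents y u" "represents (m_expr a b y) m"
    using assms(1) unfolding M_op_def by blast
  obtain w where w: "abs_cont_on {-pi..pi} w" "w (-pi) = w pi" "represents w m" "represents (vderiv w) v"
    using assms(2) unfolding S_op_def by blast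
  have p: "primitive w (vderiv w)" by (rule primitive_vderiv[OF w(1,4)])
  have ae: "AE x in leb_pi. m_expr a b y x = w x"
    using represents_eq_iff[OF y(3) w(3)] by simp
  have ysq: "square_integrable y" "u = abs_L2 y" using y(2) by (auto simp: represents_def)
  have "abs_L2 y = abs_L2 (sol w (vderiv w))"
    by (rule abs_L2_eqI[OF ysq(1) sol_square_integrable[OF p] sol_unique[OF p y(1) ysq(1) ae]])
  then have "u = sol_op v + scaleC_L2 (w (-pi)) sol_one"
    using abs_L2_sol[OF p w(4)] ysq(2) by simp
  moreover have "integral {-pi..pi} (vderiv w) = 0"
    using abs_cont_on_FTC(3)[OF _ w(1), of pi] w(2) by simp
  ultimately show ?thesis using mean_zero_iff[OF w(4)] by blast
qed

text \<open>\<open>S_op\<close> demands periodicity of \<open>w\<close>, whereas \<open>L_op\<close>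
  grants that of \<open>y\<close>. Off 0 the function \<open>y\<close> is the solution for
  \<open>w\<close>, continuity extends this to the end points, and there both values are the same
  multiple of those of \<open>w\<close>.\<close>

lemma L_op_D:
  assumes "(u, v) \<in> L_op a b"
  shows "(u, v) \<in> M_op a b O S_op"
proof -
  obtain y w where y: "abs_cont_on {-pi..pi} y" "y (-pi) = y pi" "represents y u"
    and w: "abs_cont_on {-pi..pi} w" "represents (vderiv w) v"
    and ae: "AE x in leb_pi. m_expr a b y x = w x"
    using assms unfolding L_op_def by blast
  have p: "primitive w (vderiv w)" by (rule primitive_vderiv[OF w])
  have yl: "locally_abs_cont_on punctured y"
    by (rule abs_cont_on_locally[OF y(1)]) (use pi_gt_zero in auto)
  have ysq: "square_integrable y" using y(3) by (simp add: represents_def)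
  have ends: "y pi = sol w (vderiv w) pi" "y (-pi) = sol w (vderiv w) (-pi)"
    by (rule continuous_on_eq_endpoints[OF abs_cont_on_imp_continuous_on[OF y(1)] sol_continuous[OF p]
          sol_unique[OF p yl ysq ae]]; assumption)+
  then have "sol w (vderiv w) (-pi) = sol w (vderiv w) pi" using y(2) by simp
  then have "(1 / (1 + a)) *\<^sub>R w (-pi) = (1 / (1 + a)) *\<^sub>R w pi"
    unfolding sol_at_singular_points[OF p] .
  then have w_per: "w (-pi) = w pi"
    by (rule scaleR_left_imp_eq[rotated]) (use a_pos in simp)
  have wr: "represents w (abs_L2 w)"
    using abs_cont_on_imp_square_integrable[OF w(1)] by (simp add: represents_def)
  have "represents (m_expr a b y) (abs_L2 w)"
  proof (rule represents_AE_cong[OF wr ae])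
    have c: "continuous_on {-pi<..<pi} y"
      by (rule continuous_on_subset[OF abs_cont_on_imp_continuous_on[OF y(1)]]) auto
    have m1: "(\<lambda>x. complex_of_real (1 - a * cos x) * y x) \<in> borel_measurable leb_pi"
      by (intro continuous_imp_measurable_leb_pi continuous_intros c)
    have m2: "(\<lambda>x. complex_of_real (b * sin x)) \<in> borel_measurable leb_pi"
      by (intro continuous_imp_measurable_leb_pi continuous_intros)
    show "m_expr a b y \<in> borel_measurable leb_pi"
      unfolding m_expr_def[abs_def]
      by (rule borel_measurable_add[OF m1 borel_measurable_times[OF m2 vderiv_measurable[OF y(1)]]])
  qed
  then have "(u, abs_L2 w) \<in> M_op a b" unfolding M_op_def using yl y(3) by blast
  moreover have "(abs_L2 w, v) \<in> S_op" unfolding S_op_def using w w_per wr by blast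
  ultimately show ?thesis by blast
qed

text \<open>The three preceding lemmas form a cycle: from \<open>L_op\<close> to the product, from
  there to the parametrisation by \<open>sol_op\<close> and \<open>sol_one\<close>, and back to
  \<open>L_op\<close>.\<close>

lemma L_op_eq: "L_op a b = M_op a b O S_op"
  using L_op_D M_S_D L_op_I by fastforce

lemma L_op_char: "L_op a b = {(u, v). v \<in> mean_zero \<and> u - sol_op v \<in> range (\<lambda>c. scaleC_L2 c sol_one)}"
proof (intro equalityI subsetI)
  fix x assume "x \<in> L_op a b"
  then obtain u v where x: "x = (u, v)" "(u, v) \<in> M_op a b O S_op" using L_op_eq by (cases x) auto
  then obtain c where "v \<in> mean_zero" "u = sol_op v + scaleC_L2 c sol_one" using M_S_D by blast
  then show "x \<in> {(u, v). v \<in> mean_zero \<and> u - sol_op v \<in> range (\<lambda>c. scaleC_L2 c sol_one)}" using x by auto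
next
  fix x assume "x \<in> {(u, v). v \<in> mean_zero \<and> u - sol_op v \<in> range (\<lambda>c. scaleC_L2 c sol_one)}"
  then obtain u v c where "x = (u, v)" "v \<in> mean_zero" "u - sol_op v = scaleC_L2 c sol_one" by auto
  then show "x \<in> L_op a b" using L_op_I[of v c] by (simp add: algebra_simps)
qed

lemma L_op_mem_iff: "(u, v) \<in> L_op a b \<longleftrightarrow> v \<in> mean_zero \<and> (\<exists>c. u = sol_op v + scaleC_L2 c sol_one)"
  unfolding L_op_char by (auto simp: algebra_simps)

text \<open>Both conditions of the parametrisation are preimages of closed sets under continuous
  maps, the second because \<open>sol_op\<close> is continuous and the complex line of
  \<open>sol_one\<close> is closed.\<close>

lemma closed_L_op: "closed (L_op a b)"
proof -
  have "L_op a b = snd -` mean_zero \<inter> (\<lambda>x. fst x - sol_op (snd x)) -` range (\<lambda>c. scaleC_L2 c sol_one)"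
    unfolding L_op_char by auto
  moreover have "closed (snd -` mean_zero :: (L2 \<times> L2) set)"
    by (intro closed_vimage closed_mean_zero continuous_intros)
  moreover have "closed ((\<lambda>x. fst x - sol_op (snd x)) -` range (\<lambda>c. scaleC_L2 c sol_one))"
    by (intro closed_vimage closed_complex_line continuous_intros continuous_on_compose2[OF sol_op_continuous]) auto
  ultimately show ?thesis by (simp add: closed_Int)
qed

lemma linear_operator_L_op: "linear_operator (L_op a b)"
proof -
  have lin: "(scaleC_L2 c1 u1 + scaleC_L2 c2 u2, scaleC_L2 c1 v1 + scaleC_L2 c2 v2) \<in> L_op a b"
    if L: "(u1, v1) \<in> L_op a b" "(u2, v2) \<in> L_op a b" for c1 c2 u1 u2 v1 v2
  proof -
    obtain k1 k2 where k: "v1 \<in> mean_zero" "v2 \<in> mean_zero" "u1 = sol_op v1 + scaleC_L2 k1 sol_one" "u2 = sol_op v2 + scaleC_L2 k2 sol_one"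
      using L unfolding L_op_mem_iff by blast
    have "scaleC_L2 c1 u1 + scaleC_L2 c2 u2
        = sol_op (scaleC_L2 c1 v1 + scaleC_L2 c2 v2) + scaleC_L2 (c1 * k1 + c2 * k2) sol_one"
      unfolding k(3,4) sol_op_linear scaleC_add_right scaleC_add_left scaleC_scaleC by (simp add: algebra_simps)
    then show ?thesis unfolding L_op_mem_iff using mean_zero_lin[OF k(1,2)] by blast
  qed
  have zero: "(0, 0) \<in> L_op a b"
  proof -
    have z: "(0::L2) \<in> mean_zero" by (simp add: mean_zero_def)
    have "(sol_op 0 + scaleC_L2 0 sol_one, 0) \<in> L_op a b" by (rule L_op_I[OF z])
    moreover have "sol_op 0 = 0" using sol_op_linear[of 0 0 0 0] by (simp add: scaleC_zero_left)
    ultimately show ?thesis by (simp add: scaleC_zero_left)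
  qed
  \<comment> \<open>The parametrisation expresses u through v, not v through u; single-valuedness is
    inherited from the two factors.\<close>
  have "single_valued (L_op a b)"
    unfolding L_op_eq by (rule single_valued_relcomp[OF single_valued_M_op single_valued_S_op])
  moreover have "(u + u', v + v') \<in> L_op a b" if "(u, v) \<in> L_op a b" "(u', v') \<in> L_op a b" for u v u' v'
    using lin[OF that, of 1 1] by (simp add: scaleC_one)
  moreover have "(scaleC_L2 c u, scaleC_L2 c v) \<in> L_op a b" if "(u, v) \<in> L_op a b" for c u v
    using lin[OF that that, of c 0] by (simp add: scaleC_zero_left)
  ultimately show ?thesis unfolding linear_operator_def using zero by blast
qed

lemma Range_L_op: "Range (L_op a b) = mean_zero"
  by (blast intro: L_op_I[THEN RangeI] dest: L_op_mem_iff[THEN iffD1])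

end

theorem theorem1:
  fixes a b :: real
  assumes "a > 0" and "b > 0" and "2 * a + b < 2"
  shows "closed_operator (L_op a b) \<and> closed (Range (L_op a b)) \<and> L_op a b = M_op a b O S_op"
proof -
  interpret admissible_parameters a b
    by unfold_locales (fact assms)+
  show ?thesis
    unfolding closed_operator_def Range_L_op
    using linear_operator_L_op closed_L_op closed_mean_zero L_op_eq by blast
qed

end
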